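(* Let $f$ be a continuous compactly supported $\mathbb{C}^2$-valued function on $\mathbb{R}$. Then for each $n\in\mathbb{Z}$, $j\in\{1,2\}$ and $x\in[0,\pi]$, the function $t\mapsto (P_{n,j}(t)f_t)(x)$ is integrable over $E(h)$, over $\gamma(0,h)$ and over $\gamma(1,h)$. Moreover, if $\lambda_{n,j}(0)$ is not an ESS of $L(Q)$, then this function is integrable over $(-h,h)$, and if $\lambda_{n,j}(1)$ is not an ESS, it is integrable over $(1-h,1+h)$.
   Context: Let $p,q$ be $\pi$-periodic complex-valued functions on $\mathbb{R}$ of bounded variation on $[0,\pi]$, $Q(x)=\begin{pmatrix}p(x)&q(x)\\ q(x)&-p(x)\end{pmatrix}$, $J=\begin{pmatrix}0&1\\-1&0\end{pmatrix}$, $l(\mathbf y,Q)=J\mathbf y'+Q\mathbf y$. $L(Q)$ is the operator in $L_2^2(-\infty,\infty)$ generated by $l$; for $t\in\mathbb{C}$, $L_t(Q)$ is the operator in $L_2^2[0,\pi]$ generated by $l$ and $\mathbf y(\pi)=e^{i\pi t}\mathbf y(0)$. $\mathbf c,\mathbf s$ solve $l(\mathbf y,Q)=\lambda\mathbf y$ with $\mathbf c(0)=(1,0)^T$, $\mathbf s(0)=(0,1)^T$; $F(\lambda)=c_1(\pi,\lambda)+s_2(\pi,\lambda)$; eigenvalues of $L_t(Q)$ are the roots of $F(\lambda)=2\cos\pi t$, labeled $\lambda_{n,j}(t)$ ($n\in\mathbb{Z}$, $j=1,2$) so that $\lambda_{n,j}(t)$ is analytic in $t$ near any point where it is simple, and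 simple except at finitely many $t$ in any bounded set. When $\lambda_{n,j}(t)$ is simple: $\Psi_{n,j,t}$, $\Psi^*_{n,j,t}$ are unit-norm eigenfunctions of $L_t(Q)$ and of its adjoint $L_{\bar t}(\bar Q)$ (eigenvalue $\overline{\lambda_{n,j}(t)}$), $\alpha_{n,j}(t)=(\Psi_{n,j,t},\Psi^*_{n,j,t})$, and $P_{n,j}(t)g=\frac{(g,\Psi^*_{n,j,t})}{(\Psi_{n,j,t},\Psi^*_{n,j,t})}\Psi_{n,j,t}$ is the Riesz projection (the paper's $a_{n,j}(t)\Psi_{n,j,t}$); $\|P_{n,j}(t)\|=1/|\alpha_{n,j}(t)|$. ESS: $\lambda_0=\lambda_{n,j}(t_0)$, $t_0\in(-1,1]$, such that for every $\varepsilon>0$, $1/\alpha_{n,j}$ is not integrable on $(t_0-\varepsilon,t_0+\varepsilon)$. For $f$ as in the claim, $f_t(x)=\sum_{k\in\mathbb{Z}}f(x+k\pi)e^{-i\pi kt}$ (a finite sum for $x$ in a bounded set), and $P_{n,j}(t)f_t$ means $P_{n,j}(t)$ applied to $f_t|_{[0,\pi]}$. Fix $h\in(0,1/10)$, $D_h=\{t:|\operatorname{Im}t|\le2h,\ -h\le\operatorname{Re}t\le2-h\}$; $A$ is the set of $t\in D_h$ for which some eigenvalue $\lambda$ of $L_t(Q)$ satisfies $F'(\lambda)=0$ or $s_1(\pi,\lambda)=0$ (its only accumulation points are $0,1$). Assume $h\notin\overline A$ and the semicircles $\gamma(0,h)=\{|t|=h,\operatorname{Im}t\ge0\}$, $\gamma(1,h)=\{|t-1|=h,\operatorname{Im}t\ge0\}$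 do not meet $A$. $B(h)=[h,1-h]\cup[1+h,2-h]$ and $E(h)$ is $B(h)$ minus the finitely many points of $A$ lying in $B(h)$. *)

theory Defs
  imports "HOL-Analysis.Analysis" "HOL-Complex_Analysis.Complex_Analysis"
begin

definition bv_on :: "(real \<Rightarrow> complex) \<Rightarrow> real \<Rightarrow> real \<Rightarrow> bool" where
  "bv_on f a b \<longleftrightarrow> (\<exists>B. \<forall>xs::real list. sorted xs \<and> set xs \<subseteq> {a..b} \<longrightarrow>
      (\<Sum>i<length xs - 1. cmod (f (xs ! Suc i) - f (xs ! i))) \<le> B)"

(* right-hand side of y' = -J(\<lambda> - Q)y, i.e. of J y' + Q y = \<lambda> y,
   Q = [[p,q],[q,-p]], J = [[0,1],[-1,0]] *)
definition dirac_rhs :: "(real \<Rightarrow> complex) \<Rightarrow> (real \<Rightarrow> complex) \<Rightarrow> complex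
    \<Rightarrow> (real \<Rightarrow> complex \<times> complex) \<Rightarrow> real \<Rightarrow> complex \<times> complex" where
  "dirac_rhs p q lam y s =
     (q s * fst (y s) - (lam + p s) * snd (y s), (lam - p s) * fst (y s) - q s * snd (y s))"

(* y solves l(y,Q) = lam y on [0,pi] with y(0) = y0 (integral form); y := 0 off [0,pi] *)
definition is_sol :: "(real \<Rightarrow> complex) \<Rightarrow> (real \<Rightarrow> complex) \<Rightarrow> complex
    \<Rightarrow> complex \<times> complex \<Rightarrow> (real \<Rightarrow> complex \<times> complex) \<Rightarrow> bool" where
  "is_sol p q lam y0 y \<longleftrightarrow>
     (\<forall>x\<in>{0..pi}. (dirac_rhs p q lam y has_integral (y x - y0)) {0..x}) \<and>
     (\<forall>x. x \<notin> {0..pi} \<longrightarrow> y x = 0)"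

definition sol :: "(real \<Rightarrow> complex) \<Rightarrow> (real \<Rightarrow> complex) \<Rightarrow> complex
    \<Rightarrow> complex \<times> complex \<Rightarrow> real \<Rightarrow> complex \<times> complex" where
  "sol p q lam y0 = (THE y. is_sol p q lam y0 y)"

definition csol :: "(real \<Rightarrow> complex) \<Rightarrow> (real \<Rightarrow> complex) \<Rightarrow> complex \<Rightarrow> real \<Rightarrow> complex \<times> complex" where "csol p q lam = sol p q lam (1, 0)"
definition ssol :: "(real \<Rightarrow> complex) \<Rightarrow> (real \<Rightarrow> complex) \<Rightarrow> complex \<Rightarrow> real \<Rightarrow> complex \<times> complex" where "ssol p q lam = sol p q lam (0, 1)"

definition hillF :: "(real \<Rightarrow> complex) \<Rightarrow> (real \<Rightarrow> complex) \<Rightarrow> complex \<Rightarrow> complex" where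
  "hillF p q lam = fst (csol p q lam pi) + snd (ssol p q lam pi)"

definition eigfun :: "(real \<Rightarrow> complex) \<Rightarrow> (real \<Rightarrow> complex) \<Rightarrow> complex \<Rightarrow> complex
    \<Rightarrow> (real \<Rightarrow> complex \<times> complex) \<Rightarrow> bool" where
  "eigfun p q t lam y \<longleftrightarrow> (\<exists>y0. y0 \<noteq> 0 \<and> is_sol p q lam y0 y \<and> y pi = (exp (\<i> * complex_of_real pi * t) * fst (y 0), exp (\<i> * complex_of_real pi * t) * snd (y 0)))"

definition ip :: "(real \<Rightarrow> complex \<times> complex) \<Rightarrow> (real \<Rightarrow> complex \<times> complex) \<Rightarrow> complex" where
  "ip u v = integral {0..pi} (\<lambda>s. fst (u s) * cnj (fst (v s)) + snd (u s) * cnj (snd (v s)))"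

definition l2norm :: "(real \<Rightarrow> complex \<times> complex) \<Rightarrow> real" where
  "l2norm u = sqrt (Re (ip u u))"

definition simple_eig :: "(real \<Rightarrow> complex) \<Rightarrow> (real \<Rightarrow> complex) \<Rightarrow> complex \<Rightarrow> complex \<Rightarrow> bool" where
  "simple_eig p q t lam \<longleftrightarrow> hillF p q lam = 2 * cos (complex_of_real pi * t) \<and> deriv (hillF p q) lam \<noteq> 0"

(* eigenfunction of L_t(Q) and of the adjoint L_{cnj t}(cnj Q) at cnj lam *)
definition psi :: "(real \<Rightarrow> complex) \<Rightarrow> (real \<Rightarrow> complex) \<Rightarrow> complex \<Rightarrow> complex \<Rightarrow> real \<Rightarrow> complex \<times> complex" where "psi p q t lam = (SOME y. eigfun p q t lam y)"
definition psistar :: "(real \<Rightarrow> complex) \<Rightarrow> (real \<Rightarrow> complex) \<Rightarrow> complex \<Rightarrow> complex \<Rightarrow> real \<Rightarrow> complex \<times> complex" where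
  "psistar p q t lam = (SOME y. eigfun (\<lambda>x. cnj (p x)) (\<lambda>x. cnj (q x)) (cnj t) (cnj lam) y)"

definition riesz_proj :: "(real \<Rightarrow> complex) \<Rightarrow> (real \<Rightarrow> complex) \<Rightarrow> complex \<Rightarrow> complex
    \<Rightarrow> (real \<Rightarrow> complex \<times> complex) \<Rightarrow> real \<Rightarrow> complex \<times> complex" where
  "riesz_proj p q t lam g x =
     (if simple_eig p q t lam then
        (let a = ip g (psistar p q t lam) / ip (psi p q t lam) (psistar p q t lam)
         in (a * fst (psi p q t lam x), a * snd (psi p q t lam x)))
      else 0)"

(* abs alpha = abs (Psi,PsiS) for unit-norm eigenfunctions *)
definition alpha_abs :: "(real \<Rightarrow> complex) \<Rightarrow> (real \<Rightarrow> complex) \<Rightarrow> complex \<Rightarrow> complex \<Rightarrow> real" where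
  "alpha_abs p q t lam =
     (if simple_eig p q t lam then
        cmod (ip (psi p q t lam) (psistar p q t lam)) /
          (l2norm (psi p q t lam) * l2norm (psistar p q t lam))
      else 0)"

definition is_ESS :: "(real \<Rightarrow> complex) \<Rightarrow> (real \<Rightarrow> complex) \<Rightarrow> (int \<Rightarrow> nat \<Rightarrow> complex \<Rightarrow> complex)
    \<Rightarrow> complex \<Rightarrow> bool" where
  "is_ESS p q lamf mu \<longleftrightarrow> (\<exists>n j t0. j \<in> {1,2} \<and> t0 \<in> {-1<..1} \<and> lamf n j (of_real t0) = mu \<and>
      (\<forall>e>0. \<not> ((\<lambda>t. 1 / alpha_abs p q (of_real t) (lamf n j (of_real t)))
                   absolutely_integrable_on {t0 - e<..<t0 + e})))"

(* f_t(x) = sum_k f(x + k pi) e^{-i pi k t}  (finite sum for compactly supported f) *)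
definition ft :: "(real \<Rightarrow> complex \<times> complex) \<Rightarrow> complex \<Rightarrow> real \<Rightarrow> complex \<times> complex" where
  "ft f t x = (\<Sum>k\<in>{k::int. f (x + of_int k * pi) \<noteq> 0}.
      (exp (- \<i> * complex_of_real pi * of_int k * t) * fst (f (x + of_int k * pi)),
       exp (- \<i> * complex_of_real pi * of_int k * t) * snd (f (x + of_int k * pi))))"

definition Dh :: "real \<Rightarrow> complex set" where
  "Dh h = {t. \<bar>Im t\<bar> \<le> 2 * h \<and> - h \<le> Re t \<and> Re t \<le> 2 - h}"

definition Aset :: "(real \<Rightarrow> complex) \<Rightarrow> (real \<Rightarrow> complex) \<Rightarrow> real \<Rightarrow> complex set" where
  "Aset p q h = {t \<in> Dh h. \<exists>lam. hillF p q lam = 2 * cos (complex_of_real pi * t) \<and>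
       (deriv (hillF p q) lam = 0 \<or> fst (ssol p q lam pi) = 0)}"

definition semicirc :: "complex \<Rightarrow> real \<Rightarrow> complex set" where
  "semicirc c h = {t. cmod (t - c) = h \<and> Im t \<ge> 0}"

definition semicirc_path :: "complex \<Rightarrow> real \<Rightarrow> real \<Rightarrow> complex" where
  "semicirc_path c h s = c + of_real h * exp (\<i> * complex_of_real pi * of_real s)"

definition Bset :: "real \<Rightarrow> real set" where
  "Bset h = {h..1 - h} \<union> {1 + h..2 - h}"

definition Eset :: "(real \<Rightarrow> complex) \<Rightarrow> (real \<Rightarrow> complex) \<Rightarrow> real \<Rightarrow> real set" where
  "Eset p q h = Bset h - {t. complex_of_real t \<in> Aset p q h}"

end

theory Submission
  imports Defs
begin

text \<open>
  Write \<open>Y = (c, s)\<close> for the fundamental matrix, \<open>M = Y(\<pi>)\<close>, \<open>\<rho> = e\<^sup>i\<^sup>\<pi>\<^sup>t\<close>. At a simple eigenvalue \<open>\<lambda>\<close> the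
  eigenvectors \<open>v\<close> of \<open>M\<close> (for \<open>\<rho>\<close>) and \<open>w\<close> (for \<open>1/\<rho>\<close>, from the adjoint problem) satisfy
  \<open>v w\<^sup>T \<parallel> K = (M - 1/\<rho>) J\<close>, while the Wronskian identity gives \<open>F' = - \<Sum> K\<^sub>i\<^sub>j G\<^sub>i\<^sub>j\<close> with
  \<open>G = \<integral> Y\<^sup>T Y\<close>. Hence \<open>P g (x) = - Y(x) K (\<integral> Y\<^sup>T g) / F'(\<lambda>)\<close>, and everything reduces to bounds for
  \<open>1 / F'(\<lambda>(t))\<close>.

  On the real line away from the integers, let \<open>F'\<close> vanish to order \<open>m\<close> at \<open>\<lambda>(t\<^sub>0)\<close>. From
  \<open>\<bar>t - t\<^sub>0\<bar> \<lesssim> \<bar>cos \<pi>t - cos \<pi>t\<^sub>0\<bar> \<lesssim> \<bar>\<lambda>(t) - \<lambda>(t\<^sub>0)\<bar>\<^sup>m\<^sup>+\<^sup>1\<close> one gets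
  \<open>1 / \<bar>F'(\<lambda>(t))\<bar> \<lesssim> \<bar>t - t\<^sub>0\<bar> powr (-m/(m+1))\<close>, which is integrable. Near an integer the projection is
  bounded by a multiple of \<open>1 / \<bar>\<alpha>\<bar>\<close>. On the semicircles \<open>1 / F'\<close> is bounded over all eigenvalues at once: the eigenvalues
  lie in a horizontal strip, where bounded variation gives \<open>F = 2 cos \<pi>\<lambda> + O(1/\<bar>\<lambda>\<bar>)\<close> and, by Cauchy's
  estimate, \<open>F'\<^sup>2 = 4 \<pi>\<^sup>2 sin\<^sup>2 \<pi>t + O(1/\<bar>\<lambda>\<bar>)\<close>; for bounded \<open>\<lambda>\<close> compactness suffices.
\<close>

section \<open>Functions of bounded variation\<close>

text \<open>Three obstacles shape the proof. With \<open>p\<close> and \<open>q\<close> only of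
  bounded variation, solutions are Lipschitz but need not be differentiable everywhere. So
  differential identities are stated as integrals, and F is shown to be entire not by
  differentiating solutions in \<lambda> but from an exact formula for F(\<lambda>) - F(\<mu>) with
  the factor \<lambda> - \<mu>. Next, \<open>psi\<close> and \<open>psistar\<close> are arbitrary
  choices with no regularity in t; the formula for P eliminates them and leaves quantities
  continuous in (t, \<lambda>), which yields measurability as well as the estimates. Finally,
  continuity of a label on an open semicircle does not by itself bound it near the end points, which
  is why the estimate there is uniform over all eigenvalues. The exponent m/(m+1) compares the order
  m of F' with the order m+1 of F - F(\<lambda>(t0)); it is below 1 for every m, so an eigenvalue
  may be arbitrarily degenerate. At an integer the derivative of cos \<pi>t vanishes, the first
  inequality of the chain fails, and the ESS hypothesis has to take over.\<close>

lemma variation_monotone_decomposition: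
  fixes r :: "real \<Rightarrow> real"
  assumes bd: "\<And>xs. sorted xs \<Longrightarrow> set xs \<subseteq> {a..b} \<Longrightarrow>
      (\<Sum>i<length xs - 1. \<bar>r (xs ! Suc i) - r (xs ! i)\<bar>) \<le> B"
  obtains g h where "mono_on {a..b} g" "mono_on {a..b} h" "\<And>x. x \<in> {a..b} \<Longrightarrow> r x = g x - h x"
proof -
  define var where "var xs = (\<Sum>i<length xs - 1. \<bar>r (xs ! Suc i) - r (xs ! i)\<bar>)" for xs
  \<comment> \<open>Total variation of \<open>r\<close> on {a..x}. Over [x, y] it grows by at least
    \<bar>r y - r x\<bar>, so \<open>V\<close> and \<open>V - r\<close> are both monotone: the
    Jordan decomposition.\<close>
  define V where "V x = Sup (var ` {xs. sorted xs \<and> set xs \<subseteq> {a..x}})" for x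
  have bdd: "bdd_above (var ` {xs. sorted xs \<and> set xs \<subseteq> {a..x}})" if "x \<le> b" for x
  proof (rule bdd_aboveI2[where M = B])
    fix xs assume "xs \<in> {xs. sorted xs \<and> set xs \<subseteq> {a..x}}"
    then have "sorted xs" "set xs \<subseteq> {a..b}" using that by auto
    then show "var xs \<le> B" unfolding var_def by (rule bd)
  qed
  have step: "V x + \<bar>r y - r x\<bar> \<le> V y" if "a \<le> x" "x \<le> y" "y \<le> b" for x y
  proof -
    have "V x \<le> V y - \<bar>r y - r x\<bar>"
      unfolding V_def[of x]
    proof (rule cSUP_least)
      show "{xs. sorted xs \<and> set xs \<subseteq> {a..x}} \<noteq> {}" by (auto intro: exI[of _ "[]"])
      fix xs assume xs: "xs \<in> {xs. sorted xs \<and> set xs \<subseteq> {a..x}}"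
      \<comment> \<open>Appending both points makes index \<open>length xs\<close> the increment
        from \<open>x\<close> to \<open>y\<close>. The increment from the last entry of
        \<open>xs\<close> to \<open>x\<close> is nonnegative and is dropped, so an empty
        \<open>xs\<close> is no special case.\<close>
      define ys where "ys = xs @ [x, y]"
      have ys: "ys \<in> {xs. sorted xs \<and> set xs \<subseteq> {a..y}}"
        using xs that by (auto simp: ys_def sorted_append subset_iff)
      have "var xs + \<bar>r y - r x\<bar> = (\<Sum>i<length xs - 1. \<bar>r (ys ! Suc i) - r (ys ! i)\<bar>)
              + \<bar>r (ys ! Suc (length xs)) - r (ys ! (length xs))\<bar>"
        unfolding var_def by (intro arg_cong2[where f = "(+)"] sum.cong) (auto simp: ys_def nth_append)
      also have "\<dots> = (\<Sum>i\<in>insert (length xs) {..<length xs - 1}. \<bar>r (ys ! Suc i) - r (ys ! i)\<bar>)"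
        by (subst sum.insert) auto
      also have "\<dots> \<le> var ys"
        unfolding var_def by (rule sum_mono2) (auto simp: ys_def)
      also have "\<dots> \<le> V y"
        unfolding V_def by (rule cSUP_upper[OF ys bdd[OF that(3)]])
      finally show "var xs \<le> V y - \<bar>r y - r x\<bar>" by simp
    qed
    then show ?thesis by simp
  qed
  show ?thesis
  proof (rule that[of V "\<lambda>x. V x - r x"])
    show "mono_on {a..b} V" "mono_on {a..b} (\<lambda>x. V x - r x)"
      by (intro mono_onI; use step in fastforce)+
  qed auto
qed

lemma bv_on_monotone_decomposition:
  assumes "bv_on f a b"
  obtains g1 g2 g3 g4 :: "real \<Rightarrow> real" where
    "mono_on {a..b} g1" "mono_on {a..b} g2" "mono_on {a..b} g3" "mono_on {a..b} g4"
    "\<And>x. x \<in> {a..b} \<Longrightarrow> f x = (of_real (g1 x) - of_real (g2 x)) + \<i> * (of_real (g3 x) - of_real (g4 x))"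
proof -
  obtain B where B: "\<And>xs. sorted xs \<Longrightarrow> set xs \<subseteq> {a..b} \<Longrightarrow>
      (\<Sum>i<length xs - 1. cmod (f (xs ! Suc i) - f (xs ! i))) \<le> B"
    using assms unfolding bv_on_def by blast
  have re: "(\<Sum>i<length xs - 1. \<bar>Re (f (xs ! Suc i)) - Re (f (xs ! i))\<bar>) \<le> B"
    if "sorted xs" "set xs \<subseteq> {a..b}" for xs
    by (rule order_trans[OF sum_mono B[OF that]]) (metis abs_Re_le_cmod minus_complex.simps(1))
  have im: "(\<Sum>i<length xs - 1. \<bar>Im (f (xs ! Suc i)) - Im (f (xs ! i))\<bar>) \<le> B"
    if "sorted xs" "set xs \<subseteq> {a..b}" for xs
    by (rule order_trans[OF sum_mono B[OF that]]) (metis abs_Im_le_cmod minus_complex.simps(2))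
  obtain g1 g2 where g: "mono_on {a..b} g1" "mono_on {a..b} g2"
      "\<And>x. x \<in> {a..b} \<Longrightarrow> Re (f x) = g1 x - g2 x"
    using variation_monotone_decomposition[of a b "\<lambda>x. Re (f x)", OF re] by metis
  obtain g3 g4 where g': "mono_on {a..b} g3" "mono_on {a..b} g4"
      "\<And>x. x \<in> {a..b} \<Longrightarrow> Im (f x) = g3 x - g4 x"
    using variation_monotone_decomposition[of a b "\<lambda>x. Im (f x)", OF im] by metis
  show ?thesis
    by (rule that[OF g(1,2) g'(1,2)]) (auto simp: complex_eq_iff g(3) g'(3))
qed

lemma bv_on_integrable:
  assumes "bv_on f a b"
  shows "f integrable_on {a..b}"
proof -
  obtain g1 g2 g3 g4 :: "real \<Rightarrow> real" where g:
    "mono_on {a..b} g1" "mono_on {a..b} g2" "mono_on {a..b} g3" "mono_on {a..b} g4"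
    and f: "\<And>x. x \<in> {a..b} \<Longrightarrow> f x = (of_real (g1 x) - of_real (g2 x)) + \<i> * (of_real (g3 x) - of_real (g4 x))"
    using bv_on_monotone_decomposition[OF assms] by metis
  have "(\<lambda>x. (of_real (g1 x) - of_real (g2 x)) + \<i> * (of_real (g3 x) - of_real (g4 x))) integrable_on {a..b}"
    by (intro integrable_add integrable_diff integrable_on_mult_right
        integrable_linear[OF _ bounded_linear_of_real, unfolded o_def] integrable_on_mono_on g)
  then show ?thesis
    by (rule integrable_eq) (simp add: f)
qed

lemma bv_on_bounded:
  assumes "bv_on f a b"
  obtains C where "C > 0" "\<And>x. x \<in> {a..b} \<Longrightarrow> cmod (f x) \<le> C"
proof (cases "a \<le> b")
  case True
  obtain B where B: "\<And>xs. sorted xs \<Longrightarrow> set xs \<subseteq> {a..b} \<Longrightarrow>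
      (\<Sum>i<length xs - 1. cmod (f (xs ! Suc i) - f (xs ! i))) \<le> B"
    using assms unfolding bv_on_def by blast
  have "cmod (f x) \<le> \<bar>B\<bar> + cmod (f a) + 1" if "x \<in> {a..b}" for x
  proof -
    have "cmod (f x - f a) \<le> B" using B[of "[a, x]"] that by simp
    then show ?thesis using norm_triangle_sub[of "f x" "f a"] by linarith
  qed
  then show ?thesis by (intro that[of "\<bar>B\<bar> + cmod (f a) + 1"]) (auto intro: add_nonneg_pos)
qed (auto intro: that[of 1])

section \<open>Integral equations\<close>

text \<open>A gauge integrable function times a continuous one need not be integrable; the bound
  \<open>K\<close> provides the majorant \<open>K * cmod (u s)\<close>.\<close>

lemma integrable_on_mult_continuous:
  fixes a u :: "real \<Rightarrow> complex"
  assumes a: "a integrable_on {c..d}" and bd: "\<And>s. s \<in> {c..d} \<Longrightarrow> cmod (a s) \<le> K"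
    and u: "continuous_on {c..d} u"
  shows "(\<lambda>s. a s * u s) integrable_on {c..d}"
proof (rule measurable_bounded_by_integrable_imp_integrable)
  show "(\<lambda>s. a s * u s) \<in> borel_measurable (lebesgue_on {c..d})"
    by (intro borel_measurable_times integrable_imp_measurable[OF a]
        continuous_imp_measurable_on_sets_lebesgue u) auto
  show "(\<lambda>s. K * cmod (u s)) integrable_on {c..d}"
    by (intro integrable_continuous_real continuous_intros u)
qed (auto simp: norm_mult intro!: mult_right_mono bd)

lemma has_integral_diff_interval:
  fixes a :: "real \<Rightarrow> 'a::banach"
  assumes "\<And>x. x \<in> {0..T} \<Longrightarrow> (a has_integral u x) {0..x}"
    and "0 \<le> x" "x \<le> y" "y \<le> T"
  shows "(a has_integral (u y - u x)) {x..y}"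
proof -
  have "a integrable_on {0..y}" using assms(1)[of y] assms(2-4) by (auto simp: integrable_on_def)
  then have i: "a integrable_on {x..y}"
    by (rule integrable_subinterval_real) (use assms in auto)
  have "(a has_integral (u x + integral {x..y} a)) {0..y}"
    using assms(2,3) assms(1)[of x] integrable_integral[OF i] assms(4)
    by (intro has_integral_combine) auto
  moreover have "(a has_integral u y) {0..y}" using assms(1)[of y] assms(2-4) by auto
  ultimately have "u y = u x + integral {x..y} a" by (rule has_integral_unique[symmetric])
  then show ?thesis using integrable_integral[OF i] by simp
qed

lemma has_integral_interval_bound:
  fixes a :: "real \<Rightarrow> 'a::euclidean_space"
  assumes "(a has_integral I) {x..y}" "x \<le> y" "\<And>s. s \<in> {x..y} \<Longrightarrow> norm (a s) \<le> K"
  shows "norm I \<le> K * (y - x)"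
proof -
  have "norm (integral {x..y} a) \<le> integral {x..y} (\<lambda>_. K)"
    using assms by (intro integral_norm_bound_integral) (auto simp: integrable_on_def)
  then show ?thesis using assms by (auto simp: has_integral_iff mult.commute)
qed

lemma has_integral_norm_bound:
  fixes f :: "real \<Rightarrow> 'a::euclidean_space"
  assumes "(f has_integral I) S" "(g has_integral J) S" "\<And>x. x \<in> S \<Longrightarrow> norm (f x) \<le> g x"
  shows "norm I \<le> J"
  using integral_norm_bound_integral[of f S g] assms by (auto simp: has_integral_iff)

lemma indefinite_integral_lipschitz:
  fixes a :: "real \<Rightarrow> 'a::euclidean_space"
  assumes "\<And>x. x \<in> {0..T} \<Longrightarrow> (a has_integral (u x - c)) {0..x}"
    and bd: "\<And>s. s \<in> {0..T} \<Longrightarrow> norm (a s) \<le> K"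
    and "x \<in> {0..T}" "y \<in> {0..T}"
  shows "norm (u y - u x) \<le> K * \<bar>y - x\<bar>"
proof -
  have *: "norm (u y - u x) \<le> K * (y - x)" if "0 \<le> x" "x \<le> y" "y \<le> T" for x y
    using has_integral_interval_bound[OF has_integral_diff_interval[of T a, OF assms(1) that] \<open>x \<le> y\<close>, of K]
      bd that by auto
  show ?thesis
    using *[of x y] *[of y x] assms(3,4) by (cases "x \<le> y") (auto simp: norm_minus_commute)
qed

lemma indefinite_integral_continuous:
  fixes a :: "real \<Rightarrow> 'a::euclidean_space"
  assumes "\<And>x. x \<in> {0..T} \<Longrightarrow> (a has_integral (u x - c)) {0..x}"
  shows "continuous_on {0..T} u"
proof (cases "0 \<le> T")
  case True
  then have "a integrable_on {0..T}" using assms[of T] by (auto simp: integrable_on_def)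
  then have "continuous_on {0..T} (\<lambda>x. c + integral {0..x} a)"
    by (intro continuous_intros indefinite_integral_continuous_1)
  moreover have "c + integral {0..x} a = u x" if "x \<in> {0..T}" for x
    using assms[OF that] by (simp add: has_integral_iff)
  ultimately show ?thesis by (rule continuous_on_eq)
qed simp

text \<open>Difference quotients at x are at most C \<bar>y - x\<bar>, so the derivative exists and
  is 0 even though no factor of \<open>w\<close> is known to be differentiable.\<close>

lemma constant_if_quadratic_increments:
  fixes w :: "real \<Rightarrow> 'a::real_normed_vector"
  assumes "\<And>x y. 0 \<le> x \<Longrightarrow> x \<le> y \<Longrightarrow> y \<le> T \<Longrightarrow> norm (w y - w x) \<le> C * (y - x)\<^sup>2"
    and "x \<in> {0..T}"
  shows "w x = w 0"
proof -
  have q: "norm (w y - w x) \<le> C * \<bar>y - x\<bar> * \<bar>y - x\<bar>" if "x \<in> {0..T}" "y \<in> {0..T}" for x y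
    using assms(1)[of x y] assms(1)[of y x] that
    by (cases "x \<le> y") (auto simp: power2_eq_square norm_minus_commute mult.assoc)
  have "(w has_derivative (\<lambda>h. 0)) (at x within {0..T})" if x: "x \<in> {0..T}" for x
  proof -
    have "((\<lambda>y. C * \<bar>y - x\<bar>) \<longlongrightarrow> C * \<bar>x - x\<bar>) (at x within {0..T})"
      by (intro tendsto_intros)
    then have lim: "((\<lambda>y. C * \<bar>y - x\<bar>) \<longlongrightarrow> 0) (at x within {0..T})" by simp
    have "((\<lambda>y. (w y - w x) /\<^sub>R norm (y - x)) \<longlongrightarrow> 0) (at x within {0..T})"
    proof (rule Lim_null_comparison[OF _ lim])
      show "\<forall>\<^sub>F y in at x within {0..T}. norm ((w y - w x) /\<^sub>R norm (y - x)) \<le> C * \<bar>y - x\<bar>"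
        unfolding eventually_at
        by (rule exI[of _ 1]) (use q x in \<open>auto simp: divide_simps mult.commute\<close>)
    qed
    then show ?thesis by (simp add: has_derivative_within bounded_linear_zero inverse_eq_divide)
  qed
  then obtain c where "\<forall>x\<in>{0..T}. w x = c"
    using has_derivative_zero_constant[of "{0..T}" w] by auto
  then show ?thesis using assms(2) by auto
qed

text \<open>The primitives are merely Lipschitz; the defect of the product rule over \<open>[x, y]\<close>
  is quadratic in \<open>y - x\<close>, hence zero.\<close>

lemma product_rule_integral:
  fixes a b u v :: "real \<Rightarrow> complex"
  assumes a: "\<And>x. x \<in> {0..T} \<Longrightarrow> (a has_integral (u x - u 0)) {0..x}"
    and b: "\<And>x. x \<in> {0..T} \<Longrightarrow> (b has_integral (v x - v 0)) {0..x}"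
    and abd: "\<And>s. s \<in> {0..T} \<Longrightarrow> cmod (a s) \<le> K"
    and bbd: "\<And>s. s \<in> {0..T} \<Longrightarrow> cmod (b s) \<le> L"
    and x: "x \<in> {0..T}"
  shows "((\<lambda>s. a s * v s + u s * b s) has_integral (u x * v x - u 0 * v 0)) {0..x}"
proof -
  have cu: "continuous_on {0..T} u" by (rule indefinite_integral_continuous[OF a])
  have cv: "continuous_on {0..T} v" by (rule indefinite_integral_continuous[OF b])
  have T: "0 \<le> T" using x by auto
  have K: "K \<ge> 0" using order_trans[OF norm_ge_zero abd[of 0]] T by simp
  have L: "L \<ge> 0" using order_trans[OF norm_ge_zero bbd[of 0]] T by simp
  have i1: "(\<lambda>s. a s * v s) integrable_on {0..T}"
    using a[of T] T abd cv by (intro integrable_on_mult_continuous) (auto simp: integrable_on_def)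
  have i2: "(\<lambda>s. b s * u s) integrable_on {0..T}"
    using b[of T] T bbd cu by (intro integrable_on_mult_continuous) (auto simp: integrable_on_def)
  define g where "g s = a s * v s + u s * b s" for s
  have ig: "g integrable_on {0..T}"
    unfolding g_def using i1 i2 by (intro integrable_add) (simp_all add: mult.commute)
  have gI: "(g has_integral integral {0..x} g) {0..x}" if "x \<in> {0..T}" for x
    using that by (intro integrable_integral integrable_subinterval_real[OF ig]) auto
  define w where "w x = u x * v x - integral {0..x} g" for x
  have "w x = w 0"
  proof (rule constant_if_quadratic_increments[OF _ x])
    fix x y assume xy: "0 \<le> x" "x \<le> y" "y \<le> T"
    have ga: "(a has_integral (u y - u x)) {x..y}"
      using has_integral_diff_interval[of T a, OF a xy] by simp
    have gb: "(b has_integral (v y - v x)) {x..y}"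
      using has_integral_diff_interval[of T b, OF b xy] by simp
    have gg: "(g has_integral (integral {0..y} g - integral {0..x} g)) {x..y}"
      using has_integral_diff_interval[of T g, OF gI xy] by simp
    \<comment> \<open>Freezing \<open>v\<close> at the right end and \<open>u\<close> at the left
      end gives an integral of exactly \<open>u y * v y - u x * v x\<close>. What remains of the
      integrand contains only \<open>v y - v s\<close> and \<open>u x - u s\<close>, both of size
      O(y - x).\<close>
    have "((\<lambda>s. a s * v y + u x * b s - g s) has_integral
        ((u y - u x) * v y + u x * (v y - v x) - (integral {0..y} g - integral {0..x} g))) {x..y}"
      by (intro has_integral_diff has_integral_add has_integral_mult_left has_integral_mult_right ga gb gg)
    then have "((\<lambda>s. a s * (v y - v s) + (u x - u s) * b s) has_integral (w y - w x)) {x..y}"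
      by (simp add: g_def w_def algebra_simps)
    moreover have "cmod (a s * (v y - v s) + (u x - u s) * b s) \<le> 2 * K * L * (y - x)"
      if s: "s \<in> {x..y}" for s
    proof -
      have "cmod (v y - v s) \<le> L * \<bar>y - s\<bar>"
        by (rule indefinite_integral_lipschitz[OF b bbd]) (use xy s in auto)
      also have "\<dots> \<le> L * (y - x)" using s L by (intro mult_left_mono) auto
      finally have 1: "cmod (v y - v s) \<le> L * (y - x)" .
      have "cmod (u x - u s) \<le> K * \<bar>x - s\<bar>"
        by (rule indefinite_integral_lipschitz[OF a abd]) (use xy s in auto)
      also have "\<dots> \<le> K * (y - x)" using s K by (intro mult_left_mono) auto
      finally have 2: "cmod (u x - u s) \<le> K * (y - x)" .
      have "cmod (a s * (v y - v s) + (u x - u s) * b s)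
            \<le> cmod (a s) * cmod (v y - v s) + cmod (u x - u s) * cmod (b s)"
        by (metis norm_mult norm_triangle_ineq)
      also have "\<dots> \<le> K * (L * (y - x)) + (K * (y - x)) * L"
        using 1 2 abd[of s] bbd[of s] s xy K L by (intro add_mono mult_mono) auto
      finally show ?thesis by (simp add: algebra_simps)
    qed
    ultimately have "cmod (w y - w x) \<le> (2 * K * L * (y - x)) * (y - x)"
      by (rule has_integral_interval_bound[OF _ xy(2)])
    then show "cmod (w y - w x) \<le> (2 * K * L) * (y - x)\<^sup>2"
      by (simp add: power2_eq_square mult.assoc)
  qed
  then have "integral {0..x} g = u x * v x - u 0 * v 0" by (simp add: w_def algebra_simps)
  then show ?thesis using gI[OF x] unfolding g_def by simp
qed

text \<open>The majorant \<open>U\<close> satisfies U' = K u \<le> K U, so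
  \<open>U x * exp (- K * x)\<close> decreases. Neither \<open>u\<close> nor \<open>a\<close> has a
  prescribed sign.\<close>

lemma gronwall:
  fixes u :: "real \<Rightarrow> real"
  assumes u: "continuous_on {0..T} u" and K: "K \<ge> 0"
    and le: "\<And>x. x \<in> {0..T} \<Longrightarrow> u x \<le> a + K * integral {0..x} u"
    and x: "x \<in> {0..T}"
  shows "u x \<le> a * exp (K * x)"
proof -
  define U where "U x = a + K * integral {0..x} u" for x
  have D: "(U has_real_derivative K * u y) (at y within {0..T})" if "y \<in> {0..T}" for y
    unfolding U_def
    by (auto intro!: derivative_eq_intros integral_has_real_derivative[OF u that])
  define W where "W x = U x * exp (- K * x)" for x
  have DW: "(W has_real_derivative (K * u y - K * U y) * exp (- K * y)) (at y within {0..T})"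
    if "y \<in> {0..T}" for y
    unfolding W_def by (auto intro!: derivative_eq_intros D that simp: algebra_simps)
  have "W x \<le> W 0"
  proof (rule DERIV_nonpos_imp_decreasing_open[of 0 x W])
    show "0 \<le> x" using x by auto
    show "continuous_on {0..x} W"
      by (rule continuous_on_subset[OF DERIV_continuous_on[OF DW]]) (use x in auto)
    fix y assume y: "0 < y" "y < x"
    have "(W has_real_derivative (K * u y - K * U y) * exp (- K * y)) (at y)"
      using DW[of y] y x by (simp add: at_within_Icc_at)
    moreover have "(K * u y - K * U y) * exp (- K * y) \<le> 0"
      using le[of y] y x K by (intro mult_nonpos_nonneg) (auto simp: U_def mult_left_mono)
    ultimately show "\<exists>d. DERIV W y :> d \<and> d \<le> 0" by blast
  qed
  then have "U x * exp (- K * x) \<le> a" by (simp add: W_def U_def)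
  then have "U x \<le> a * exp (K * x)" by (simp add: exp_minus field_simps)
  then show ?thesis using le[OF x] by (simp add: U_def)
qed

text \<open>The constant \<open>e\<close> is a forcing term: it carries the change of the spectral
  parameter in \<open>is_sol_dependence\<close> and is 0 for the homogeneous system in
  \<open>z_bounded_strip\<close>.\<close>

lemma gronwall_integral_equation:
  fixes y :: "real \<Rightarrow> 'a::euclidean_space"
  assumes b: "\<And>x. x \<in> {0..T} \<Longrightarrow> (b has_integral (y x - y0)) {0..x}"
    and le: "\<And>s. s \<in> {0..T} \<Longrightarrow> norm (b s) \<le> K * norm (y s) + e" and K: "K \<ge> 0"
    and x: "x \<in> {0..T}" and e: "e \<ge> 0"
  shows "norm (y x) \<le> (norm y0 + e * T) * exp (K * x)"
proof -
  have c: "continuous_on {0..T} y" by (rule indefinite_integral_continuous[OF b])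
  show ?thesis
  proof (rule gronwall[where T = T, OF _ K _ x])
    show "continuous_on {0..T} (\<lambda>x. norm (y x))" by (intro continuous_intros c)
    fix x assume x: "x \<in> {0..T}"
    have i: "(\<lambda>s. norm (y s)) integrable_on {0..x}"
      by (intro integrable_continuous_real continuous_intros continuous_on_subset[OF c]) (use x in auto)
    have "norm (integral {0..x} b) \<le> integral {0..x} (\<lambda>s. K * norm (y s) + e)"
      using b[OF x] le x i
      by (intro integral_norm_bound_integral integrable_add integrable_on_mult_right)
        (auto simp: integrable_on_def)
    also have "\<dots> = K * integral {0..x} (\<lambda>s. norm (y s)) + e * x"
      using x i by (subst integral_add) (auto intro!: integrable_on_mult_right)
    also have "\<dots> \<le> K * integral {0..x} (\<lambda>s. norm (y s)) + e * T"
      using x e by (simp add: mult_left_mono)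
    finally have "norm (y x - y0) \<le> K * integral {0..x} (\<lambda>s. norm (y s)) + e * T"
      using b[OF x] by (simp add: has_integral_iff)
    then show "norm (y x) \<le> norm y0 + e * T + K * integral {0..x} (\<lambda>s. norm (y s))"
      using norm_triangle_sub[of "y x" y0] by linarith
  qed
qed

text \<open>Successive differences are bounded by D (K x)^n / n!, the factorial coming from
  integrating monomials. The series thus converges uniformly on all of [0, T] for any
  \<open>K\<close>, and no short intervals have to be glued.\<close>

lemma picard_iteration:
  fixes A :: "real \<Rightarrow> 'a::euclidean_space \<Rightarrow> 'a"
  assumes T: "T \<ge> 0" and K: "K \<ge> 0"
    and lip: "\<And>s y z. s \<in> {0..T} \<Longrightarrow> norm (A s y - A s z) \<le> K * norm (y - z)"
    and int: "\<And>y. continuous_on {0..T} y \<Longrightarrow> (\<lambda>s. A s (y s)) integrable_on {0..T}"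
  obtains y where "\<And>x. x \<in> {0..T} \<Longrightarrow> ((\<lambda>s. A s (y s)) has_integral (y x - y0)) {0..x}"
proof -
  define f where "f = rec_nat (\<lambda>x. y0) (\<lambda>n g x. y0 + integral {0..x} (\<lambda>s. A s (g s)))"
  have f0: "f 0 = (\<lambda>x. y0)" and fS: "f (Suc n) = (\<lambda>x. y0 + integral {0..x} (\<lambda>s. A s (f n s)))" for n
    by (simp_all add: f_def)
  have fc: "continuous_on {0..T} (f n)" for n
    by (induction n) (auto simp: f0 fS intro!: continuous_intros indefinite_integral_continuous_1 int)
  have fI: "((\<lambda>s. A s (f n s)) has_integral (f (Suc n) x - y0)) {0..x}" if "x \<in> {0..T}" for n x
    using that integrable_subinterval_real[OF int[OF fc], of 0 x n] by (simp add: fS has_integral_iff)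
  have "continuous_on {0..T} (\<lambda>x. f (Suc 0) x - f 0 x)" by (intro continuous_intros fc)
  then have "bounded ((\<lambda>x. f (Suc 0) x - f 0 x) ` {0..T})"
    by (intro compact_imp_bounded compact_continuous_image) auto
  then obtain D where D: "\<And>x. x \<in> {0..T} \<Longrightarrow> norm (f (Suc 0) x - f 0 x) \<le> D"
    unfolding bounded_iff by blast
  have D0: "D \<ge> 0" using order_trans[OF norm_ge_zero D[of 0]] T by simp
  have bd: "norm (f (Suc n) x - f n x) \<le> D * (K ^ n * x ^ n / fact n)" if "x \<in> {0..T}" for n x
    using that
  proof (induction n arbitrary: x)
    case 0
    then show ?case using D[of x] by simp
  next
    case (Suc n)
    have i1: "((\<lambda>s. A s (f (Suc n) s) - A s (f n s)) has_integral
        (f (Suc (Suc n)) x - f (Suc n) x)) {0..x}"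
      using has_integral_diff[OF fI[of x "Suc n"] fI[of x n]] Suc.prems by simp
    have "((\<lambda>s. real (Suc n) * s ^ n) has_integral (x ^ Suc n - 0 ^ Suc n)) {0..x}"
    proof (rule fundamental_theorem_of_calculus)
      show "((\<lambda>s. s ^ Suc n) has_vector_derivative real (Suc n) * s ^ n) (at s within {0..x})" for s
        using DERIV_subset[OF DERIV_pow[of "Suc n" s UNIV]]
        by (simp add: has_real_derivative_iff_has_vector_derivative[symmetric] del: power_Suc)
    qed (use Suc.prems in auto)
    from has_integral_mult_right[OF this, of "D * K ^ Suc n / fact (Suc n)"]
    have i2: "((\<lambda>s. D * K ^ Suc n / fact (Suc n) * (real (Suc n) * s ^ n)) has_integral
        (D * K ^ Suc n / fact (Suc n) * x ^ Suc n)) {0..x}" by simp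
    have "norm (f (Suc (Suc n)) x - f (Suc n) x) \<le> D * K ^ Suc n / fact (Suc n) * x ^ Suc n"
    proof (rule has_integral_norm_bound[OF i1 i2])
      fix s assume s: "s \<in> {0..x}"
      have "norm (A s (f (Suc n) s) - A s (f n s)) \<le> K * norm (f (Suc n) s - f n s)"
        using s Suc.prems by (intro lip) auto
      also have "\<dots> \<le> K * (D * (K ^ n * s ^ n / fact n))"
        using s Suc.prems K by (intro mult_left_mono Suc.IH) auto
      also have "\<dots> = D * K ^ Suc n / fact (Suc n) * (real (Suc n) * s ^ n)"
        by (simp add: divide_simps del: of_nat_Suc)
      finally show "norm (A s (f (Suc n) s) - A s (f n s)) \<le> \<dots>" .
    qed
    then show ?case by simp
  qed
  define M where "M n = D * ((K * T) ^ n / fact n)" for n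
  have M: "norm (f (Suc n) x - f n x) \<le> M n" if "x \<in> {0..T}" for n x
  proof -
    have "D * (K ^ n * x ^ n / fact n) \<le> D * (K ^ n * T ^ n / fact n)"
      using that D0 K by (intro mult_left_mono divide_right_mono power_mono) auto
    then show ?thesis using bd[OF that, of n] by (simp add: M_def power_mult_distrib)
  qed
  have "summable M"
    unfolding M_def using summable_exp_generic[of "K * T"]
    by (intro summable_mult) (simp add: divide_inverse mult.commute)
  then have "uniform_limit {0..T} (\<lambda>n x. \<Sum>i<n. f (Suc i) x - f i x)
      (\<lambda>x. \<Sum>i. f (Suc i) x - f i x) sequentially"
    by (intro Weierstrass_m_test[where M = M] M)
  then have "uniform_limit {0..T} (\<lambda>n x. f 0 x + (\<Sum>i<n. f (Suc i) x - f i x))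
      (\<lambda>x. f 0 x + (\<Sum>i. f (Suc i) x - f i x)) sequentially"
    by (intro uniform_limit_intros)
  moreover have "f 0 x + (\<Sum>i<n. f (Suc i) x - f i x) = f n x" for n x
    using sum_lessThan_telescope[of "\<lambda>i. f i x" n] by simp
  moreover define y where "y = (\<lambda>x. f 0 x + (\<Sum>i. f (Suc i) x - f i x))"
  ultimately have ul: "uniform_limit {0..T} f y sequentially" by simp
  have yc: "continuous_on {0..T} y"
    by (rule uniform_limit_theorem[OF _ ul]) (simp_all add: fc)
  show ?thesis
  proof (rule that)
    fix x assume x: "x \<in> {0..T}"
    have iy: "((\<lambda>s. A s (y s)) has_integral integral {0..x} (\<lambda>s. A s (y s))) {0..x}"
      using x by (intro integrable_integral integrable_subinterval_real[OF int[OF yc]]) auto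
    have "(\<lambda>n. f (Suc n) x - y0) \<longlonglongrightarrow> y x - y0"
      by (intro tendsto_intros LIMSEQ_Suc tendsto_uniform_limitI[OF ul x])
    moreover have "(\<lambda>n. f (Suc n) x - y0) \<longlonglongrightarrow> integral {0..x} (\<lambda>s. A s (y s))"
    proof (rule LIMSEQ_I)
      fix r :: real assume r: "r > 0"
      \<comment> \<open>The added 1 keeps the denominator positive when K T = 0 and makes the final
        inequality strict.\<close>
      define e where "e = r / (K * T + 1)"
      have KT: "K * T \<ge> 0" using K T by simp
      have e: "e > 0" using r KT by (simp add: e_def add_nonneg_pos)
      obtain N where N: "\<And>n s. n \<ge> N \<Longrightarrow> s \<in> {0..T} \<Longrightarrow> norm (f n s - y s) < e"
        using uniform_limitD[OF ul e] unfolding eventually_sequentially dist_norm by blast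
      have "norm (f (Suc n) x - y0 - integral {0..x} (\<lambda>s. A s (y s))) < r" if n: "n \<ge> N" for n
      proof -
        have "norm (f (Suc n) x - y0 - integral {0..x} (\<lambda>s. A s (y s))) \<le> (K * e) * (x - 0)"
        proof (rule has_integral_interval_bound)
          show "((\<lambda>s. A s (f n s) - A s (y s)) has_integral
              (f (Suc n) x - y0 - integral {0..x} (\<lambda>s. A s (y s)))) {0..x}"
            by (rule has_integral_diff[OF fI[OF x] iy])
          fix s assume s: "s \<in> {0..x}"
          have "norm (A s (f n s) - A s (y s)) \<le> K * norm (f n s - y s)"
            using s x by (intro lip) auto
          also have "\<dots> \<le> K * e" using N[OF n, of s] s x K by (intro mult_left_mono) auto
          finally show "norm (A s (f n s) - A s (y s)) \<le> K * e" .
        qed (use x in auto)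
        also have "\<dots> \<le> K * e * T" using x K e by (intro mult_left_mono) auto
        also have "\<dots> = (K * T) * e" by simp
        also have "\<dots> < (K * T + 1) * e" using e by simp
        also have "\<dots> = r" using KT by (simp add: e_def)
        finally show ?thesis .
      qed
      then show "\<exists>N. \<forall>n\<ge>N. norm (f (Suc n) x - y0 - integral {0..x} (\<lambda>s. A s (y s))) < r" by blast
    qed
    ultimately have "y x - y0 = integral {0..x} (\<lambda>s. A s (y s))" by (rule LIMSEQ_unique)
    then show "((\<lambda>s. A s (y s)) has_integral (y x - y0)) {0..x}" using iy by simp
  qed
qed

section \<open>Solutions of the Dirac system\<close>

lemma has_integral_pair:
  fixes f :: "real \<Rightarrow> complex" and g :: "real \<Rightarrow> complex"
  assumes "(f has_integral I) S" "(g has_integral J) S"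
  shows "((\<lambda>s. (f s, g s)) has_integral (I, J)) S"
proof -
  have "bounded_linear (\<lambda>z::complex. (z, 0::complex))" "bounded_linear (\<lambda>z::complex. (0::complex, z))"
    by (intro bounded_linear_Pair bounded_linear_ident bounded_linear_zero)+
  from has_integral_add[OF has_integral_linear[OF assms(1) this(1)] has_integral_linear[OF assms(2) this(2)]]
  show ?thesis by (simp add: o_def)
qed

text \<open>The change of parameter is isolated as a forcing term linear in \<open>z\<close>; the
  rest is the homogeneous system for \<open>y - z\<close>.\<close>

lemma dirac_rhs_diff:
  "dirac_rhs p q lam y s - dirac_rhs p q mu z s
    = dirac_rhs p q lam (\<lambda>s. y s - z s) s + ((mu - lam) * snd (z s), (lam - mu) * fst (z s))"
  by (simp add: dirac_rhs_def algebra_simps)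

lemma norm_dirac_rhs_le:
  assumes "cmod (p s) \<le> C" "cmod (q s) \<le> C"
  shows "norm (dirac_rhs p q lam y s) \<le> (4 * C + 2 * cmod lam) * norm (y s)"
proof -
  have C: "C \<ge> 0" using order_trans[OF norm_ge_zero assms(1)] .
  define N where "N = norm (y s)"
  have y: "cmod (fst (y s)) \<le> N" "cmod (snd (y s)) \<le> N"
    using norm_fst_le[of "fst (y s)" "snd (y s)"] norm_snd_le[of "snd (y s)" "fst (y s)"] by (simp_all add: N_def)
  have N: "N \<ge> 0" by (simp add: N_def)
  have 1: "cmod (q s * fst (y s)) \<le> C * N" "cmod (q s * snd (y s)) \<le> C * N"
    unfolding norm_mult using y assms C by (auto intro!: mult_mono)
  have "cmod (lam + p s) \<le> cmod lam + C" "cmod (lam - p s) \<le> cmod lam + C"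
    using assms norm_triangle_ineq[of lam "p s"] norm_triangle_ineq4[of lam "p s"] by auto
  then have 2: "cmod ((lam + p s) * snd (y s)) \<le> (cmod lam + C) * N"
      "cmod ((lam - p s) * fst (y s)) \<le> (cmod lam + C) * N"
    unfolding norm_mult using y C by (auto intro!: mult_mono)
  have "norm (dirac_rhs p q lam y s) \<le> cmod (q s * fst (y s) - (lam + p s) * snd (y s))
      + cmod ((lam - p s) * fst (y s) - q s * snd (y s))"
    unfolding dirac_rhs_def by (rule norm_Pair_le)
  also have "\<dots> \<le> (cmod (q s * fst (y s)) + cmod ((lam + p s) * snd (y s)))
      + (cmod ((lam - p s) * fst (y s)) + cmod (q s * snd (y s)))"
    by (intro add_mono norm_triangle_ineq4)
  also have "\<dots> \<le> (C * N + (cmod lam + C) * N) + ((cmod lam + C) * N + C * N)"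
    using 1 2 by linarith
  also have "\<dots> = (4 * C + 2 * cmod lam) * N" by (simp add: algebra_simps)
  finally show ?thesis by (simp add: N_def)
qed

locale dirac =
  fixes p q :: "real \<Rightarrow> complex"
  assumes bv_p: "bv_on p 0 pi" and bv_q: "bv_on q 0 pi"
begin

lemma coefficients_bounded:
  obtains C where "C > 0" "\<And>s. s \<in> {0..pi} \<Longrightarrow> cmod (p s) \<le> C" "\<And>s. s \<in> {0..pi} \<Longrightarrow> cmod (q s) \<le> C"
proof -
  obtain C where "C > 0" "\<And>s. s \<in> {0..pi} \<Longrightarrow> cmod (p s) \<le> C"
    using bv_on_bounded[OF bv_p] by metis
  moreover obtain D where "D > 0" "\<And>s. s \<in> {0..pi} \<Longrightarrow> cmod (q s) \<le> D"
    using bv_on_bounded[OF bv_q] by metis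
  ultimately show ?thesis by (intro that[of "max C D"]) (auto simp: max.coboundedI1 max.coboundedI2)
qed

lemma dirac_rhs_integrable:
  assumes "continuous_on {0..pi} y"
  shows "dirac_rhs p q lam y integrable_on {0..pi}"
proof -
  obtain C where C: "\<And>s. s \<in> {0..pi} \<Longrightarrow> cmod (p s) \<le> C" "\<And>s. s \<in> {0..pi} \<Longrightarrow> cmod (q s) \<le> C"
    using coefficients_bounded by metis
  have c: "continuous_on {0..pi} (\<lambda>s. fst (y s))" "continuous_on {0..pi} (\<lambda>s. snd (y s))"
    by (intro continuous_intros assms)+
  have i: "(\<lambda>s. p s * fst (y s)) integrable_on {0..pi}" "(\<lambda>s. p s * snd (y s)) integrable_on {0..pi}"
      "(\<lambda>s. q s * fst (y s)) integrable_on {0..pi}" "(\<lambda>s. q s * snd (y s)) integrable_on {0..pi}"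
    by (intro integrable_on_mult_continuous[of _ _ _ C] bv_on_integrable bv_p bv_q c C; simp)+
  have l: "(\<lambda>s. lam * fst (y s)) integrable_on {0..pi}" "(\<lambda>s. lam * snd (y s)) integrable_on {0..pi}"
    by (intro integrable_continuous_real continuous_intros c)+
  have "(\<lambda>s. q s * fst (y s) - (lam * snd (y s) + p s * snd (y s))) integrable_on {0..pi}"
    "(\<lambda>s. (lam * fst (y s) - p s * fst (y s)) - q s * snd (y s)) integrable_on {0..pi}"
    by (intro integrable_add integrable_diff i l)+
  then obtain I J where
    "((\<lambda>s. q s * fst (y s) - (lam * snd (y s) + p s * snd (y s))) has_integral I) {0..pi}"
    "((\<lambda>s. (lam * fst (y s) - p s * fst (y s)) - q s * snd (y s)) has_integral J) {0..pi}"
    unfolding integrable_on_def by blast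
  from has_integral_integrable[OF has_integral_pair[OF this]]
  have "(\<lambda>s. (q s * fst (y s) - (lam * snd (y s) + p s * snd (y s)),
      (lam * fst (y s) - p s * fst (y s)) - q s * snd (y s))) integrable_on {0..pi}" .
  then show ?thesis
    by (rule integrable_eq) (simp add: dirac_rhs_def algebra_simps)
qed

lemma is_sol_0:
  assumes "is_sol p q lam y0 y"
  shows "y 0 = y0"
proof -
  have "(dirac_rhs p q lam y has_integral (y 0 - y0)) {0..0}"
    using assms unfolding is_sol_def by (elim conjE ballE[of _ _ 0]) simp_all
  then have "y 0 - y0 = 0" by (rule has_integral_unique) (rule has_integral_null_real, simp)
  then show ?thesis by simp
qed

lemma is_sol_integral:
  "is_sol p q lam y0 y \<Longrightarrow> x \<in> {0..pi} \<Longrightarrow> (dirac_rhs p q lam y has_integral (y x - y0)) {0..x}"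
  by (simp add: is_sol_def)

lemma is_sol_continuous: "is_sol p q lam y0 y \<Longrightarrow> continuous_on {0..pi} y"
  by (rule indefinite_integral_continuous[OF is_sol_integral])

lemma is_sol_exists: "\<exists>y. is_sol p q lam y0 y"
proof -
  obtain C where C: "C > 0" "\<And>s. s \<in> {0..pi} \<Longrightarrow> cmod (p s) \<le> C" "\<And>s. s \<in> {0..pi} \<Longrightarrow> cmod (q s) \<le> C"
    using coefficients_bounded by metis
  define A where "A s v = dirac_rhs p q lam (\<lambda>_. v) s" for s v
  have A: "(\<lambda>s. A s (y s)) = dirac_rhs p q lam y" for y by (auto simp: A_def dirac_rhs_def)
  obtain y where y: "\<And>x. x \<in> {0..pi} \<Longrightarrow> ((\<lambda>s. A s (y s)) has_integral (y x - y0)) {0..x}"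
  proof (rule picard_iteration[of pi "4 * C + 2 * cmod lam" A y0])
    show "norm (A s v - A s w) \<le> (4 * C + 2 * cmod lam) * norm (v - w)" if "s \<in> {0..pi}" for s v w
      using norm_dirac_rhs_le[of p s C q lam "\<lambda>_. v - w"] C that dirac_rhs_diff[of p q lam "\<lambda>_. v" s lam "\<lambda>_. w"]
      by (simp add: A_def zero_prod_def[symmetric])
    show "(\<lambda>s. A s (y s)) integrable_on {0..pi}" if "continuous_on {0..pi} y" for y
      unfolding A by (rule dirac_rhs_integrable[OF that])
  qed (use C in auto)
  \<comment> \<open>\<open>is_sol\<close> prescribes the value 0 off the interval; this makes
    solutions unique as functions on the whole line, as the definite description in
    \<open>sol\<close> requires.\<close>
  define z where "z x = (if x \<in> {0..pi} then y x else 0)" for x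
  have "(dirac_rhs p q lam z has_integral (z x - y0)) {0..x}" if x: "x \<in> {0..pi}" for x
  proof (rule has_integral_eq[rotated])
    show "((\<lambda>s. A s (y s)) has_integral (z x - y0)) {0..x}" using y[OF x] x by (simp add: z_def)
    show "A s (y s) = dirac_rhs p q lam z s" if "s \<in> {0..x}" for s
      using that x by (simp add: A_def z_def dirac_rhs_def)
  qed
  then have "is_sol p q lam y0 z" by (simp add: is_sol_def z_def)
  then show ?thesis by blast
qed

text \<open>One estimate serves three purposes: uniqueness (equal data), the norm bound
  (\<open>z = 0\<close>) and continuity in the parameter. Its factor grows with
  \<open>cmod lam\<close>; bounds uniform in a strip come later from the variables
  \<open>zplus\<close> and \<open>zminus\<close>.\<close>

lemma is_sol_dependence:
  assumes y: "is_sol p q lam y0 y" and z: "is_sol p q mu z0 z"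
    and C: "C \<ge> 0" "\<And>s. s \<in> {0..pi} \<Longrightarrow> cmod (p s) \<le> C" "\<And>s. s \<in> {0..pi} \<Longrightarrow> cmod (q s) \<le> C"
    and B: "B \<ge> 0" "\<And>s. s \<in> {0..pi} \<Longrightarrow> norm (z s) \<le> B" and x: "x \<in> {0..pi}"
  shows "norm (y x - z x) \<le> (norm (y0 - z0) + 2 * cmod (lam - mu) * B * pi)
      * exp ((4 * C + 2 * cmod lam) * pi)"
proof -
  have "norm (y x - z x) \<le> (norm (y0 - z0) + 2 * cmod (lam - mu) * B * pi)
      * exp ((4 * C + 2 * cmod lam) * x)"
  proof (rule gronwall_integral_equation[OF _ _ _ x])
    show "((\<lambda>s. dirac_rhs p q lam y s - dirac_rhs p q mu z s) has_integral (y x - z x - (y0 - z0))) {0..x}"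
      if "x \<in> {0..pi}" for x
      using has_integral_diff[OF is_sol_integral[OF y that] is_sol_integral[OF z that]]
      by (simp add: algebra_simps)
    show "norm (dirac_rhs p q lam y s - dirac_rhs p q mu z s)
        \<le> (4 * C + 2 * cmod lam) * norm (y s - z s) + 2 * cmod (lam - mu) * B" if s: "s \<in> {0..pi}" for s
    proof -
      have zz: "cmod (fst (z s)) \<le> B" "cmod (snd (z s)) \<le> B"
        using norm_fst_le[of "fst (z s)" "snd (z s)"] norm_snd_le[of "snd (z s)" "fst (z s)"] B(2)[OF s] by simp_all
      have "norm ((mu - lam) * snd (z s), (lam - mu) * fst (z s))
          \<le> cmod ((mu - lam) * snd (z s)) + cmod ((lam - mu) * fst (z s))" by (rule norm_Pair_le)
      also have "\<dots> \<le> cmod (lam - mu) * B + cmod (lam - mu) * B"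
        unfolding norm_mult using zz by (intro add_mono mult_mono) (auto simp: norm_minus_commute)
      finally have "norm ((mu - lam) * snd (z s), (lam - mu) * fst (z s)) \<le> 2 * cmod (lam - mu) * B" by (simp add: algebra_simps)
      moreover have "norm (dirac_rhs p q lam (\<lambda>s. y s - z s) s) \<le> (4 * C + 2 * cmod lam) * norm (y s - z s)"
        using norm_dirac_rhs_le[of p s C q lam "\<lambda>s. y s - z s"] C s by simp
      ultimately show ?thesis
        unfolding dirac_rhs_diff
        using norm_triangle_ineq[of "dirac_rhs p q lam (\<lambda>s. y s - z s) s"
            "((mu - lam) * snd (z s), (lam - mu) * fst (z s))"] by linarith
    qed
  qed (use C B in auto)
  also have "\<dots> \<le> (norm (y0 - z0) + 2 * cmod (lam - mu) * B * pi) * exp ((4 * C + 2 * cmod lam) * pi)"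
  proof (rule mult_left_mono)
    have "(4 * C + 2 * cmod lam) * x \<le> (4 * C + 2 * cmod lam) * pi"
      using x C(1) by (intro mult_left_mono) auto
    then show "exp ((4 * C + 2 * cmod lam) * x) \<le> exp ((4 * C + 2 * cmod lam) * pi)" by simp
  qed (use B(1) in simp)
  finally show ?thesis .
qed

lemma is_sol_zero: "is_sol p q lam 0 (\<lambda>_. 0)"
proof -
  have "dirac_rhs p q lam (\<lambda>_. 0) = (\<lambda>_. 0)" by (auto simp: dirac_rhs_def zero_prod_def)
  then show ?thesis by (simp add: is_sol_def)
qed

lemma is_sol_norm_le:
  assumes "is_sol p q lam y0 y"
    and "C \<ge> 0" "\<And>s. s \<in> {0..pi} \<Longrightarrow> cmod (p s) \<le> C" "\<And>s. s \<in> {0..pi} \<Longrightarrow> cmod (q s) \<le> C"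
    and "x \<in> {0..pi}"
  shows "norm (y x) \<le> norm y0 * exp ((4 * C + 2 * cmod lam) * pi)"
proof -
  have "norm (y x - 0) \<le> (norm (y0 - 0) + 2 * cmod (lam - lam) * 0 * pi) * exp ((4 * C + 2 * cmod lam) * pi)"
    by (rule is_sol_dependence[OF assms(1) is_sol_zero]) (use assms in auto)
  then show ?thesis by simp
qed

lemma is_sol_unique:
  assumes "is_sol p q lam y0 y" "is_sol p q lam y0 z"
  shows "y = z"
proof
  fix x
  obtain C where C: "C > 0" "\<And>s. s \<in> {0..pi} \<Longrightarrow> cmod (p s) \<le> C" "\<And>s. s \<in> {0..pi} \<Longrightarrow> cmod (q s) \<le> C"
    using coefficients_bounded by metis
  show "y x = z x"
  proof (cases "x \<in> {0..pi}")
    case True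
    have "norm (y x - z x) \<le> 0"
      using is_sol_dependence[OF assms _ C(2,3) _ _ True, of "norm y0 * exp ((4 * C + 2 * cmod lam) * pi)"]
        is_sol_norm_le[OF assms(2) _ C(2,3)] C(1) by simp
    then show ?thesis by simp
  qed (use assms in \<open>auto simp: is_sol_def\<close>)
qed

lemma is_sol_sol: "is_sol p q lam y0 (sol p q lam y0)"
  unfolding sol_def by (rule theI'[of "is_sol p q lam y0"], rule ex_ex1I[OF is_sol_exists is_sol_unique])

lemma is_sol_csol: "is_sol p q lam (1, 0) (csol p q lam)"
  and is_sol_ssol: "is_sol p q lam (0, 1) (ssol p q lam)"
  unfolding csol_def ssol_def by (rule is_sol_sol)+

lemma is_sol_eq_combination:
  assumes y: "is_sol p q lam y0 y"
  shows "y = (\<lambda>x. (fst y0 * fst (csol p q lam x) + snd y0 * fst (ssol p q lam x),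
      fst y0 * snd (csol p q lam x) + snd y0 * snd (ssol p q lam x)))" (is "y = ?z")
proof (rule is_sol_unique[OF y])
  have "(dirac_rhs p q lam ?z has_integral (?z x - y0)) {0..x}" if x: "x \<in> {0..pi}" for x
  proof -
    have bl: "bounded_linear (\<lambda>w::complex \<times> complex. (a * fst w, a * snd w))" for a
      by (intro bounded_linear_Pair bounded_linear_const_mult bounded_linear_fst bounded_linear_snd)
    from has_integral_add[OF
        has_integral_linear[OF is_sol_integral[OF is_sol_csol[of lam] x] bl[of "fst y0"]]
        has_integral_linear[OF is_sol_integral[OF is_sol_ssol[of lam] x] bl[of "snd y0"]]]
    have "((\<lambda>s. ((\<lambda>w. (fst y0 * fst w, fst y0 * snd w)) \<circ> dirac_rhs p q lam (csol p q lam)) s +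
        ((\<lambda>w. (snd y0 * fst w, snd y0 * snd w)) \<circ> dirac_rhs p q lam (ssol p q lam)) s)
        has_integral (?z x - y0)) {0..x}"
      by (rule has_integral_eq_rhs) (simp add: prod_eq_iff algebra_simps)
    then show ?thesis
      by (rule has_integral_eq[rotated]) (simp add: dirac_rhs_def algebra_simps)
  qed
  moreover have "csol p q lam x = 0" "ssol p q lam x = 0" if "x \<notin> {0..pi}" for x
    using is_sol_csol[of lam] is_sol_ssol[of lam] that by (auto simp: is_sol_def)
  ultimately show "is_sol p q lam y0 ?z" by (auto simp: is_sol_def zero_prod_def)
qed

text \<open>The parameter is moved first, uniformly in the position by
  \<open>is_sol_dependence\<close>; what is left is the single continuous function
  \<open>sol p q mu y0\<close>.\<close>

lemma continuous_on_sol: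
  "continuous_on (UNIV \<times> {0..pi}) (\<lambda>z. sol p q (fst z) y0 (snd z))"
  unfolding continuous_on_def
proof
  fix w :: "complex \<times> real" assume w: "w \<in> UNIV \<times> {0..pi}"
  obtain mu x0 where w_eq: "w = (mu, x0)" by force
  then have x0: "x0 \<in> {0..pi}" using w by auto
  obtain C where C: "C > 0" "\<And>s. s \<in> {0..pi} \<Longrightarrow> cmod (p s) \<le> C" "\<And>s. s \<in> {0..pi} \<Longrightarrow> cmod (q s) \<le> C"
    using coefficients_bounded by metis
  define B where "B = norm y0 * exp ((4 * C + 2 * cmod mu) * pi)"
  have B: "norm (sol p q mu y0 s) \<le> B" if "s \<in> {0..pi}" for s
    unfolding B_def by (rule is_sol_norm_le[OF is_sol_sol]) (use that C in auto)
  let ?F = "at w within UNIV \<times> {0..pi}"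
  let ?b = "\<lambda>z. (2 * cmod (fst z - mu) * B * pi) * exp ((4 * C + 2 * cmod (fst z)) * pi)
      + norm (sol p q mu y0 (snd z) - sol p q mu y0 x0)"
  have "continuous_on (UNIV \<times> {0..pi}) (\<lambda>z::complex \<times> real. sol p q mu y0 (snd z))"
    by (rule continuous_on_compose2[OF is_sol_continuous[OF is_sol_sol]]) (auto intro!: continuous_intros)
  then have "((\<lambda>z. sol p q mu y0 (snd z)) \<longlongrightarrow> sol p q mu y0 x0) ?F"
    using w by (force simp: continuous_on_def w_eq)
  then have "(?b \<longlongrightarrow> (2 * cmod (fst w - mu) * B * pi) * exp ((4 * C + 2 * cmod (fst w)) * pi)
      + norm (sol p q mu y0 x0 - sol p q mu y0 x0)) ?F"
    by (intro tendsto_intros)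
  then have "(?b \<longlongrightarrow> 0) ?F" by (simp add: w_eq)
  moreover have "norm (sol p q (fst z) y0 (snd z) - sol p q mu y0 x0) \<le> ?b z" if "z \<in> UNIV \<times> {0..pi}" for z
  proof -
    have "norm (sol p q (fst z) y0 (snd z) - sol p q mu y0 (snd z))
        \<le> (norm (y0 - y0) + 2 * cmod (fst z - mu) * B * pi) * exp ((4 * C + 2 * cmod (fst z)) * pi)"
      using that B C(1) B[of 0] order_trans[OF norm_ge_zero B[of 0]]
      by (intro is_sol_dependence[OF is_sol_sol is_sol_sol] C(2,3)) auto
    then show ?thesis
      using norm_triangle_ineq[of "sol p q (fst z) y0 (snd z) - sol p q mu y0 (snd z)"
          "sol p q mu y0 (snd z) - sol p q mu y0 x0"] by simp
  qed
  then have "\<forall>\<^sub>F z in ?F. norm (sol p q (fst z) y0 (snd z) - sol p q mu y0 x0) \<le> ?b z"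
    unfolding eventually_at by (intro exI[of _ 1]) simp
  ultimately have "((\<lambda>z. sol p q (fst z) y0 (snd z) - sol p q mu y0 x0) \<longlongrightarrow> 0) ?F"
    by (rule Lim_null_comparison[rotated])
  then show "((\<lambda>z. sol p q (fst z) y0 (snd z)) \<longlongrightarrow> sol p q (fst w) y0 (snd w)) ?F"
    unfolding w_eq fst_conv snd_conv by (rule LIM_zero_cancel)
qed

lemma is_sol_components:
  assumes y: "is_sol p q lam y0 y" and x: "x \<in> {0..pi}"
  shows "((\<lambda>s. q s * fst (y s) - (lam + p s) * snd (y s)) has_integral (fst (y x) - fst (y 0))) {0..x}"
    and "((\<lambda>s. (lam - p s) * fst (y s) - q s * snd (y s)) has_integral (snd (y x) - snd (y 0))) {0..x}"
  using has_integral_linear[OF is_sol_integral[OF y x] bounded_linear_fst]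
    has_integral_linear[OF is_sol_integral[OF y x] bounded_linear_snd]
  unfolding is_sol_0[OF y] by (simp_all only: o_def dirac_rhs_def fst_conv snd_conv fst_diff snd_diff)

lemma is_sol_components_bounded:
  assumes y: "is_sol p q lam y0 y"
  obtains K where "\<And>s. s \<in> {0..pi} \<Longrightarrow> cmod (q s * fst (y s) - (lam + p s) * snd (y s)) \<le> K"
    "\<And>s. s \<in> {0..pi} \<Longrightarrow> cmod ((lam - p s) * fst (y s) - q s * snd (y s)) \<le> K"
proof -
  obtain C where C: "C > 0" "\<And>s. s \<in> {0..pi} \<Longrightarrow> cmod (p s) \<le> C" "\<And>s. s \<in> {0..pi} \<Longrightarrow> cmod (q s) \<le> C"
    using coefficients_bounded by metis
  define K where "K = (4 * C + 2 * cmod lam) * (norm y0 * exp ((4 * C + 2 * cmod lam) * pi))"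
  have "norm (dirac_rhs p q lam y s) \<le> K" if "s \<in> {0..pi}" for s
  proof -
    have "norm (dirac_rhs p q lam y s) \<le> (4 * C + 2 * cmod lam) * norm (y s)"
      by (intro norm_dirac_rhs_le C that)
    also have "\<dots> \<le> K"
      unfolding K_def by (intro mult_left_mono is_sol_norm_le[OF y]) (use C that in auto)
    finally show ?thesis .
  qed
  then show ?thesis
    unfolding dirac_rhs_def
    by (intro that; (rule order_trans[OF norm_fst_le] order_trans[OF norm_snd_le])) simp_all
qed

text \<open>Q is symmetric, so \<open>p\<close> and \<open>q\<close> cancel from the derivative of
  z1 y2 - z2 y1 and only the difference of the spectral parameters survives.\<close>

lemma wronskian:
  assumes y: "is_sol p q lam y0 y" and z: "is_sol p q mu z0 z" and x: "x \<in> {0..pi}"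
  shows "((\<lambda>s. (lam - mu) * (fst (z s) * fst (y s) + snd (z s) * snd (y s))) has_integral
      (fst (z x) * snd (y x) - snd (z x) * fst (y x) - (fst z0 * snd y0 - snd z0 * fst y0))) {0..x}"
proof -
  obtain K where K: "\<And>s. s \<in> {0..pi} \<Longrightarrow> cmod (q s * fst (y s) - (lam + p s) * snd (y s)) \<le> K"
    "\<And>s. s \<in> {0..pi} \<Longrightarrow> cmod ((lam - p s) * fst (y s) - q s * snd (y s)) \<le> K"
    using is_sol_components_bounded[OF y] by metis
  obtain L where L: "\<And>s. s \<in> {0..pi} \<Longrightarrow> cmod (q s * fst (z s) - (mu + p s) * snd (z s)) \<le> L"
    "\<And>s. s \<in> {0..pi} \<Longrightarrow> cmod ((mu - p s) * fst (z s) - q s * snd (z s)) \<le> L"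
    using is_sol_components_bounded[OF z] by metis
  note i1 = product_rule_integral[OF is_sol_components(1)[OF z] is_sol_components(2)[OF y] L(1) K(2) x]
  note i2 = product_rule_integral[OF is_sol_components(2)[OF z] is_sol_components(1)[OF y] L(2) K(1) x]
  have "((\<lambda>s. (lam - mu) * (fst (z s) * fst (y s) + snd (z s) * snd (y s))) has_integral
      (fst (z x) * snd (y x) - fst (z 0) * snd (y 0) - (snd (z x) * fst (y x) - snd (z 0) * fst (y 0)))) {0..x}"
    by (rule has_integral_eq[OF _ has_integral_diff[OF i1 i2]]) (simp add: algebra_simps)
  then show ?thesis
    by (rule has_integral_eq_rhs) (simp add: is_sol_0[OF y] is_sol_0[OF z])
qed

end

section \<open>The discriminant and its derivative\<close>

text \<open>Bilinear, without conjugation, because this is the pairing that the Wronskian identity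
  produces; conjugation enters only through the adjoint problem.\<close>

definition bip :: "(real \<Rightarrow> complex \<times> complex) \<Rightarrow> (real \<Rightarrow> complex \<times> complex) \<Rightarrow> complex" where
  "bip u v = integral {0..pi} (\<lambda>s. fst (u s) * fst (v s) + snd (u s) * snd (v s))"

definition cnj2 :: "complex \<times> complex \<Rightarrow> complex \<times> complex" where
  "cnj2 w = (cnj (fst w), cnj (snd w))"

lemma cnj2_simps [simp]: "fst (cnj2 w) = cnj (fst w)" "snd (cnj2 w) = cnj (snd w)"
    "cnj2 (cnj2 w) = w" "cnj2 0 = 0" "cnj2 (u - w) = cnj2 u - cnj2 w" "cnj2 w = 0 \<longleftrightarrow> w = 0"
  by (auto simp: cnj2_def prod_eq_iff)

lemma norm_cnj2 [simp]: "norm (cnj2 w) = norm w"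
  by (simp add: cnj2_def norm_prod_def)

lemma bounded_linear_cnj2: "bounded_linear cnj2"
  unfolding cnj2_def
  by (intro bounded_linear_Pair bounded_linear_compose[OF bounded_linear_cnj] bounded_linear_fst bounded_linear_snd)

lemma ip_eq_bip: "ip u v = bip u (\<lambda>s. cnj2 (v s))"
  by (simp add: ip_def bip_def)

lemma bip_commute: "bip u v = bip v u"
  by (simp add: bip_def mult.commute)

lemma norm_prod_power2: "(norm (w :: complex \<times> complex))\<^sup>2 = (cmod (fst w))\<^sup>2 + (cmod (snd w))\<^sup>2"
  by (simp add: norm_prod_def)

lemma l2norm_eq:
  assumes "continuous_on {0..pi} u"
  shows "l2norm u = sqrt (integral {0..pi} (\<lambda>s. (norm (u s))\<^sup>2))"
proof -
  have "(\<lambda>s. (norm (u s))\<^sup>2) integrable_on {0..pi}"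
    by (intro integrable_continuous_real continuous_intros assms)
  note i = has_integral_of_real[OF integrable_integral[OF this]]
  have "fst w * cnj (fst w) + snd w * cnj (snd w) = of_real ((norm w)\<^sup>2)" for w :: "complex \<times> complex"
    unfolding norm_prod_power2 by (simp only: of_real_add complex_norm_square)
  then have "ip u u = integral {0..pi} (\<lambda>s. of_real ((norm (u s))\<^sup>2))"
    by (simp add: ip_def)
  also have "\<dots> = of_real (integral {0..pi} (\<lambda>s. (norm (u s))\<^sup>2))"
    by (rule integral_unique[OF i])
  finally show ?thesis by (simp add: l2norm_def)
qed

text \<open>This converts the adjoint problem into the original one: the conjugate of an adjoint
  eigenfunction solves the equation for \<open>p\<close>, \<open>q\<close> at \<open>lam\<close>,
  and \<open>ip\<close> against the eigenfunction becomes \<open>bip\<close> against its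
  conjugate.\<close>

lemma is_sol_cnj:
  assumes "is_sol (\<lambda>x. cnj (p x)) (\<lambda>x. cnj (q x)) (cnj lam) y0 y"
  shows "is_sol p q lam (cnj2 y0) (\<lambda>x. cnj2 (y x))"
proof -
  have eq: "cnj2 \<circ> dirac_rhs (\<lambda>x. cnj (p x)) (\<lambda>x. cnj (q x)) (cnj lam) y
      = dirac_rhs p q lam (\<lambda>x. cnj2 (y x))"
    by (auto simp: dirac_rhs_def cnj2_def fun_eq_iff)
  show ?thesis
    unfolding is_sol_def
  proof (intro conjI ballI allI impI)
    fix x assume "x \<in> {0..pi}"
    then have "(dirac_rhs (\<lambda>x. cnj (p x)) (\<lambda>x. cnj (q x)) (cnj lam) y has_integral (y x - y0)) {0..x}"
      using assms by (simp add: is_sol_def)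
    from has_integral_linear[OF this bounded_linear_cnj2]
    show "(dirac_rhs p q lam (\<lambda>x. cnj2 (y x)) has_integral cnj2 (y x) - cnj2 y0) {0..x}"
      unfolding eq by simp
  next
    fix x assume "x \<notin> {0..pi}"
    then have "y x = 0" using assms unfolding is_sol_def by blast
    then show "cnj2 (y x) = 0" by simp
  qed
qed

text \<open>The integral of a non-integrable function is 0 and satisfies the bound too, so that
  \<open>bip_bound\<close> can be used without integrability conditions.\<close>

lemma integral_bound_const:
  fixes f :: "real \<Rightarrow> complex"
  assumes "\<And>s. s \<in> {0..pi} \<Longrightarrow> cmod (f s) \<le> B" "B \<ge> 0"
  shows "cmod (integral {0..pi} f) \<le> B * pi"
proof (cases "f integrable_on {0..pi}")
  case True
  then show ?thesis using has_integral_interval_bound[OF integrable_integral[OF True], of B] assms by simp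
qed (use assms in \<open>simp add: not_integrable_integral\<close>)

lemma bip_bound:
  assumes "\<And>s. s \<in> {0..pi} \<Longrightarrow> norm (u s) \<le> U" "\<And>s. s \<in> {0..pi} \<Longrightarrow> norm (v s) \<le> V"
  shows "cmod (bip u v) \<le> 2 * pi * U * V"
proof -
  have "0 \<le> U" "0 \<le> V"
    using order_trans[OF norm_ge_zero assms(1)[of 0]] order_trans[OF norm_ge_zero assms(2)[of 0]] by auto
  have "cmod (fst (u s) * fst (v s) + snd (u s) * snd (v s)) \<le> 2 * U * V" if s: "s \<in> {0..pi}" for s
  proof -
    have "cmod (fst (u s)) \<le> U" "cmod (snd (u s)) \<le> U" "cmod (fst (v s)) \<le> V" "cmod (snd (v s)) \<le> V"
      using norm_fst_le[of "fst (u s)" "snd (u s)"] norm_snd_le[of "snd (u s)" "fst (u s)"]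
        norm_fst_le[of "fst (v s)" "snd (v s)"] norm_snd_le[of "snd (v s)" "fst (v s)"]
        assms(1)[OF s] assms(2)[OF s] by simp_all
    then have "cmod (fst (u s)) * cmod (fst (v s)) \<le> U * V" "cmod (snd (u s)) * cmod (snd (v s)) \<le> U * V"
      using \<open>0 \<le> U\<close> by (auto intro!: mult_mono)
    then show ?thesis
      using norm_triangle_ineq[of "fst (u s) * fst (v s)" "snd (u s) * snd (v s)"] by (simp add: norm_mult)
  qed
  from integral_bound_const[of _ "2 * U * V", OF this] show ?thesis
    using \<open>0 \<le> U\<close> \<open>0 \<le> V\<close> by (simp add: bip_def mult_ac)
qed

text \<open>By Cayley-Hamilton (M - r)(M - r') = 0, so every column of M - r' that is not 0 is an
  eigenvector for r; both columns vanish only if M is scalar. The argument also covers r =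
  r'.\<close>

lemma eigenvector_exists:
  fixes m11 m12 m21 m22 r r' :: complex
  assumes "m11 + m22 = r + r'" "m11 * m22 - m12 * m21 = 1" "r * r' = 1"
    and "\<not> (m12 = 0 \<and> m21 = 0 \<and> m11 = m22)"
  obtains v1 v2 where "v1 \<noteq> 0 \<or> v2 \<noteq> 0" "m11 * v1 + m12 * v2 = r * v1" "m21 * v1 + m22 * v2 = r * v2"
proof (cases "m11 - r' = 0 \<and> m21 = 0")
  case True
  have m22: "m22 = r" using assms(1) True by simp
  show ?thesis
  proof (rule that[of m12 "m22 - r'"])
    show "m12 \<noteq> 0 \<or> m22 - r' \<noteq> 0" using True assms(4) by auto
    show "m11 * m12 + m12 * (m22 - r') = r * m12" using assms(1) by algebra
    show "m21 * m12 + m22 * (m22 - r') = r * (m22 - r')" using m22 True by simp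
  qed
next
  case False
  show ?thesis
  proof (rule that[of "m11 - r'" m21])
    show "m11 - r' \<noteq> 0 \<or> m21 \<noteq> 0" using False by auto
    show "m11 * (m11 - r') + m12 * m21 = r * (m11 - r')" using assms(1-3) by algebra
    show "m21 * (m11 - r') + m22 * m21 = r * m21" using assms(1) by algebra
  qed
qed

lemma exp_pi_sum: "exp (\<i> * of_real pi * t) + exp (- (\<i> * of_real pi * t)) = 2 * cos (of_real pi * t)"
  by (simp add: cos_exp_eq mult.assoc)

context dirac
begin

lemma wronskian_pi:
  assumes y: "is_sol p q lam y0 y" and z: "is_sol p q mu z0 z"
  shows "(lam - mu) * bip z y =
      fst (z pi) * snd (y pi) - snd (z pi) * fst (y pi) - (fst z0 * snd y0 - snd z0 * fst y0)"
  using integral_unique[OF wronskian[OF y z, of pi]] by (simp add: bip_def)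

lemma sol_det:
  assumes "x \<in> {0..pi}"
  shows "fst (csol p q lam x) * snd (ssol p q lam x) - snd (csol p q lam x) * fst (ssol p q lam x) = 1"
  using has_integral_unique[OF wronskian[OF is_sol_ssol[of lam] is_sol_csol[of lam] assms]
      has_integral_is_0[of "{0..x}" "\<lambda>s. (lam - lam) * (fst (csol p q lam s) * fst (ssol p q lam s)
        + snd (csol p q lam s) * snd (ssol p q lam s))"]]
  by simp

lemma continuous_on_bip_sol:
  assumes "continuous_on {0..pi} g"
  shows "continuous_on UNIV (\<lambda>lam. bip g (sol p q lam v))"
proof -
  have g: "continuous_on (UNIV \<times> {0..pi}) (\<lambda>z::complex \<times> real. g (snd z))"
    by (rule continuous_on_compose2[OF assms]) (auto intro!: continuous_intros)
  have "continuous_on (UNIV \<times> cbox 0 pi) (\<lambda>(lam, s). fst (g s) * fst (sol p q lam v s) + snd (g s) * snd (sol p q lam v s))"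
    unfolding case_prod_beta
    using g continuous_on_sol[of v] by (auto intro!: continuous_intros)
  from integral_continuous_on_param[OF this] show ?thesis by (simp add: bip_def)
qed

lemma continuous_on_sol_param:
  assumes "x \<in> {0..pi}"
  shows "continuous_on UNIV (\<lambda>lam. sol p q lam v x)"
proof -
  have "continuous_on UNIV (\<lambda>lam. (\<lambda>z. sol p q (fst z) v (snd z)) (lam, x))"
    by (rule continuous_on_compose2[OF continuous_on_sol]) (use assms in \<open>auto intro!: continuous_intros\<close>)
  then show ?thesis by simp
qed

text \<open>This is the sum - \<Sum> K G of the overview: G is symmetric, so the off-diagonal
  entries of K enter only through their sum, in which 1/\<rho> cancels. Hence the expression depends
  on \<open>lam\<close> alone.\<close>

definition dF :: "complex \<Rightarrow> complex" where
  "dF lam = - ((fst (csol p q lam pi) - snd (ssol p q lam pi)) * bip (csol p q lam) (ssol p q lam)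
      - fst (ssol p q lam pi) * bip (csol p q lam) (csol p q lam)
      + snd (csol p q lam pi) * bip (ssol p q lam) (ssol p q lam))"

text \<open>The cofactor of \<open>lam - mu\<close> is continuous in \<open>lam\<close>, so the
  difference quotient of F converges and F is entire; no solution is differentiated with respect to
  \<open>lam\<close>.\<close>

lemma hillF_diff:
  "hillF p q lam - hillF p q mu = (lam - mu) * - (fst (csol p q mu pi) * bip (ssol p q mu) (csol p q lam)
      - fst (ssol p q mu pi) * bip (csol p q mu) (csol p q lam)
      + snd (csol p q mu pi) * bip (ssol p q mu) (ssol p q lam)
      - snd (ssol p q mu pi) * bip (csol p q mu) (ssol p q lam))"
proof -
  note w = wronskian_pi[OF is_sol_csol[of lam] is_sol_csol[of mu]]
    wronskian_pi[OF is_sol_ssol[of lam] is_sol_csol[of mu]]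
    wronskian_pi[OF is_sol_csol[of lam] is_sol_ssol[of mu]]
    wronskian_pi[OF is_sol_ssol[of lam] is_sol_ssol[of mu]]
  have d: "fst (csol p q mu pi) * snd (ssol p q mu pi) - snd (csol p q mu pi) * fst (ssol p q mu pi) = 1"
    by (rule sol_det) simp
  \<comment> \<open>The four identities are the entries of M(mu)^T J M(lam) - J. Multiplying from
    the left by M(mu) J^(-1) gives M(lam) - M(mu), because det M(mu) = 1; the claim is the
    trace.\<close>
  show ?thesis
    using w d unfolding hillF_def fst_conv snd_conv by algebra
qed

lemma hillF_has_field_derivative: "(hillF p q has_field_derivative dF mu) (at mu)"
proof -
  let ?D = "\<lambda>lam. - (fst (csol p q mu pi) * bip (ssol p q mu) (csol p q lam)
      - fst (ssol p q mu pi) * bip (csol p q mu) (csol p q lam)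
      + snd (csol p q mu pi) * bip (ssol p q mu) (ssol p q lam)
      - snd (ssol p q mu pi) * bip (csol p q mu) (ssol p q lam))"
  have "continuous_on UNIV ?D"
    unfolding csol_def ssol_def
    by (intro continuous_intros continuous_on_bip_sol is_sol_continuous[OF is_sol_sol])
  then have "(?D \<longlongrightarrow> ?D mu) (at mu)" by (auto simp: continuous_on_def)
  moreover have "?D mu = dF mu"
    by (simp add: dF_def algebra_simps bip_commute[of "ssol p q mu" "csol p q mu"])
  moreover have "\<forall>\<^sub>F lam in at mu. (hillF p q lam - hillF p q mu) / (lam - mu) = ?D lam"
    unfolding eventually_at by (intro exI[of _ 1]) (simp add: hillF_diff)
  ultimately have "((\<lambda>lam. (hillF p q lam - hillF p q mu) / (lam - mu)) \<longlongrightarrow> dF mu) (at mu)"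
    by (simp add: tendsto_cong)
  then show ?thesis by (simp add: has_field_derivative_iff)
qed

lemma hillF_holomorphic: "hillF p q holomorphic_on A"
  using hillF_has_field_derivative
  by (meson holomorphic_onI field_differentiable_def field_differentiable_at_within)

lemma deriv_hillF: "deriv (hillF p q) lam = dF lam"
  by (rule DERIV_imp_deriv[OF hillF_has_field_derivative])

lemma continuous_on_hillF: "continuous_on A (hillF p q)"
  by (rule holomorphic_on_imp_continuous_on[OF hillF_holomorphic])

lemma continuous_on_deriv_hillF: "continuous_on A (deriv (hillF p q))"
  by (rule continuous_on_subset[OF holomorphic_on_imp_continuous_on[OF holomorphic_deriv[OF hillF_holomorphic[of UNIV]]]])
    auto

section \<open>Eigenfunctions and eigenvectors of the monodromy matrix\<close>

definition comb :: "complex \<Rightarrow> complex \<times> complex \<Rightarrow> real \<Rightarrow> complex \<times> complex" where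
  "comb lam v x = (fst v * fst (csol p q lam x) + snd v * fst (ssol p q lam x),
      fst v * snd (csol p q lam x) + snd v * snd (ssol p q lam x))"

lemma is_sol_comb: "is_sol p q lam v (comb lam v)"
  using is_sol_eq_combination[OF is_sol_sol[of lam v]] is_sol_sol[of lam v]
  by (simp add: comb_def[abs_def])

lemma is_sol_imp_comb: "is_sol p q lam v y \<Longrightarrow> y = comb lam v"
  by (rule is_sol_unique[OF _ is_sol_comb])

lemma bip_comb:
  assumes "continuous_on {0..pi} g"
  shows "bip g (comb lam v) = fst v * bip g (csol p q lam) + snd v * bip g (ssol p q lam)"
proof -
  have i: "(\<lambda>s. fst (g s) * fst (u s) + snd (g s) * snd (u s)) integrable_on {0..pi}"
    if "continuous_on {0..pi} u" for u
    using that assms by (intro integrable_continuous_real continuous_intros)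
  note ic = i[OF is_sol_continuous[OF is_sol_csol[of lam]]] and iss = i[OF is_sol_continuous[OF is_sol_ssol[of lam]]]
  have "bip g (comb lam v) = integral {0..pi} (\<lambda>s.
      fst v * (fst (g s) * fst (csol p q lam s) + snd (g s) * snd (csol p q lam s)) +
      snd v * (fst (g s) * fst (ssol p q lam s) + snd (g s) * snd (ssol p q lam s)))"
    unfolding bip_def by (rule integral_cong) (simp add: comb_def algebra_simps)
  also have "\<dots> = fst v * bip g (csol p q lam) + snd v * bip g (ssol p q lam)"
    unfolding bip_def integral_mult_right[symmetric]
    by (rule integral_add) (intro integrable_on_mult_right ic iss)+
  finally show ?thesis .
qed

definition eigvec :: "complex \<Rightarrow> complex \<Rightarrow> complex \<times> complex \<Rightarrow> bool" where
  "eigvec lam r v \<longleftrightarrow> v \<noteq> 0 \<and>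
     fst (csol p q lam pi) * fst v + fst (ssol p q lam pi) * snd v = r * fst v \<and>
     snd (csol p q lam pi) * fst v + snd (ssol p q lam pi) * snd v = r * snd v"

lemma eigvec_exists:
  assumes "hillF p q lam = r + r'" "r * r' = 1" "dF lam \<noteq> 0"
  obtains v where "eigvec lam r v"
proof -
  \<comment> \<open>If M were scalar, all three coefficients in \<open>dF\<close> would
    vanish.\<close>
  have "\<not> (fst (ssol p q lam pi) = 0 \<and> snd (csol p q lam pi) = 0 \<and> fst (csol p q lam pi) = snd (ssol p q lam pi))"
    using assms(3) by (auto simp: dF_def)
  moreover have "fst (csol p q lam pi) * snd (ssol p q lam pi) - fst (ssol p q lam pi) * snd (csol p q lam pi) = 1"
    using sol_det[of pi lam] by (simp add: mult.commute)
  ultimately obtain v1 v2 where "v1 \<noteq> 0 \<or> v2 \<noteq> 0"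
    "fst (csol p q lam pi) * v1 + fst (ssol p q lam pi) * v2 = r * v1"
    "snd (csol p q lam pi) * v1 + snd (ssol p q lam pi) * v2 = r * v2"
    using eigenvector_exists[of "fst (csol p q lam pi)" "snd (ssol p q lam pi)" r r' "fst (ssol p q lam pi)" "snd (csol p q lam pi)"]
      assms(1,2) unfolding hillF_def by metis
  then show ?thesis by (intro that[of "(v1, v2)"]) (auto simp: eigvec_def zero_prod_def)
qed

lemma comb_0: "comb lam v 0 = v"
  by (rule is_sol_0[OF is_sol_comb])

lemma eigvec_boundary:
  "eigvec lam r v \<longleftrightarrow> v \<noteq> 0 \<and> comb lam v pi = (r * fst v, r * snd v)"
  by (auto simp: eigvec_def comb_def mult.commute)

text \<open>\<open>psi\<close> is some eigenfunction, not normalised. Only the existence of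
  \<open>v\<close> is extracted; \<open>riesz_proj\<close> and \<open>alpha_abs\<close> are
  invariant under scaling.\<close>

lemma psi_eq:
  assumes "simple_eig p q t lam"
  obtains v where "eigvec lam (exp (\<i> * of_real pi * t)) v" "psi p q t lam = comb lam v"
proof -
  let ?r = "exp (\<i> * of_real pi * t)"
  have "?r * exp (- (\<i> * of_real pi * t)) = 1" by (simp flip: exp_add)
  then obtain v where v: "eigvec lam ?r v"
    using eigvec_exists[of lam ?r "exp (- (\<i> * of_real pi * t))"] assms
    by (auto simp: simple_eig_def exp_pi_sum deriv_hillF)
  then have "eigfun p q t lam (comb lam v)"
    unfolding eigfun_def by (intro exI[of _ v]) (simp add: eigvec_boundary is_sol_comb comb_0)
  then have "eigfun p q t lam (psi p q t lam)" unfolding psi_def by (rule someI[of "eigfun p q t lam"])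
  then obtain u where u: "u \<noteq> 0" "is_sol p q lam u (psi p q t lam)"
    "psi p q t lam pi = (?r * fst (psi p q t lam 0), ?r * snd (psi p q t lam 0))"
    unfolding eigfun_def by blast
  have e: "psi p q t lam = comb lam u" by (rule is_sol_imp_comb[OF u(2)])
  show ?thesis by (rule that[OF _ e]) (use u in \<open>simp add: eigvec_boundary e comb_0\<close>)
qed

lemma psistar_eq:
  assumes "simple_eig p q t lam"
  obtains w where "eigvec lam (exp (- (\<i> * of_real pi * t))) w"
    "(\<lambda>s. cnj2 (psistar p q t lam s)) = comb lam w"
proof -
  let ?r = "exp (- (\<i> * of_real pi * t))"
  let ?e = "eigfun (\<lambda>x. cnj (p x)) (\<lambda>x. cnj (q x)) (cnj t) (cnj lam)"
  \<comment> \<open>The multiplier of the adjoint problem is the conjugate of exp(-\<i>\<pi>t), so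
    conjugating the boundary condition gives the multiplier 1/\<rho> for the original
    equation.\<close>
  have r: "exp (\<i> * of_real pi * cnj t) = cnj ?r" by (simp add: exp_cnj)
  have "?r * exp (\<i> * of_real pi * t) = 1" by (simp flip: exp_add)
  then obtain v where v: "eigvec lam ?r v"
    using eigvec_exists[of lam ?r "exp (\<i> * of_real pi * t)"] assms
    by (auto simp: simple_eig_def exp_pi_sum deriv_hillF add.commute)
  have "is_sol (\<lambda>x. cnj (p x)) (\<lambda>x. cnj (q x)) (cnj lam) (cnj2 v) (\<lambda>s. cnj2 (comb lam v s))"
    by (rule is_sol_cnj) (simp add: is_sol_comb)
  then have "?e (\<lambda>s. cnj2 (comb lam v s))"
    unfolding eigfun_def r by (intro exI[of _ "cnj2 v"]) (use v in \<open>simp add: eigvec_boundary comb_0 cnj2_def prod_eq_iff\<close>)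
  then have "?e (psistar p q t lam)" unfolding psistar_def by (rule someI[of ?e])
  then obtain u where u: "u \<noteq> 0"
    "is_sol (\<lambda>x. cnj (p x)) (\<lambda>x. cnj (q x)) (cnj lam) u (psistar p q t lam)"
    "psistar p q t lam pi = (cnj ?r * fst (psistar p q t lam 0), cnj ?r * snd (psistar p q t lam 0))"
    unfolding eigfun_def r by blast
  have e: "(\<lambda>s. cnj2 (psistar p q t lam s)) = comb lam (cnj2 u)"
    by (rule is_sol_imp_comb[OF is_sol_cnj[OF u(2)]])
  have "cnj2 (psistar p q t lam 0) = cnj2 u" using fun_cong[OF e, of 0] by (simp add: comb_0)
  moreover have "comb lam (cnj2 u) pi = cnj2 (psistar p q t lam pi)" using fun_cong[OF e, of pi] by simp
  ultimately have "eigvec lam ?r (cnj2 u)"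
    using u(1,3) by (simp add: eigvec_boundary cnj2_def prod_eq_iff)
  then show ?thesis by (rule that[OF _ e])
qed

end

section \<open>The Riesz projection at a simple eigenvalue\<close>

context dirac
begin

definition K11 where "K11 (t::complex) lam = - fst (ssol p q lam pi)"
definition K12 where "K12 t lam = fst (csol p q lam pi) - exp (- (\<i> * of_real pi * t))"
definition K21 where "K21 t lam = exp (- (\<i> * of_real pi * t)) - snd (ssol p q lam pi)"
definition K22 where "K22 (t::complex) lam = snd (csol p q lam pi)"

definition numer :: "complex \<Rightarrow> complex \<Rightarrow> (real \<Rightarrow> complex \<times> complex) \<Rightarrow> complex \<times> complex" where
  "numer t lam g =
     (- (K11 t lam * bip g (csol p q lam) + K12 t lam * bip g (ssol p q lam)),
      - (K21 t lam * bip g (csol p q lam) + K22 t lam * bip g (ssol p q lam)))"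

text \<open>Columns of M - r' are eigenvectors for r, hence parallel to v. The vector w annihilates
  the rows of M - r'; right multiplication by J rotates these rows into the direction of w. Thus K
  has columns along v and rows along w.\<close>

lemma proportional_to_K:
  fixes v1 v2 w1 w2 m11 m12 m21 m22 r r' :: complex
  assumes "m11 + m22 = r + r'"
    and "m11 * v1 + m12 * v2 = r * v1" "m21 * v1 + m22 * v2 = r * v2"
    and "m11 * w1 + m12 * w2 = r' * w1" "m21 * w1 + m22 * w2 = r' * w2"
  shows "v1 * (r' - m22) = - (v2 * m12)" "v1 * m21 = v2 * (m11 - r')"
    and "w1 * (m11 - r') = - (w2 * m12)" "w1 * m21 = w2 * (r' - m22)"
  using assms by algebra+

text \<open>The scalar relating v w^T to K is found by pairing both with the Gram matrix G: the
  first gives \<open>a\<close>, the second gives - F'. In particular \<open>a\<close> cannot vanish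
  at a simple eigenvalue.\<close>

lemma riesz_data:
  assumes s: "simple_eig p q t lam"
  obtains v w a where "v \<noteq> 0" "w \<noteq> 0" "psi p q t lam = comb lam v"
    "(\<lambda>s. cnj2 (psistar p q t lam s)) = comb lam w"
    "bip (psi p q t lam) (comb lam w) = a" "a \<noteq> 0"
    "fst v * fst w * dF lam = - a * K11 t lam" "fst v * snd w * dF lam = - a * K12 t lam"
    "snd v * fst w * dF lam = - a * K21 t lam" "snd v * snd w * dF lam = - a * K22 t lam"
proof -
  let ?r = "exp (\<i> * of_real pi * t)" and ?r' = "exp (- (\<i> * of_real pi * t))"
  obtain v where v: "eigvec lam ?r v" "psi p q t lam = comb lam v" by (rule psi_eq[OF s])
  obtain w where w: "eigvec lam ?r' w" "(\<lambda>s. cnj2 (psistar p q t lam s)) = comb lam w"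
    by (rule psistar_eq[OF s])
  define v1 v2 w1 w2 where vw: "v1 = fst v" "v2 = snd v" "w1 = fst w" "w2 = snd w"
  define k11 k12 k21 k22 where k: "k11 = K11 t lam" "k12 = K12 t lam" "k21 = K21 t lam" "k22 = K22 t lam"
  define gcc gcs gss where g: "gcc = bip (csol p q lam) (csol p q lam)"
    "gcs = bip (csol p q lam) (ssol p q lam)" "gss = bip (ssol p q lam) (ssol p q lam)"
  have tr: "fst (csol p q lam pi) + snd (ssol p q lam pi) = ?r + ?r'"
    using s by (simp add: simple_eig_def hillF_def exp_pi_sum)
  have pr: "v1 * k21 = v2 * k11" "v1 * k22 = v2 * k12" "w1 * k12 = w2 * k11" "w1 * k22 = w2 * k21"
    using proportional_to_K[OF tr, of v1 "fst (ssol p q lam pi)" v2 "snd (csol p q lam pi)" w1 w2] v(1) w(1)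
    by (auto simp: eigvec_def vw k K11_def K12_def K21_def K22_def)
  define a where "a = bip (psi p q t lam) (comb lam w)"
  have c: "continuous_on {0..pi} (comb lam u)" "continuous_on {0..pi} (csol p q lam)"
      "continuous_on {0..pi} (ssol p q lam)" for u
    using is_sol_continuous is_sol_comb is_sol_csol is_sol_ssol by blast+
  have a: "a = v1 * w1 * gcc + (v1 * w2 + v2 * w1) * gcs + v2 * w2 * gss"
    unfolding a_def v(2) bip_comb[OF c(1)] bip_commute[of "comb lam v"] bip_comb[OF c(2)] bip_comb[OF c(3)] g vw
    by (simp add: algebra_simps bip_commute[of "ssol p q lam" "csol p q lam"])
  have dF: "dF lam = - (k11 * gcc + (k12 + k21) * gcs + k22 * gss)"
    by (simp add: dF_def k g K11_def K12_def K21_def K22_def algebra_simps)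
  \<comment> \<open>Proportionality in the form (v w^T)_ij K_kl = (v w^T)_kl K_ij is contracted with
    G_kl; nothing is divided, so zero entries of K do no harm.\<close>
  have e: "v1 * w1 * dF lam = - a * k11" "v1 * w2 * dF lam = - a * k12"
       "v2 * w1 * dF lam = - a * k21" "v2 * w2 * dF lam = - a * k22"
    using pr unfolding a dF by algebra+
  have nz: "v \<noteq> 0" "w \<noteq> 0" "dF lam \<noteq> 0"
    using v(1) w(1) s by (auto simp: eigvec_def simple_eig_def deriv_hillF)
  have "a \<noteq> 0"
  proof
    assume "a = 0"
    with e nz(3) have "v1 * w1 = 0" "v1 * w2 = 0" "v2 * w1 = 0" "v2 * w2 = 0" by auto
    then show False using nz(1,2) by (auto simp: vw prod_eq_iff)
  qed
  then show ?thesis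
    using e unfolding vw k by (intro that[OF nz(1,2) v(2) w(2) a_def[symmetric]])
qed

text \<open>The arbitrary choices of \<open>v\<close> and \<open>w\<close> drop out. The numerator
  will be continuous in (t, lam), so the projection along a continuous label is a quotient of
  continuous functions wherever the eigenvalue is simple.\<close>

lemma riesz_proj_formula:
  assumes s: "simple_eig p q t lam" and g: "continuous_on {0..pi} g"
  shows "riesz_proj p q t lam g x =
    (fst (comb lam (numer t lam g) x) / deriv (hillF p q) lam,
     snd (comb lam (numer t lam g) x) / deriv (hillF p q) lam)"
proof -
  obtain v w a where vw: "v \<noteq> 0" "w \<noteq> 0" "psi p q t lam = comb lam v"
    "(\<lambda>s. cnj2 (psistar p q t lam s)) = comb lam w"
    and a: "bip (psi p q t lam) (comb lam w) = a" and a0: "a \<noteq> 0"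
    and e: "fst v * fst w * dF lam = - a * K11 t lam" "fst v * snd w * dF lam = - a * K12 t lam"
    "snd v * fst w * dF lam = - a * K21 t lam" "snd v * snd w * dF lam = - a * K22 t lam"
    by (rule riesz_data[OF s])
  define b1 b2 where b: "b1 = bip g (csol p q lam)" "b2 = bip g (ssol p q lam)"
  have nz: "dF lam \<noteq> 0" using s by (simp add: simple_eig_def deriv_hillF)
  have n: "(fst w * b1 + snd w * b2) / a * fst v = fst (numer t lam g) / dF lam"
     "(fst w * b1 + snd w * b2) / a * snd v = snd (numer t lam g) / dF lam"
    using e a0 nz unfolding numer_def b[symmetric] fst_conv snd_conv
    by (auto simp: divide_simps) (algebra+)
  have lin: "(fst w * b1 + snd w * b2) / a * (fst v * X + snd v * Y)
      = (fst (numer t lam g) * X + snd (numer t lam g) * Y) / dF lam" for X Y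
    unfolding distrib_left mult.assoc[symmetric] n by (simp add: add_divide_distrib)
  have "ip g (psistar p q t lam) = fst w * b1 + snd w * b2"
    unfolding ip_eq_bip vw(4) b by (rule bip_comb[OF g])
  moreover have "ip (psi p q t lam) (psistar p q t lam) = a"
    unfolding ip_eq_bip vw(4) by (rule a)
  ultimately have "riesz_proj p q t lam g x =
    ((fst w * b1 + snd w * b2) / a * fst (comb lam v x), (fst w * b1 + snd w * b2) / a * snd (comb lam v x))"
    using s by (simp add: riesz_proj_def Let_def vw(3))
  also have "\<dots> = (fst (comb lam (numer t lam g) x) / dF lam, snd (comb lam (numer t lam g) x) / dF lam)"
    unfolding comb_def fst_conv snd_conv lin ..
  finally show ?thesis by (simp add: deriv_hillF)
qed

section \<open>Norms of solutions against their initial vectors\<close>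

lemma norm_comb_le:
  assumes "norm (csol p q lam x) \<le> E" "norm (ssol p q lam x) \<le> E"
  shows "norm (comb lam v x) \<le> 4 * E * norm v"
proof -
  have E: "E \<ge> 0" using order_trans[OF norm_ge_zero assms(1)] .
  have le: "cmod (fst u) \<le> norm u" "cmod (snd u) \<le> norm u" for u :: "complex \<times> complex"
    using norm_fst_le[of "fst u" "snd u"] norm_snd_le[of "snd u" "fst u"] by simp_all
  have "cmod (a * b) \<le> E * norm v" if "cmod a \<le> norm v" "cmod b \<le> E" for a b
    using that E by (simp add: norm_mult mult.commute[of E] mult_mono)
  then have *: "cmod (fst v * fst (csol p q lam x)) \<le> E * norm v" "cmod (snd v * fst (ssol p q lam x)) \<le> E * norm v"
    "cmod (fst v * snd (csol p q lam x)) \<le> E * norm v" "cmod (snd v * snd (ssol p q lam x)) \<le> E * norm v"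
    using le[of v] order_trans[OF le(1) assms(1)] order_trans[OF le(2) assms(1)]
      order_trans[OF le(1) assms(2)] order_trans[OF le(2) assms(2)] by blast+
  have "norm (comb lam v x) \<le> cmod (fst v * fst (csol p q lam x) + snd v * fst (ssol p q lam x))
      + cmod (fst v * snd (csol p q lam x) + snd v * snd (ssol p q lam x))"
    unfolding comb_def by (rule norm_Pair_le)
  also have "\<dots> \<le> 4 * E * norm v"
    using * norm_triangle_ineq[of "fst v * fst (csol p q lam x)" "snd v * fst (ssol p q lam x)"]
      norm_triangle_ineq[of "fst v * snd (csol p q lam x)" "snd v * snd (ssol p q lam x)"] by linarith
  finally show ?thesis .
qed

text \<open>The fundamental matrix has determinant 1, so its inverse has the same entries up to sign
  and position and obeys the same bound \<open>E\<close>.\<close>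

lemma norm_le_comb:
  assumes x: "x \<in> {0..pi}" and "norm (csol p q lam x) \<le> E" "norm (ssol p q lam x) \<le> E"
  shows "norm v \<le> 4 * E * norm (comb lam v x)"
proof -
  define y where "y = comb lam v x"
  have E: "E \<ge> 0" using order_trans[OF norm_ge_zero assms(2)] .
  have le: "cmod (fst u) \<le> norm u" "cmod (snd u) \<le> norm u" for u :: "complex \<times> complex"
    using norm_fst_le[of "fst u" "snd u"] norm_snd_le[of "snd u" "fst u"] by simp_all
  have d: "fst (csol p q lam x) * snd (ssol p q lam x) - snd (csol p q lam x) * fst (ssol p q lam x) = 1"
    by (rule sol_det[OF x])
  have v1: "fst v = snd (ssol p q lam x) * fst y - fst (ssol p q lam x) * snd y"
    using d unfolding y_def comb_def fst_conv snd_conv by algebra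
  have v2: "snd v = fst (csol p q lam x) * snd y - snd (csol p q lam x) * fst y"
    using d unfolding y_def comb_def fst_conv snd_conv by algebra
  have "cmod (b * a) \<le> E * norm y" if "cmod a \<le> norm y" "cmod b \<le> E" for a b
    using that E by (simp add: norm_mult mult_mono)
  then have *: "cmod (snd (ssol p q lam x) * fst y) \<le> E * norm y" "cmod (fst (ssol p q lam x) * snd y) \<le> E * norm y"
    "cmod (fst (csol p q lam x) * snd y) \<le> E * norm y" "cmod (snd (csol p q lam x) * fst y) \<le> E * norm y"
    using le[of y] order_trans[OF le(1) assms(2)] order_trans[OF le(2) assms(2)]
      order_trans[OF le(1) assms(3)] order_trans[OF le(2) assms(3)] by blast+
  have "norm v \<le> cmod (fst v) + cmod (snd v)" using norm_Pair_le[of "fst v" "snd v"] by simp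
  also have "\<dots> \<le> 4 * E * norm y"
    unfolding v1 v2
    using * norm_triangle_ineq4[of "snd (ssol p q lam x) * fst y" "fst (ssol p q lam x) * snd y"]
      norm_triangle_ineq4[of "fst (csol p q lam x) * snd y" "snd (csol p q lam x) * fst y"] by linarith
  finally show ?thesis by (simp add: y_def)
qed

text \<open>\<open>alpha_abs\<close> is normalised by L2 norms while the projection is estimated
  through initial vectors; this passes from the latter to the former. The interval length \<pi> > 1
  is discarded.\<close>

lemma norm_le_l2norm_comb:
  assumes E: "\<And>s. s \<in> {0..pi} \<Longrightarrow> norm (csol p q lam s) \<le> E" "\<And>s. s \<in> {0..pi} \<Longrightarrow> norm (ssol p q lam s) \<le> E"
  shows "norm v \<le> 4 * E * l2norm (comb lam v)"
proof -
  have E0: "E \<ge> 0" using order_trans[OF norm_ge_zero E(1)[of 0]] by simp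
  have c: "continuous_on {0..pi} (comb lam v)" by (rule is_sol_continuous[OF is_sol_comb])
  define I where "I = integral {0..pi} (\<lambda>s. (norm (comb lam v s))\<^sup>2)"
  have i: "(\<lambda>s. (norm (comb lam v s))\<^sup>2) integrable_on {0..pi}"
    by (intro integrable_continuous_real continuous_intros c)
  have "integral {0..pi} (\<lambda>s. (norm v)\<^sup>2) \<le> integral {0..pi} (\<lambda>s. (4 * E)\<^sup>2 * (norm (comb lam v s))\<^sup>2)"
  proof (rule integral_le)
    show "(norm v)\<^sup>2 \<le> (4 * E)\<^sup>2 * (norm (comb lam v s))\<^sup>2" if "s \<in> {0..pi}" for s
      using norm_le_comb[OF that E(1)[OF that] E(2)[OF that], of v]
      unfolding power_mult_distrib[symmetric] by (rule power_mono) simp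
  qed (use i in \<open>auto intro!: integrable_on_mult_right\<close>)
  then have "pi * (norm v)\<^sup>2 \<le> (4 * E)\<^sup>2 * I" by (simp add: I_def)
  moreover have "1 * (norm v)\<^sup>2 \<le> pi * (norm v)\<^sup>2"
    using pi_gt3 by (intro mult_right_mono) auto
  ultimately have "(norm v)\<^sup>2 \<le> (4 * E)\<^sup>2 * I" by linarith
  then have "sqrt ((norm v)\<^sup>2) \<le> sqrt ((4 * E)\<^sup>2 * I)" by (rule real_sqrt_le_mono)
  then show ?thesis
    using E0 by (simp add: real_sqrt_mult l2norm_eq[OF c] I_def)
qed

text \<open>Near an integer \<open>weight\<close> is out of control, so the bound is in terms of the
  quantity that \<open>is_ESS\<close> refers to. The constant involves only bounds for the
  fundamental solutions and for \<open>g\<close>, hence can be kept fixed while t varies in a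
  compact interval.\<close>

lemma riesz_proj_le_alpha:
  assumes s: "simple_eig p q t lam" and x: "x \<in> {0..pi}"
    and E: "\<And>s. s \<in> {0..pi} \<Longrightarrow> norm (csol p q lam s) \<le> E" "\<And>s. s \<in> {0..pi} \<Longrightarrow> norm (ssol p q lam s) \<le> E"
    and G: "\<And>s. s \<in> {0..pi} \<Longrightarrow> norm (g s) \<le> G"
  shows "norm (riesz_proj p q t lam g x) \<le> 2 * (2 * pi * G * (4 * E) * (4 * E)) * (4 * E)\<^sup>2 * (1 / alpha_abs p q t lam)"
proof -
  obtain v w a where vw: "psi p q t lam = comb lam v"
    "(\<lambda>s. cnj2 (psistar p q t lam s)) = comb lam w"
    and a: "bip (psi p q t lam) (comb lam w) = a"
    by (rule riesz_data[OF s])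
  have E0: "E \<ge> 0" using order_trans[OF norm_ge_zero E(1)[of 0]] by simp
  have G0: "G \<ge> 0" using order_trans[OF norm_ge_zero G[of 0]] by simp
  let ?z = "psistar p q t lam"
  have ce: "continuous_on {0..pi} (comb lam u)" for u by (rule is_sol_continuous[OF is_sol_comb])
  have z: "?z = (\<lambda>s. cnj2 (comb lam w s))" by (simp add: vw(2)[symmetric])
  have cz: "continuous_on {0..pi} ?z"
    unfolding z by (rule bounded_linear.continuous_on[OF bounded_linear_cnj2 ce])
  have lz: "l2norm ?z = l2norm (comb lam w)"
    unfolding l2norm_eq[OF cz] l2norm_eq[OF ce] by (simp add: z)
  define b where "b = ip g ?z"
  have b: "cmod b \<le> 2 * pi * G * (4 * E * norm w)"
    unfolding b_def ip_eq_bip vw(2)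
    by (rule bip_bound) (use norm_comb_le E G in auto)
  have "ip (psi p q t lam) ?z = a" by (simp add: ip_eq_bip vw(2) a)
  then have rp: "riesz_proj p q t lam g x = (b / a * fst (comb lam v x), b / a * snd (comb lam v x))"
    and al: "1 / alpha_abs p q t lam = l2norm (comb lam v) * l2norm (comb lam w) / cmod a"
    using s by (simp_all add: riesz_proj_def Let_def vw(1) b_def alpha_abs_def lz)
  define c where "c = comb lam v x"
  have le: "cmod (fst c) \<le> norm c" "cmod (snd c) \<le> norm c"
    using norm_fst_le[of "fst c" "snd c"] norm_snd_le[of "snd c" "fst c"] by simp_all
  have lv: "norm v \<le> 4 * E * l2norm (comb lam v)" and lw: "norm w \<le> 4 * E * l2norm (comb lam w)"
    by (rule norm_le_l2norm_comb[OF E]; assumption)+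
  have "norm (riesz_proj p q t lam g x) \<le> cmod (b / a * fst c) + cmod (b / a * snd c)"
    unfolding rp c_def by (rule norm_Pair_le)
  also have "\<dots> \<le> cmod b / cmod a * norm c + cmod b / cmod a * norm c"
    unfolding norm_mult norm_divide by (intro add_mono mult_left_mono le) auto
  also have "\<dots> = 2 * (cmod b * norm c / cmod a)" by simp
  also have "\<dots> \<le> 2 * ((2 * pi * G * (4 * E * norm w)) * (4 * E * norm v) / cmod a)"
    unfolding c_def
    by (intro mult_left_mono divide_right_mono mult_mono b norm_comb_le E x) (use E0 G0 in auto)
  also have "\<dots> = 2 * (2 * pi * G * (4 * E) * (4 * E)) * (norm v * norm w / cmod a)" by simp
  also have "\<dots> \<le> 2 * (2 * pi * G * (4 * E) * (4 * E)) *
      ((4 * E * l2norm (comb lam v)) * (4 * E * l2norm (comb lam w)) / cmod a)"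
    by (intro mult_left_mono divide_right_mono mult_mono lv lw)
      (use E0 G0 order_trans[OF norm_ge_zero lv] in auto)
  also have "\<dots> = 2 * (2 * pi * G * (4 * E) * (4 * E)) * (4 * E)\<^sup>2 * (1 / alpha_abs p q t lam)"
    unfolding al by (simp add: power2_eq_square)
  finally show ?thesis .
qed

end

section \<open>Integrability along a real branch of eigenvalues\<close>

lemma borel_measurable_lebesgue_on:
  fixes f :: "'a::euclidean_space \<Rightarrow> 'b::euclidean_space"
  assumes "f \<in> borel_measurable borel"
  shows "f \<in> borel_measurable (lebesgue_on S)"
  using assms by (intro measurable_restrict_space1 measurable_completion) simp

lemma integrable_on_abs_powr:
  fixes a t0 e :: real
  assumes "a > -1" "e \<ge> 0"
  shows "(\<lambda>t. \<bar>t - t0\<bar> powr a) integrable_on {t0 - e..t0 + e}"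
proof -
  have pos: "(\<lambda>x::real. \<bar>x\<bar> powr a) integrable_on {0..e}"
    by (rule integrable_eq[OF integrable_on_powr_from_0[OF assms]]) simp
  then have "(\<lambda>x::real. \<bar>- x\<bar> powr a) integrable_on {-e..-0}"
    by (subst Henstock_Kurzweil_Integration.integrable_reflect_real)
  then have neg: "(\<lambda>x::real. \<bar>x\<bar> powr a) integrable_on {-e..0}" by simp
  have "(\<lambda>x::real. \<bar>x\<bar> powr a) integrable_on {-e..e}"
    by (rule Henstock_Kurzweil_Integration.integrable_combine[OF _ _ neg pos]) (use assms in auto)
  moreover have "(\<lambda>x::real. \<bar>x\<bar> powr a) = (\<lambda>t. \<bar>t - t0\<bar> powr a) \<circ> (+) t0" by auto
  ultimately show ?thesis
    using integrable_on_shift_Icc_real[of "\<lambda>t. \<bar>t - t0\<bar> powr a" t0 "-e" e] by (simp add: add.commute)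
qed

lemma absolutely_integrable_on_locally:
  fixes f :: "real \<Rightarrow> 'a::euclidean_space"
  assumes "\<And>x. x \<in> {a..b} \<Longrightarrow> \<exists>e>0. f absolutely_integrable_on {x - e..x + e}"
  shows "f absolutely_integrable_on {a..b}"
proof -
  obtain e where e: "\<And>x. x \<in> {a..b} \<Longrightarrow> e x > 0"
      "\<And>x. x \<in> {a..b} \<Longrightarrow> f absolutely_integrable_on {x - e x..x + e x}"
    using assms by metis
  have "{a..b} \<subseteq> (\<Union>x\<in>{a..b}. {x - e x<..<x + e x})" using e(1) by force
  then obtain C where C: "C \<subseteq> {a..b}" "finite C" "{a..b} \<subseteq> (\<Union>x\<in>C. {x - e x<..<x + e x})"
    by (rule compactE_image[OF compact_Icc, rotated]) auto
  have "f absolutely_integrable_on (\<Union>x\<in>C. {x - e x..x + e x})"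
    using C(2,1)
  proof (induction C)
    case (insert x C)
    then show ?case by (auto intro!: absolutely_integrable_Un e(2))
  qed simp
  moreover have "{a..b} \<subseteq> (\<Union>x\<in>C. {x - e x..x + e x})"
    using C(3) by (rule order_trans) (intro UN_mono, auto)
  ultimately show ?thesis by (auto intro: set_integrable_subset)
qed

text \<open>Raise the hypothesis to the power m/(m+1). In the application \<open>d\<close> is the
  displacement of the eigenvalue and \<open>s\<close> that of t.\<close>

lemma reciprocal_power_le_powr:
  fixes d k s :: real
  assumes "k > 0" "s > 0" "d \<ge> 0" "k * s \<le> d ^ Suc m"
  shows "1 / d ^ m \<le> k powr (- (m / Suc m)) * s powr (- (m / Suc m))"
proof -
  have "0 < d ^ Suc m" using assms by (meson mult_pos_pos order_less_le_trans)
  then have d: "d > 0" using assms(3) by (cases "d = 0") auto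
  have "(k * s) powr (m / Suc m) \<le> (d ^ Suc m) powr (m / Suc m)"
    using assms by (intro powr_mono2) auto
  also have "\<dots> = (d powr real (Suc m)) powr (m / Suc m)" using d by (simp only: powr_realpow)
  also have "\<dots> = d powr (real (Suc m) * (m / Suc m))" by (rule powr_powr)
  also have "real (Suc m) * (m / Suc m) = m" by (simp del: of_nat_Suc)
  also have "d powr m = d ^ m" using d by (simp add: powr_realpow)
  finally have "1 / d ^ m \<le> 1 / (k * s) powr (m / Suc m)"
    using assms d by (intro divide_left_mono) auto
  also have "\<dots> = k powr (- (m / Suc m)) * s powr (- (m / Suc m))"
    using assms by (simp add: powr_mult powr_minus divide_inverse)
  finally show ?thesis .
qed

text \<open>Near \<open>mu\<close>, f is (z - mu)^m times a function without zeros on a closed disc.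
  Allowing m = 0 treats simple and multiple eigenvalues together; the point \<open>z0\<close>
  excludes f = 0.\<close>

lemma holomorphic_order_bounds:
  fixes f :: "complex \<Rightarrow> complex"
  assumes f: "f holomorphic_on UNIV" and nz: "f z0 \<noteq> 0"
  obtains m :: nat and r c C where "r > 0" "c > 0" "C > 0"
    "\<And>z. z \<in> cball mu r \<Longrightarrow> c * cmod (z - mu) ^ m \<le> cmod (f z)"
    "\<And>z. z \<in> cball mu r \<Longrightarrow> cmod (f z) \<le> C * cmod (z - mu) ^ m"
proof -
  obtain g r m where g: "r > 0" "continuous_on (cball mu r) g"
    "\<And>z. z \<in> cball mu r \<Longrightarrow> f z = (z - mu) ^ m * g z" "\<And>z. z \<in> cball mu r \<Longrightarrow> g z \<noteq> 0"
  proof (cases "f mu = 0")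
    case True
    have "\<not> f constant_on UNIV" using True nz unfolding constant_on_def by (metis UNIV_I)
    then obtain g r n where g: "0 < r" "g holomorphic_on ball mu r"
      "\<And>w. w \<in> ball mu r \<Longrightarrow> f w = (w - mu)^n * g w" "\<And>w. w \<in> ball mu r \<Longrightarrow> g w \<noteq> 0"
      using holomorphic_factor_zero_nonconstant[OF f open_UNIV connected_UNIV UNIV_I True] by metis
    have sub: "cball mu (r / 2) \<subseteq> ball mu r" using g(1) by auto
    show ?thesis
      by (rule that[of "r / 2" g n])
        (use g sub in \<open>auto intro: continuous_on_subset[OF holomorphic_on_imp_continuous_on]\<close>)
  next
    case False
    have c: "continuous_on UNIV f" by (rule holomorphic_on_imp_continuous_on[OF f])
    then have "isCont f mu" by (simp add: continuous_on_eq_continuous_at)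
    from continuous_at_avoid[OF this False] obtain e where e: "e > 0" "\<And>y. dist mu y < e \<Longrightarrow> f y \<noteq> 0" by blast
    show ?thesis
      by (rule that[of "e / 2" f 0]) (use e in \<open>auto intro: continuous_on_subset[OF c]\<close>)
  qed
  have "compact (cball mu r)" "cball mu r \<noteq> {}" using g(1) by auto
  moreover have "continuous_on (cball mu r) (\<lambda>z. cmod (g z))" by (intro continuous_intros g(2))
  ultimately obtain z1 z2 where z: "z1 \<in> cball mu r" "z2 \<in> cball mu r"
    "\<And>z. z \<in> cball mu r \<Longrightarrow> cmod (g z1) \<le> cmod (g z)" "\<And>z. z \<in> cball mu r \<Longrightarrow> cmod (g z) \<le> cmod (g z2)"
    using continuous_attains_inf[of "cball mu r" "\<lambda>z. cmod (g z)"]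
      continuous_attains_sup[of "cball mu r" "\<lambda>z. cmod (g z)"] by metis
  show ?thesis
  proof (rule that[of r "cmod (g z1)" "cmod (g z2)" m])
    show "cmod (g z1) * cmod (z - mu) ^ m \<le> cmod (f z)" "cmod (f z) \<le> cmod (g z2) * cmod (z - mu) ^ m"
      if "z \<in> cball mu r" for z
      using z(3,4)[OF that] by (simp_all add: g(3)[OF that] norm_mult norm_power mult.commute mult_left_mono mult_right_mono)
  qed (use g(1,4) z in auto)
qed

lemma two_cos_of_real:
  "2 * cos (of_real pi * of_real t) = complex_of_real (2 * cos (pi * t))"
  by (metis cos_of_real of_real_mult of_real_numeral)

locale branch =
  fixes F :: "complex \<Rightarrow> complex" and L :: "real \<Rightarrow> complex"
  assumes F: "F holomorphic_on UNIV" and L: "continuous_on UNIV L"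
begin

definition simple_set :: "real set" where
  "simple_set = {t. F (L t) = 2 * cos (of_real pi * of_real t) \<and> deriv F (L t) \<noteq> 0}"

text \<open>The value 0 off \<open>simple_set\<close> mirrors the value 0 of
  \<open>riesz_proj\<close> at an eigenvalue that is not simple, so that a multiple of
  \<open>weight\<close> dominates the projection at every t.\<close>

definition weight :: "real \<Rightarrow> real" where
  "weight t = (if t \<in> simple_set then 1 / cmod (deriv F (L t)) else 0)"

lemma continuous_F: "continuous_on UNIV (\<lambda>t. F (L t))"
  by (rule continuous_on_compose2[OF holomorphic_on_imp_continuous_on[OF F] L]) auto

lemma continuous_deriv_F: "continuous_on UNIV (\<lambda>t. deriv F (L t))"
  by (rule continuous_on_compose2[OF holomorphic_on_imp_continuous_on[OF holomorphic_deriv[OF F open_UNIV]] L]) auto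

lemma simple_set_borel [measurable]: "simple_set \<in> sets borel"
proof -
  have "closed {t. F (L t) = 2 * cos (of_real pi * of_real t)}"
    by (intro closed_Collect_eq continuous_F continuous_intros)
  moreover have "open {t. deriv F (L t) \<noteq> 0}"
    by (intro open_Collect_neq continuous_deriv_F continuous_intros)
  ultimately have "{t. F (L t) = 2 * cos (of_real pi * of_real t)} \<inter> {t. deriv F (L t) \<noteq> 0} \<in> sets borel"
    by (intro sets.Int borel_closed borel_open)
  then show ?thesis by (simp add: simple_set_def Collect_conj_eq)
qed

lemma weight_measurable: "weight \<in> borel_measurable borel"
proof -
  have [measurable]: "(\<lambda>t. deriv F (L t)) \<in> borel_measurable borel"
    by (rule borel_measurable_continuous_onI[OF continuous_deriv_F])
  show ?thesis unfolding weight_def by measurable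
qed

lemma weight_integrable_locally:
  assumes t0: "sin (pi * t0) \<noteq> 0"
  shows "\<exists>e>0. weight absolutely_integrable_on {t0 - e..t0 + e}"
proof -
  have bounded_case: "\<exists>e>0. weight absolutely_integrable_on {t0 - e..t0 + e}"
    if "e > 0" "g integrable_on {t0 - e..t0 + e}" "\<And>t. t \<in> {t0 - e..t0 + e} \<Longrightarrow> weight t \<le> g t" for e g
    using that
    by (intro exI[of _ e] conjI measurable_bounded_by_integrable_imp_absolutely_integrable[of _ _ g]
        borel_measurable_lebesgue_on weight_measurable) (auto simp: weight_def)
  define mu where "mu = L t0"
  show ?thesis
  proof (cases "F mu = 2 * cos (of_real pi * complex_of_real t0)")
    \<comment> \<open>\<open>L t0\<close> is not an eigenvalue; by continuity neither is
      \<open>L t\<close> nearby, and the weight vanishes there.\<close>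
    case False
    have c: "isCont (\<lambda>t. F (L t) - 2 * cos (of_real pi * of_real t)) t0"
      using continuous_F by (intro continuous_intros) (simp add: continuous_on_eq_continuous_at)
    have "F (L t0) - 2 * cos (of_real pi * complex_of_real t0) \<noteq> 0" using False by (simp add: mu_def)
    from continuous_at_avoid[OF c this] obtain e where
      e: "e > 0" "\<And>t. dist t0 t < e \<Longrightarrow> F (L t) - 2 * cos (of_real pi * of_real t) \<noteq> 0" by blast
    show ?thesis
    proof (rule bounded_case[of "e / 2" "\<lambda>_. 0"])
      show "weight t \<le> 0" if "t \<in> {t0 - e / 2..t0 + e / 2}" for t
      proof -
        have "dist t0 t < e" using that e(1) by (auto simp: dist_real_def)
        from e(2)[OF this] show ?thesis by (simp add: weight_def simple_set_def)
      qed
    qed (use e in auto)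
  next
    case Fmu: True
    show ?thesis
    proof (cases "\<exists>z0. deriv F z0 \<noteq> 0")
      \<comment> \<open>F is constant, so \<open>simple_set\<close> is empty.\<close>
      case False
      then have "weight = (\<lambda>_. 0)" by (auto simp: weight_def simple_set_def)
      then show ?thesis by (intro exI[of _ 1]) simp
    next
      case True
      then obtain z0 where "deriv F z0 \<noteq> 0" by blast
      from holomorphic_order_bounds[OF holomorphic_deriv[OF F open_UNIV] this, of mu]
      obtain m r c C where r: "r > 0" "c > 0" "C > 0"
        and lo: "\<And>z. z \<in> cball mu r \<Longrightarrow> c * cmod (z - mu) ^ m \<le> cmod (deriv F z)"
        and up: "\<And>z. z \<in> cball mu r \<Longrightarrow> cmod (deriv F z) \<le> C * cmod (z - mu) ^ m" by metis
      \<comment> \<open>The mean value inequality on the disc of radius \<bar>z - mu\<bar>, on which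
        F' is at most C \<bar>z - mu\<bar>^m, gains the extra order.\<close>
      have Fle: "cmod (F z - F mu) \<le> C * cmod (z - mu) ^ Suc m" if z: "z \<in> cball mu r" for z
      proof -
        have "cmod (F z - F mu) \<le> (C * cmod (z - mu) ^ m) * cmod (z - mu)"
        proof (rule field_differentiable_bound[of "cball mu (cmod (z - mu))" F "deriv F"])
          show "(F has_field_derivative deriv F w) (at w within cball mu (cmod (z - mu)))" for w
            by (rule holomorphic_derivI[OF F open_UNIV]) simp
          show "cmod (deriv F w) \<le> C * cmod (z - mu) ^ m" if w: "w \<in> cball mu (cmod (z - mu))" for w
          proof -
            have "cmod (w - mu) \<le> cmod (z - mu)" using w by (simp add: dist_norm norm_minus_commute)
            moreover have "cmod (z - mu) \<le> r" using z by (simp add: dist_norm norm_minus_commute)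
            ultimately have "w \<in> cball mu r" "C * cmod (w - mu) ^ m \<le> C * cmod (z - mu) ^ m"
              using r by (auto simp: dist_norm norm_minus_commute intro!: mult_left_mono power_mono)
            then show ?thesis using up[of w] by linarith
          qed
        qed (auto simp: dist_norm norm_minus_commute)
        then show ?thesis by (simp add: mult_ac)
      qed
      \<comment> \<open>Half the slope of 2 cos \<pi>t at \<open>t0\<close>, so that difference
        quotients exceed \<open>k\<close> close to \<open>t0\<close>.\<close>
      define k where "k = \<bar>pi * sin (pi * t0)\<bar>"
      have k: "k > 0" using t0 by (simp add: k_def)
      have "((\<lambda>t. 2 * cos (pi * t)) has_real_derivative (- 2 * pi * sin (pi * t0))) (at t0)"
        by (auto intro!: derivative_eq_intros)
      then have "((\<lambda>t. \<bar>(2 * cos (pi * t) - 2 * cos (pi * t0)) / (t - t0)\<bar>) \<longlongrightarrow> \<bar>- 2 * pi * sin (pi * t0)\<bar>) (at t0)"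
        by (intro tendsto_rabs) (simp add: has_field_derivative_iff)
      moreover have "\<bar>- 2 * pi * sin (pi * t0)\<bar> = 2 * k" by (simp add: k_def abs_mult)
      ultimately have "\<forall>\<^sub>F t in at t0. \<bar>(2 * cos (pi * t) - 2 * cos (pi * t0)) / (t - t0)\<bar> > k"
        using k by (intro order_tendstoD(1)) auto
      then obtain e1 where e1: "e1 > 0"
        "\<And>t. t \<noteq> t0 \<Longrightarrow> dist t t0 < e1 \<Longrightarrow> \<bar>(2 * cos (pi * t) - 2 * cos (pi * t0)) / (t - t0)\<bar> > k"
        unfolding eventually_at by auto
      have cos_lower: "k * \<bar>t - t0\<bar> \<le> \<bar>2 * cos (pi * t) - 2 * cos (pi * t0)\<bar>" if "dist t t0 < e1" for t
      proof (cases "t = t0")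
        case False
        then show ?thesis using e1(2)[OF False that] by (simp add: abs_divide divide_simps split: if_splits)
      qed simp
      have "isCont L t0" using L by (simp add: continuous_on_eq_continuous_at)
      then obtain e2 where e2: "e2 > 0" "\<And>t. dist t t0 < e2 \<Longrightarrow> dist (L t) mu < r"
        using r(1) unfolding continuous_at_eps_delta mu_def dist_norm by (metis real_norm_def)
      define e where "e = min e1 e2 / 2"
      have e: "e > 0" "e < e1" "e < e2" using e1 e2 by (auto simp: e_def min_def)
      let ?a = "- (m / Suc m)"
      let ?g = "\<lambda>t. 1 / c * (k / C) powr ?a * \<bar>t - t0\<bar> powr ?a"
      have "?a > -1" by (simp add: field_simps)
      then have "?g integrable_on {t0 - e..t0 + e}"
        using e by (intro integrable_on_mult_right integrable_on_abs_powr) auto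
      \<comment> \<open>\<open>0 powr a\<close> is 0 even for a = 0. If m = 0 the majorant would
        therefore vanish at \<open>t0\<close> while the weight need not; this one value is
        replaced.\<close>
      then have gi: "(\<lambda>t. if t = t0 then weight t0 else ?g t) integrable_on {t0 - e..t0 + e}"
        by (rule integrable_spike_finite[where S = "{t0}", rotated 2]) auto
      have le: "weight t \<le> ?g t" if t: "t \<in> {t0 - e..t0 + e}" "t \<noteq> t0" for t
      proof (cases "t \<in> simple_set")
        case True
        have dt: "dist t t0 < e1" "dist t t0 < e2" using t e by (auto simp: dist_real_def)
        have z: "L t \<in> cball mu r" using e2(2)[OF dt(2)] by (simp add: dist_commute)
        define d where "d = cmod (L t - mu)"
        have "F (L t) - F mu = complex_of_real (2 * cos (pi * t) - 2 * cos (pi * t0))"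
          using True Fmu by (simp only: simple_set_def mem_Collect_eq mu_def two_cos_of_real of_real_diff)
        then have "\<bar>2 * cos (pi * t) - 2 * cos (pi * t0)\<bar> = cmod (F (L t) - F mu)"
          by (simp only: norm_of_real)
        then have "k * \<bar>t - t0\<bar> \<le> C * d ^ Suc m"
          using cos_lower[OF dt(1)] Fle[OF z] unfolding d_def by linarith
        then have "(k / C) * \<bar>t - t0\<bar> \<le> d ^ Suc m" using r by (simp add: field_simps)
        moreover have kC: "k / C > 0" "\<bar>t - t0\<bar> > 0" using k r t(2) by auto
        ultimately have pb: "1 / d ^ m \<le> (k / C) powr ?a * \<bar>t - t0\<bar> powr ?a"
          by (intro reciprocal_power_le_powr) (auto simp: d_def)
        have "d \<noteq> 0"
          using \<open>(k / C) * \<bar>t - t0\<bar> \<le> d ^ Suc m\<close> mult_pos_pos[OF kC] by auto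
        then have d0: "d > 0" by (simp add: d_def)
        have "weight t = 1 / cmod (deriv F (L t))" using True by (simp add: weight_def)
        also have "\<dots> \<le> 1 / (c * d ^ m)"
          using lo[OF z] r d0 True unfolding d_def[symmetric]
          by (intro divide_left_mono) (auto simp: simple_set_def intro!: mult_pos_pos)
        also have "\<dots> = 1 / c * (1 / d ^ m)" by simp
        also have "\<dots> \<le> 1 / c * ((k / C) powr ?a * \<bar>t - t0\<bar> powr ?a)"
          using pb r by (intro mult_left_mono) auto
        finally show ?thesis by (simp add: mult.assoc)
      qed (use r in \<open>simp add: weight_def\<close>)
      show ?thesis by (rule bounded_case[OF e(1) gi]) (use le in auto)
    qed
  qed
qed

lemma weight_integrable:
  assumes "\<And>t. t \<in> {a..b} \<Longrightarrow> sin (pi * t) \<noteq> 0"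
  shows "weight absolutely_integrable_on {a..b}"
  by (rule absolutely_integrable_on_locally) (rule weight_integrable_locally[OF assms])

end

section \<open>Oscillatory integrals\<close>

abbreviation osc :: "complex \<Rightarrow> real \<Rightarrow> complex" where
  "osc z s \<equiv> exp (\<i> * z * complex_of_real s)"

lemma norm_exp_strip:
  assumes "\<bar>Im z\<bar> \<le> b" "s \<in> {0..pi}"
  shows "cmod (osc z s) \<le> exp (b * pi)"
proof -
  have "- (Im z * s) \<le> \<bar>Im z\<bar> * s" using assms(2) by (metis abs_ge_minus_self abs_mult abs_of_nonneg atLeastAtMost_iff)
  also have "\<dots> \<le> b * pi" using assms by (intro mult_mono) auto
  finally show ?thesis by simp
qed

lemma integral_exp_bound:
  assumes "z \<noteq> 0" "\<bar>Im z\<bar> \<le> b" "c \<in> {0..pi}" "d \<in> {0..pi}" "c \<le> d"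
  shows "cmod (integral {c..d} (\<lambda>s. osc z s)) \<le> 2 * exp (b * pi) / cmod z"
proof -
  have "((\<lambda>s. osc z s) has_integral
      (osc z d / (\<i> * z) - osc z c / (\<i> * z))) {c..d}"
    using assms(1)
    by (intro fundamental_theorem_of_calculus assms(5))
      (auto intro!: derivative_eq_intros has_vector_derivative_real_field)
  then have "integral {c..d} (\<lambda>s. osc z s)
      = (osc z d - osc z c) / (\<i> * z)"
    by (simp add: integral_unique diff_divide_distrib)
  then have "cmod (integral {c..d} (\<lambda>s. osc z s))
      = cmod (osc z d - osc z c) / cmod z"
    by (simp add: norm_divide norm_mult)
  also have "\<dots> \<le> (exp (b * pi) + exp (b * pi)) / cmod z"
    using norm_exp_strip[OF assms(2,4)] norm_exp_strip[OF assms(2,3)]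
    by (intro divide_right_mono order_trans[OF norm_triangle_ineq4] add_mono) auto
  finally show ?thesis by simp
qed

text \<open>The second mean value theorem replaces integration by parts. It needs a real oscillating
  factor, so it is applied to the real and imaginary parts of \<open>osc\<close> through the
  functional \<open>T\<close>; each contributes 2 G K, whence the constant 8.\<close>

lemma mono_oscillatory_integral_bound:
  fixes g :: "real \<Rightarrow> real"
  assumes g: "mono_on {0..pi} g" and G: "\<And>s. s \<in> {0..pi} \<Longrightarrow> \<bar>g s\<bar> \<le> G"
    and z: "z \<noteq> 0" "\<bar>Im z\<bar> \<le> b" and x: "x \<in> {0..pi}"
  shows "cmod (integral {0..x} (\<lambda>s. complex_of_real (g s) * osc z s))
      \<le> 8 * G * exp (b * pi) / cmod z"
proof -
  let ?e = "\<lambda>s. osc z s"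
  define K where "K = 2 * exp (b * pi) / cmod z"
  have ie: "?e integrable_on {c..d}" for c d
    by (intro integrable_continuous_real continuous_intros)
  have *: "\<exists>I. ((\<lambda>s. g s * T (?e s)) has_integral I) {0..x} \<and> \<bar>I\<bar> \<le> 2 * G * K"
    if T: "bounded_linear T" "\<And>w. \<bar>T w\<bar> \<le> cmod w" for T :: "complex \<Rightarrow> real"
  proof -
    have iT: "(\<lambda>s. T (?e s)) integrable_on {c..d}" and eT: "integral {c..d} (\<lambda>s. T (?e s)) = T (integral {c..d} ?e)" for c d
      using integrable_linear[OF ie T(1)] integral_linear[OF ie T(1)] by (simp_all add: o_def)
    have "g r \<le> g s" if "0 \<le> r" "r \<le> s" "s \<le> x" for r s
      using that x by (intro mono_onD[OF g]) auto
    then obtain c where c: "c \<in> {0..x}"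
      "((\<lambda>s. g s * T (?e s)) has_integral
         (g 0 * integral {0..c} (\<lambda>s. T (?e s)) + g x * integral {c..x} (\<lambda>s. T (?e s)))) {0..x}"
      using second_mean_value_theorem_full[OF iT, of 0 x g] x by auto
    have "\<bar>integral {0..c} (\<lambda>s. T (?e s))\<bar> \<le> K" "\<bar>integral {c..x} (\<lambda>s. T (?e s))\<bar> \<le> K"
      unfolding eT K_def using c(1) x
      by (intro order_trans[OF T(2) integral_exp_bound[OF z]]; simp)+
    then have "\<bar>g 0 * integral {0..c} (\<lambda>s. T (?e s))\<bar> \<le> G * K" "\<bar>g x * integral {c..x} (\<lambda>s. T (?e s))\<bar> \<le> G * K"
      unfolding abs_mult using G[of 0] G[of x] x by (auto intro!: mult_mono)
    then show ?thesis using c(2) by (intro exI conjI) (assumption, linarith)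
  qed
  obtain I where I: "((\<lambda>s. g s * Re (?e s)) has_integral I) {0..x}" "\<bar>I\<bar> \<le> 2 * G * K"
    using *[OF bounded_linear_Re abs_Re_le_cmod] by blast
  obtain I' where I': "((\<lambda>s. g s * Im (?e s)) has_integral I') {0..x}" "\<bar>I'\<bar> \<le> 2 * G * K"
    using *[OF bounded_linear_Im abs_Im_le_cmod] by blast
  have "((\<lambda>s. complex_of_real (g s * Re (?e s)) + \<i> * complex_of_real (g s * Im (?e s)))
      has_integral (complex_of_real I + \<i> * complex_of_real I')) {0..x}"
    by (intro has_integral_add has_integral_mult_right has_integral_of_real I I')
  moreover have "complex_of_real (g s * Re (?e s)) + \<i> * complex_of_real (g s * Im (?e s)) = complex_of_real (g s) * ?e s" for s
    by (simp add: complex_eq_iff)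
  ultimately have "integral {0..x} (\<lambda>s. complex_of_real (g s) * ?e s) = complex_of_real I + \<i> * complex_of_real I'"
    by (simp add: integral_unique)
  also have "cmod \<dots> \<le> \<bar>I\<bar> + \<bar>I'\<bar>"
    using norm_triangle_ineq[of "complex_of_real I" "\<i> * complex_of_real I'"] by (simp add: norm_mult)
  also have "\<dots> \<le> 4 * G * K" using I(2) I'(2) by linarith
  finally show ?thesis by (simp add: K_def mult_ac)
qed

text \<open>Besides boundedness and integrability of the coefficients, this decay rate is what
  bounded variation supplies: the Riemann-Lebesgue lemma with the rate 1/\<bar>z\<bar>, uniform in a
  strip and in the upper limit.\<close>

lemma bv_oscillatory_integral_bound:
  assumes "bv_on f 0 pi"
  obtains D where "D \<ge> 0" "\<And>z x. z \<noteq> 0 \<Longrightarrow> \<bar>Im z\<bar> \<le> b \<Longrightarrow> x \<in> {0..pi} \<Longrightarrow>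
    cmod (integral {0..x} (\<lambda>s. f s * osc z s)) \<le> D / cmod z"
proof -
  obtain g1 g2 g3 g4 :: "real \<Rightarrow> real" where
    g: "mono_on {0..pi} g1" "mono_on {0..pi} g2" "mono_on {0..pi} g3" "mono_on {0..pi} g4"
    and f: "\<And>x. x \<in> {0..pi} \<Longrightarrow> f x = (of_real (g1 x) - of_real (g2 x)) + \<i> * (of_real (g3 x) - of_real (g4 x))"
    using bv_on_monotone_decomposition[OF assms] by metis
  define M where "M h = \<bar>h 0\<bar> + \<bar>h pi\<bar>" for h :: "real \<Rightarrow> real"
  have M: "\<bar>h s\<bar> \<le> M h" if "mono_on {0..pi} h" "s \<in> {0..pi}" for h s
    using mono_onD[OF that(1), of 0 s] mono_onD[OF that(1), of s pi] that(2) by (auto simp: M_def)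
  define D where "D = 8 * M g1 * exp (b * pi) + 8 * M g2 * exp (b * pi) + 8 * M g3 * exp (b * pi) + 8 * M g4 * exp (b * pi)"
  show ?thesis
  proof (rule that[of D])
    show "D \<ge> 0" by (simp add: D_def M_def)
    fix z x assume z: "z \<noteq> 0" "\<bar>Im z\<bar> \<le> b" and x: "x \<in> {0..pi}"
    let ?I = "\<lambda>h :: real \<Rightarrow> real. integral {0..x} (\<lambda>s. complex_of_real (h s) * osc z s)"
    have le: "cmod (?I h) \<le> 8 * M h * exp (b * pi) / cmod z" if "mono_on {0..pi} h" for h
      by (rule mono_oscillatory_integral_bound[OF that M[OF that] z x])
    have hi: "((\<lambda>s. complex_of_real (h s) * osc z s) has_integral ?I h) {0..x}"
      if h: "mono_on {0..pi} h" for h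
    proof (rule integrable_integral, rule integrable_on_mult_continuous[where K = "M h"])
      show "(\<lambda>s. complex_of_real (h s)) integrable_on {0..x}"
        using x integrable_linear[OF integrable_on_mono_on[OF h] bounded_linear_of_real[where 'a = complex]]
        by (auto simp: o_def intro: integrable_subinterval_real)
      show "cmod (complex_of_real (h s)) \<le> M h" if "s \<in> {0..x}" for s
        using M[OF h, of s] that x by simp
    qed (intro continuous_intros)
    have "((\<lambda>s. (complex_of_real (g1 s) * osc z s - complex_of_real (g2 s) * osc z s)
         + \<i> * (complex_of_real (g3 s) * osc z s - complex_of_real (g4 s) * osc z s))
       has_integral ((?I g1 - ?I g2) + \<i> * (?I g3 - ?I g4))) {0..x}"
      by (intro has_integral_add has_integral_diff has_integral_mult_right hi g)
    then have "((\<lambda>s. f s * osc z s) has_integral ((?I g1 - ?I g2) + \<i> * (?I g3 - ?I g4))) {0..x}"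
      by (rule has_integral_eq[rotated]) (use x in \<open>simp add: f algebra_simps\<close>)
    then have "cmod (integral {0..x} (\<lambda>s. f s * osc z s)) = cmod ((?I g1 - ?I g2) + \<i> * (?I g3 - ?I g4))"
      by (simp add: integral_unique)
    also have "\<dots> \<le> (cmod (?I g1) + cmod (?I g2)) + (cmod (?I g3) + cmod (?I g4))"
      using norm_triangle_ineq[of "?I g1 - ?I g2" "\<i> * (?I g3 - ?I g4)"]
        norm_triangle_ineq4[of "?I g1" "?I g2"] norm_triangle_ineq4[of "?I g3" "?I g4"] by (simp add: norm_mult)
    also have "\<dots> \<le> D / cmod z"
      using le[OF g(1)] le[OF g(2)] le[OF g(3)] le[OF g(4)] by (simp add: D_def add_divide_distrib)
    finally show "cmod (integral {0..x} (\<lambda>s. f s * osc z s)) \<le> D / cmod z" .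
  qed
qed

text \<open>Integrating a z2 by parts moves everything onto the primitive of \<open>a\<close>, which
  is at most \<open>e\<close>: the boundary term is at most e Z and the remaining integral of that
  primitive times b z1 at most T e K Z.\<close>

lemma coupled_system_bound:
  fixes z1 z2 a b :: "real \<Rightarrow> complex"
  assumes z1: "\<And>x. x \<in> {0..T} \<Longrightarrow> ((\<lambda>s. a s * z2 s) has_integral (z1 x - z1 0)) {0..x}"
    and z2: "\<And>x. x \<in> {0..T} \<Longrightarrow> ((\<lambda>s. b s * z1 s) has_integral (z2 x - z2 0)) {0..x}"
    and a: "a integrable_on {0..T}" "\<And>s. s \<in> {0..T} \<Longrightarrow> cmod (a s) \<le> K"
    and b: "\<And>s. s \<in> {0..T} \<Longrightarrow> cmod (b s) \<le> K"
    and A: "\<And>x. x \<in> {0..T} \<Longrightarrow> cmod (integral {0..x} a) \<le> e"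
    and Z: "\<And>s. s \<in> {0..T} \<Longrightarrow> cmod (z1 s) \<le> Z" "\<And>s. s \<in> {0..T} \<Longrightarrow> cmod (z2 s) \<le> Z"
    and x: "x \<in> {0..T}"
  shows "cmod (z1 x - z1 0) \<le> e * Z * (1 + T * K)"
proof -
  have T: "0 \<le> T" using x by simp
  have pos: "0 \<le> K" "0 \<le> e" "0 \<le> Z"
    using order_trans[OF norm_ge_zero a(2)[of 0]] order_trans[OF norm_ge_zero A[of 0]]
      order_trans[OF norm_ge_zero Z(1)[of 0]] T by auto
  define P where "P x = integral {0..x} a" for x
  have P: "(a has_integral (P x - P 0)) {0..x}" if "x \<in> {0..T}" for x
    using integrable_integral[OF integrable_subinterval_real[OF a(1), of 0 x]] that by (simp add: P_def)
  have bz: "cmod (b s * z1 s) \<le> K * Z" if "s \<in> {0..T}" for s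
    unfolding norm_mult using b Z(1) that pos by (intro mult_mono) auto
  have i: "((\<lambda>s. a s * z2 s + P s * (b s * z1 s)) has_integral (P x * z2 x - P 0 * z2 0)) {0..x}"
    by (rule product_rule_integral[OF P z2 a(2) bz x])
  have "((\<lambda>s. P s * (b s * z1 s)) has_integral (P x * z2 x - (z1 x - z1 0))) {0..x}"
    using has_integral_diff[OF i z1[OF x]] by (simp add: P_def)
  then have "cmod (P x * z2 x - (z1 x - z1 0)) \<le> (e * (K * Z)) * (x - 0)"
  proof (rule has_integral_interval_bound)
    fix s assume "s \<in> {0..x}"
    then have "s \<in> {0..T}" using x by auto
    then show "cmod (P s * (b s * z1 s)) \<le> e * (K * Z)"
      unfolding norm_mult[of "P s"] using A[of s] bz[of s] pos by (intro mult_mono) (auto simp: P_def)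
  qed (use x in auto)
  also have "\<dots> \<le> e * (K * Z) * T" using x pos by (intro mult_left_mono) auto
  finally have "cmod (P x * z2 x - (z1 x - z1 0)) \<le> e * (K * Z) * T" .
  moreover have "cmod (P x * z2 x) \<le> e * Z"
    unfolding norm_mult using A[OF x] Z(2)[OF x] pos by (intro mult_mono) (auto simp: P_def)
  moreover have "cmod (z1 x - z1 0) \<le> cmod (P x * z2 x) + cmod (P x * z2 x - (z1 x - z1 0))"
    by (metis norm_minus_commute norm_triangle_sub)
  ultimately show ?thesis by (simp add: algebra_simps)
qed

section \<open>Asymptotics in horizontal strips\<close>

context dirac
begin

text \<open>Variation of constants: y1 + \<i> y2 and y1 - \<i> y2 diagonalise J, and the exponential
  factors remove the free motion. With Q = 0 both \<open>zplus\<close> and \<open>zminus\<close> are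
  constant.\<close>

definition zplus :: "complex \<Rightarrow> (real \<Rightarrow> complex \<times> complex) \<Rightarrow> real \<Rightarrow> complex" where
  "zplus lam y s = osc (- lam) s * (fst (y s) + \<i> * snd (y s))"

definition zminus :: "complex \<Rightarrow> (real \<Rightarrow> complex \<times> complex) \<Rightarrow> real \<Rightarrow> complex" where
  "zminus lam y s = osc lam s * (fst (y s) - \<i> * snd (y s))"

text \<open>The terms in \<open>lam\<close> cancel, and Q sends each of the two eigendirections of J
  into the other. The coupling is therefore purely off-diagonal, with oscillating coefficients of
  frequency \<mp> 2 lam.\<close>

lemma z_integral:
  assumes y: "is_sol p q lam y0 y" and x: "x \<in> {0..pi}"
  shows "((\<lambda>s. (q s - \<i> * p s) * osc (- 2 * lam) s * zminus lam y s)
      has_integral (zplus lam y x - zplus lam y 0)) {0..x}" (is ?plus)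
    and "((\<lambda>s. (q s + \<i> * p s) * osc (2 * lam) s * zplus lam y s)
      has_integral (zminus lam y x - zminus lam y 0)) {0..x}" (is ?minus)
proof -
  obtain K where K: "\<And>s. s \<in> {0..pi} \<Longrightarrow> cmod (q s * fst (y s) - (lam + p s) * snd (y s)) \<le> K"
    "\<And>s. s \<in> {0..pi} \<Longrightarrow> cmod ((lam - p s) * fst (y s) - q s * snd (y s)) \<le> K"
    using is_sol_components_bounded[OF y] by metis
  define d1 where "d1 s = q s * fst (y s) - (lam + p s) * snd (y s)" for s
  define d2 where "d2 s = (lam - p s) * fst (y s) - q s * snd (y s)" for s
  have E: "((\<lambda>s. \<i> * mu * osc mu s) has_integral
      (osc mu x - exp (\<i> * mu * complex_of_real 0))) {0..x}" if "x \<in> {0..pi}" for mu x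
    using that by (intro fundamental_theorem_of_calculus)
      (auto intro!: derivative_eq_intros has_vector_derivative_real_field)
  have EK: "cmod (\<i> * mu * osc mu s) \<le> cmod mu * exp (\<bar>Im mu\<bar> * pi)" if "s \<in> {0..pi}" for mu s
    using norm_exp_strip[OF order_refl that, of mu] by (simp add: norm_mult mult_left_mono)
  have dd: "((\<lambda>s. d1 s + c * d2 s) has_integral (fst (y x) + c * snd (y x) - (fst (y 0) + c * snd (y 0)))) {0..x}"
    if "x \<in> {0..pi}" for c x
    using has_integral_add[OF is_sol_components(1)[OF y that] has_integral_mult_right[OF is_sol_components(2)[OF y that], of c]]
    by (simp add: d1_def d2_def algebra_simps)
  have ddK: "cmod (d1 s + c * d2 s) \<le> K + cmod c * K" if "s \<in> {0..pi}" for s c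
    using K[OF that] by (intro order_trans[OF norm_triangle_ineq add_mono])
      (auto simp: d1_def d2_def norm_mult mult_left_mono)
  have e2: "osc (- 2 * mu) s * osc mu s = osc (- mu) s" for mu s
    by (simp flip: exp_add add: algebra_simps)
  note i1 = product_rule_integral[OF E dd EK ddK x, of "- lam" \<i>]
  show ?plus
    unfolding zplus_def
  proof (rule has_integral_eq[OF _ i1])
    fix s
    have "(q s - \<i> * p s) * osc (- 2 * lam) s * zminus lam y s
        = (q s - \<i> * p s) * (osc (- 2 * lam) s * osc lam s) * (fst (y s) - \<i> * snd (y s))"
      by (simp only: zminus_def mult_ac)
    also have "\<dots> = (q s - \<i> * p s) * osc (- lam) s * (fst (y s) - \<i> * snd (y s))"
      unfolding e2 ..
    also have "\<dots> = \<i> * (- lam) * osc (- lam) s * (fst (y s) + \<i> * snd (y s))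
        + osc (- lam) s * (d1 s + \<i> * d2 s)"
      unfolding d1_def d2_def using i_squared by algebra
    finally show "\<i> * (- lam) * osc (- lam) s * (fst (y s) + \<i> * snd (y s))
        + osc (- lam) s * (d1 s + \<i> * d2 s)
      = (q s - \<i> * p s) * osc (- 2 * lam) s * zminus lam y s" ..
  qed
  note i2 = product_rule_integral[OF E dd EK ddK x, of lam "- \<i>"]
  have "((\<lambda>s. (q s + \<i> * p s) * osc (2 * lam) s * zplus lam y s) has_integral
    (osc lam x * (fst (y x) + - \<i> * snd (y x))
      - exp (\<i> * lam * complex_of_real 0) * (fst (y 0) + - \<i> * snd (y 0)))) {0..x}"
  proof (rule has_integral_eq[OF _ i2])
    fix s
    have "(q s + \<i> * p s) * osc (2 * lam) s * zplus lam y s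
        = (q s + \<i> * p s) * (osc (2 * lam) s * osc (- lam) s) * (fst (y s) + \<i> * snd (y s))"
      by (simp only: zplus_def mult_ac)
    also have "\<dots> = (q s + \<i> * p s) * osc lam s * (fst (y s) + \<i> * snd (y s))"
      using e2[of "- lam" s] by simp
    also have "\<dots> = \<i> * lam * osc lam s * (fst (y s) + - \<i> * snd (y s))
        + osc lam s * (d1 s + - \<i> * d2 s)"
      unfolding d1_def d2_def using i_squared by algebra
    finally show "\<i> * lam * osc lam s * (fst (y s) + - \<i> * snd (y s))
        + osc lam s * (d1 s + - \<i> * d2 s)
      = (q s + \<i> * p s) * osc (2 * lam) s * zplus lam y s" ..
  qed
  then show ?minus by (simp add: zminus_def)
qed

lemma strip_coefficient_bound:
  assumes "\<bar>Im lam\<bar> \<le> b" "s \<in> {0..pi}" "cmod (p s) \<le> C" "cmod (q s) \<le> C"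
  shows "cmod ((q s - \<i> * p s) * osc (- 2 * lam) s) \<le> 2 * C * exp (2 * b * pi)"
    and "cmod ((q s + \<i> * p s) * osc (2 * lam) s) \<le> 2 * C * exp (2 * b * pi)"
proof -
  have pq: "cmod (q s - \<i> * p s) \<le> 2 * C" "cmod (q s + \<i> * p s) \<le> 2 * C"
    using norm_triangle_ineq4[of "q s" "\<i> * p s"] norm_triangle_ineq[of "q s" "\<i> * p s"] assms(3,4)
    by (auto simp: norm_mult)
  have C: "0 \<le> 2 * C" using order_trans[OF norm_ge_zero assms(3)] by simp
  have e: "cmod (osc (- 2 * lam) s) \<le> exp (2 * b * pi)"
      "cmod (osc (2 * lam) s) \<le> exp (2 * b * pi)"
    using assms(1,2) by (intro norm_exp_strip; simp)+
  show "cmod ((q s - \<i> * p s) * osc (- 2 * lam) s) \<le> 2 * C * exp (2 * b * pi)"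
    "cmod ((q s + \<i> * p s) * osc (2 * lam) s) \<le> 2 * C * exp (2 * b * pi)"
    using mult_mono[OF pq(1) e(1) C] mult_mono[OF pq(2) e(2) C] unfolding norm_mult[of "q s - _"] norm_mult[of "q s + _"]
    by (simp_all only: norm_ge_zero)
qed

lemma z_initial:
  assumes "norm (y 0) \<le> 1"
  shows "cmod (zplus lam y 0) \<le> 2" "cmod (zminus lam y 0) \<le> 2"
proof -
  have "cmod (fst (y 0)) \<le> 1" "cmod (snd (y 0)) \<le> 1"
    using norm_fst_le[of "fst (y 0)" "snd (y 0)"] norm_snd_le[of "snd (y 0)" "fst (y 0)"] assms by simp_all
  then show "cmod (zplus lam y 0) \<le> 2" "cmod (zminus lam y 0) \<le> 2"
    using norm_triangle_ineq4[of "fst (y 0)" "\<i> * snd (y 0)"] norm_triangle_ineq[of "fst (y 0)" "\<i> * snd (y 0)"]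
    by (auto simp: zplus_def zminus_def norm_mult)
qed

text \<open>In these variables \<open>lam\<close> survives only inside exponentials, so the Gronwall
  constant depends on the width of the strip and not on Re lam.\<close>

lemma z_bounded_strip:
  obtains Z where "Z \<ge> 0" "\<And>lam y0 y x. \<bar>Im lam\<bar> \<le> b \<Longrightarrow> is_sol p q lam y0 y \<Longrightarrow> norm y0 \<le> 1 \<Longrightarrow> x \<in> {0..pi}
    \<Longrightarrow> cmod (zplus lam y x) \<le> Z \<and> cmod (zminus lam y x) \<le> Z"
proof -
  obtain C where C: "C > 0" "\<And>s. s \<in> {0..pi} \<Longrightarrow> cmod (p s) \<le> C" "\<And>s. s \<in> {0..pi} \<Longrightarrow> cmod (q s) \<le> C"
    using coefficients_bounded by metis
  define K where "K = 2 * C * exp (2 * b * pi)"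
  have K0: "K \<ge> 0" using C by (simp add: K_def)
  define Z where "Z = 4 * exp (2 * K * pi)"
  show ?thesis
  proof (rule that[of Z])
    show "Z \<ge> 0" by (simp add: Z_def)
    fix lam y0 y x
    assume lam: "\<bar>Im lam\<bar> \<le> b" and y: "is_sol p q lam y0 y" and y0: "norm y0 \<le> 1" and x: "x \<in> {0..pi}"
    define w where "w s = (zplus lam y s, zminus lam y s)" for s
    define W where "W s = ((q s - \<i> * p s) * osc (- 2 * lam) s * zminus lam y s,
        (q s + \<i> * p s) * osc (2 * lam) s * zplus lam y s)" for s
    have comp: "cmod (zplus lam y s) \<le> norm (w s)" "cmod (zminus lam y s) \<le> norm (w s)" for s
      unfolding w_def by (rule norm_fst_le, rule norm_snd_le)
    have "norm (w x) \<le> (norm (w 0) + 0 * pi) * exp (2 * K * x)"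
    proof (rule gronwall_integral_equation[OF _ _ _ x])
      show "(W has_integral (w x - w 0)) {0..x}" if "x \<in> {0..pi}" for x
        using has_integral_pair[OF z_integral[OF y that]] by (simp add: W_def[abs_def] w_def)
      show "norm (W s) \<le> 2 * K * norm (w s) + 0" if s: "s \<in> {0..pi}" for s
      proof -
        have "norm (W s) \<le> cmod (fst (W s)) + cmod (snd (W s))"
          using norm_Pair_le[of "fst (W s)" "snd (W s)"] by simp
        moreover have "cmod (fst (W s)) \<le> K * norm (w s)"
          unfolding W_def fst_conv norm_mult[of _ "zminus lam y s"] K_def
          using strip_coefficient_bound(1)[OF lam s C(2)[OF s] C(3)[OF s]] comp(2)[of s] C(1)
          by (intro mult_mono) auto
        moreover have "cmod (snd (W s)) \<le> K * norm (w s)"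
          unfolding W_def snd_conv norm_mult[of _ "zplus lam y s"] K_def
          using strip_coefficient_bound(2)[OF lam s C(2)[OF s] C(3)[OF s]] comp(1)[of s] C(1)
          by (intro mult_mono) auto
        ultimately show ?thesis by simp
      qed
    qed (use K0 in auto)
    also have "\<dots> \<le> 4 * exp (2 * K * pi)"
    proof -
      have "norm (w 0) \<le> 4"
        using norm_Pair_le[of "zplus lam y 0" "zminus lam y 0"] z_initial[of y lam] y0 is_sol_0[OF y] by (simp add: w_def)
      moreover have "exp (2 * K * x) \<le> exp (2 * K * pi)" using x K0 by (auto intro!: mult_left_mono)
      ultimately show ?thesis by (intro mult_mono) auto
    qed
    finally show "cmod (zplus lam y x) \<le> Z \<and> cmod (zminus lam y x) \<le> Z"
      using comp[of x] by (simp add: Z_def)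
  qed
qed

text \<open>Each equation is driven by a coefficient with primitive O(1/\<bar>lam\<bar>), so
  \<open>coupled_system_bound\<close> applies twice, with the roles of the two components
  exchanged.\<close>

lemma z_asymptotics:
  obtains D where "D \<ge> 0" "\<And>lam y0 y x. \<bar>Im lam\<bar> \<le> b \<Longrightarrow> lam \<noteq> 0 \<Longrightarrow> is_sol p q lam y0 y \<Longrightarrow> norm y0 \<le> 1
    \<Longrightarrow> x \<in> {0..pi} \<Longrightarrow> cmod (zplus lam y x - zplus lam y 0) \<le> D / cmod lam
      \<and> cmod (zminus lam y x - zminus lam y 0) \<le> D / cmod lam"
proof -
  obtain C where C: "C > 0" "\<And>s. s \<in> {0..pi} \<Longrightarrow> cmod (p s) \<le> C" "\<And>s. s \<in> {0..pi} \<Longrightarrow> cmod (q s) \<le> C"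
    using coefficients_bounded by metis
  obtain Z where Z: "Z \<ge> 0" "\<And>lam y0 y x. \<bar>Im lam\<bar> \<le> b \<Longrightarrow> is_sol p q lam y0 y \<Longrightarrow> norm y0 \<le> 1 \<Longrightarrow> x \<in> {0..pi}
    \<Longrightarrow> cmod (zplus lam y x) \<le> Z \<and> cmod (zminus lam y x) \<le> Z"
    using z_bounded_strip[of b] by metis
  \<comment> \<open>The frequency is doubled, hence so is the width of the strip.\<close>
  obtain Dp where Dp: "Dp \<ge> 0" "\<And>z x. z \<noteq> 0 \<Longrightarrow> \<bar>Im z\<bar> \<le> 2 * b \<Longrightarrow> x \<in> {0..pi} \<Longrightarrow>
    cmod (integral {0..x} (\<lambda>s. p s * osc z s)) \<le> Dp / cmod z"
    using bv_oscillatory_integral_bound[OF bv_p, of "2 * b"] by metis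
  obtain Dq where Dq: "Dq \<ge> 0" "\<And>z x. z \<noteq> 0 \<Longrightarrow> \<bar>Im z\<bar> \<le> 2 * b \<Longrightarrow> x \<in> {0..pi} \<Longrightarrow>
    cmod (integral {0..x} (\<lambda>s. q s * osc z s)) \<le> Dq / cmod z"
    using bv_oscillatory_integral_bound[OF bv_q, of "2 * b"] by metis
  define K where "K = 2 * C * exp (2 * b * pi)"
  define D where "D = (Dp + Dq) * Z * (1 + pi * K)"
  show ?thesis
  proof (rule that[of D])
    show "D \<ge> 0" using Dp(1) Dq(1) Z(1) C(1) by (simp add: D_def K_def)
    fix lam y0 y x
    assume lam: "\<bar>Im lam\<bar> \<le> b" "lam \<noteq> 0" and y: "is_sol p q lam y0 y" and y0: "norm y0 \<le> 1" and x: "x \<in> {0..pi}"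
    have osc: "(\<lambda>s. (q s + c * p s) * osc z s) integrable_on {0..pi} \<and>
       (\<forall>x\<in>{0..pi}. cmod (integral {0..x} (\<lambda>s. (q s + c * p s) * osc z s)) \<le> (Dp + Dq) / cmod lam)"
      if z: "z \<noteq> 0" "\<bar>Im z\<bar> \<le> 2 * b" "cmod z = 2 * cmod lam" and c: "cmod c = 1" for z c
    proof -
      have ip: "(\<lambda>s. p s * osc z s) integrable_on {0..pi}"
        and iq: "(\<lambda>s. q s * osc z s) integrable_on {0..pi}"
        by (intro integrable_on_mult_continuous[of _ _ _ C] bv_on_integrable bv_p bv_q C(2,3) continuous_intros; simp)+
      have eq: "(q s + c * p s) * osc z s
          = q s * osc z s + c * (p s * osc z s)" for s
        by (simp add: algebra_simps)
      have "cmod (integral {0..x} (\<lambda>s. (q s + c * p s) * osc z s)) \<le> (Dp + Dq) / cmod lam"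
        if x: "x \<in> {0..pi}" for x
      proof -
        have "integral {0..x} (\<lambda>s. (q s + c * p s) * osc z s)
          = integral {0..x} (\<lambda>s. q s * osc z s) + c * integral {0..x} (\<lambda>s. p s * osc z s)"
          unfolding eq integral_mult_right[symmetric]
          by (intro integral_add integrable_on_mult_right integrable_subinterval_real[OF ip] integrable_subinterval_real[OF iq])
            (use x in auto)
        also have "cmod \<dots> \<le> Dq / cmod z + Dp / cmod z"
          using Dp(2)[OF z(1,2) x] Dq(2)[OF z(1,2) x]
          by (intro order_trans[OF norm_triangle_ineq add_mono]) (auto simp: norm_mult c)
        also have "\<dots> \<le> (Dp + Dq) / cmod lam"
          using Dp(1) Dq(1) lam(2) by (simp add: z(3) field_simps)
        finally show ?thesis .
      qed
      then show ?thesis unfolding eq using ip iq by (auto intro!: integrable_add integrable_on_mult_right)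
    qed
    have Zl: "cmod (zplus lam y s) \<le> Z" "cmod (zminus lam y s) \<le> Z" if "s \<in> {0..pi}" for s
      using Z(2)[OF lam(1) y y0 that] by auto
    have cb: "cmod ((q s - \<i> * p s) * osc (- 2 * lam) s) \<le> K"
       "cmod ((q s + \<i> * p s) * osc (2 * lam) s) \<le> K" if s: "s \<in> {0..pi}" for s
      using strip_coefficient_bound[OF lam(1) s C(2)[OF s] C(3)[OF s]] by (simp_all add: K_def)
    have o1: "(\<lambda>s. (q s - \<i> * p s) * osc (- 2 * lam) s) integrable_on {0..pi}"
        "\<And>x. x \<in> {0..pi} \<Longrightarrow> cmod (integral {0..x} (\<lambda>s. (q s - \<i> * p s) * osc (- 2 * lam) s)) \<le> (Dp + Dq) / cmod lam"
      using osc[of "- 2 * lam" "- \<i>"] lam by (auto simp: norm_mult)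
    have o2: "(\<lambda>s. (q s + \<i> * p s) * osc (2 * lam) s) integrable_on {0..pi}"
        "\<And>x. x \<in> {0..pi} \<Longrightarrow> cmod (integral {0..x} (\<lambda>s. (q s + \<i> * p s) * osc (2 * lam) s)) \<le> (Dp + Dq) / cmod lam"
      using osc[of "2 * lam" "\<i>"] lam by (auto simp: norm_mult)
    have "cmod (zplus lam y x - zplus lam y 0) \<le> (Dp + Dq) / cmod lam * Z * (1 + pi * K)"
      by (rule coupled_system_bound[OF z_integral(1)[OF y] z_integral(2)[OF y] o1(1) cb(1) cb(2) o1(2) Zl(1) Zl(2) x])
    moreover have "cmod (zminus lam y x - zminus lam y 0) \<le> (Dp + Dq) / cmod lam * Z * (1 + pi * K)"
      by (rule coupled_system_bound[OF z_integral(2)[OF y] z_integral(1)[OF y] o2(1) cb(2) cb(1) o2(2) Zl(2) Zl(1) x])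
    ultimately show "cmod (zplus lam y x - zplus lam y 0) \<le> D / cmod lam
      \<and> cmod (zminus lam y x - zminus lam y 0) \<le> D / cmod lam" by (simp add: D_def)
  qed
qed

lemma recover_from_z:
  "fst (y s) = (osc lam s * zplus lam y s + osc (- lam) s * zminus lam y s) / 2"
  "snd (y s) = (osc lam s * zplus lam y s - osc (- lam) s * zminus lam y s) / (2 * \<i>)"
proof -
  have 1: "osc lam s * osc (- lam) s = 1"
    by (simp flip: exp_add)
  have "osc lam s * zplus lam y s = fst (y s) + \<i> * snd (y s)"
    "osc (- lam) s * zminus lam y s = fst (y s) - \<i> * snd (y s)"
    unfolding zplus_def zminus_def using 1 by algebra+
  then show "fst (y s) = (osc lam s * zplus lam y s + osc (- lam) s * zminus lam y s) / 2"
  "snd (y s) = (osc lam s * zplus lam y s - osc (- lam) s * zminus lam y s) / (2 * \<i>)"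
    by simp_all
qed

lemma sol_bounded_strip:
  obtains E where "E \<ge> 0" "\<And>lam x. \<bar>Im lam\<bar> \<le> b \<Longrightarrow> x \<in> {0..pi} \<Longrightarrow> norm (csol p q lam x) \<le> E"
    "\<And>lam x. \<bar>Im lam\<bar> \<le> b \<Longrightarrow> x \<in> {0..pi} \<Longrightarrow> norm (ssol p q lam x) \<le> E"
proof -
  obtain Z where Z: "Z \<ge> 0" "\<And>lam y0 y x. \<bar>Im lam\<bar> \<le> b \<Longrightarrow> is_sol p q lam y0 y \<Longrightarrow> norm y0 \<le> 1 \<Longrightarrow> x \<in> {0..pi}
    \<Longrightarrow> cmod (zplus lam y x) \<le> Z \<and> cmod (zminus lam y x) \<le> Z"
    using z_bounded_strip[of b] by metis
  have "norm (y x) \<le> 2 * (exp (b * pi) * Z)"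
    if lam: "\<bar>Im lam\<bar> \<le> b" and y: "is_sol p q lam y0 y" "norm y0 \<le> 1" and x: "x \<in> {0..pi}" for lam y0 y x
  proof -
    let ?A = "osc lam x * zplus lam y x"
    let ?B = "osc (- lam) x * zminus lam y x"
    have e: "cmod (osc lam x) \<le> exp (b * pi)"
      "cmod (osc (- lam) x) \<le> exp (b * pi)"
      using lam x by (intro norm_exp_strip; simp)+
    have "cmod ?A \<le> exp (b * pi) * Z" "cmod ?B \<le> exp (b * pi) * Z"
      unfolding norm_mult[of "exp _"] using Z(2)[OF lam y x]
      by (intro mult_mono e; simp)+
    then have "cmod (?A + ?B) \<le> 2 * (exp (b * pi) * Z)" "cmod (?A - ?B) \<le> 2 * (exp (b * pi) * Z)"
      using norm_triangle_ineq[of ?A ?B] norm_triangle_ineq4[of ?A ?B] by linarith+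
    then have "cmod (fst (y x)) \<le> exp (b * pi) * Z" "cmod (snd (y x)) \<le> exp (b * pi) * Z"
      unfolding recover_from_z[of y x lam] norm_divide by (simp_all add: norm_mult)
    then show ?thesis using norm_Pair_le[of "fst (y x)" "snd (y x)"] by simp
  qed
  from this[OF _ is_sol_csol] this[OF _ is_sol_ssol] show ?thesis
    using Z(1) by (intro that[of "2 * (exp (b * pi) * Z)"]) (auto simp: norm_prod_def)
qed

lemma hillF_asymptotics:
  obtains D where "D \<ge> 0" "\<And>lam. \<bar>Im lam\<bar> \<le> b \<Longrightarrow> lam \<noteq> 0 \<Longrightarrow>
    cmod (hillF p q lam - 2 * cos (of_real pi * lam)) \<le> D / cmod lam"
proof -
  obtain D where D: "D \<ge> 0" "\<And>lam y0 y x. \<bar>Im lam\<bar> \<le> b \<Longrightarrow> lam \<noteq> 0 \<Longrightarrow> is_sol p q lam y0 y \<Longrightarrow> norm y0 \<le> 1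
    \<Longrightarrow> x \<in> {0..pi} \<Longrightarrow> cmod (zplus lam y x - zplus lam y 0) \<le> D / cmod lam
      \<and> cmod (zminus lam y x - zminus lam y 0) \<le> D / cmod lam"
    using z_asymptotics[of b] by metis
  show ?thesis
  proof (rule that[of "2 * (exp (b * pi) * D)"])
    show "0 \<le> 2 * (exp (b * pi) * D)" using D(1) by simp
    fix lam assume lam: "\<bar>Im lam\<bar> \<le> b" "lam \<noteq> 0"
    let ?e = "osc lam pi" and ?f = "osc (- lam) pi"
    let ?c = "csol p q lam" and ?s = "ssol p q lam"
    have pi: "pi \<in> {0..pi}" by simp
    have ef: "cmod ?e \<le> exp (b * pi)" "cmod ?f \<le> exp (b * pi)"
      using lam(1) by (intro norm_exp_strip; simp)+
    \<comment> \<open>These are the limiting values at \<pi> as well. Inserted into F they leave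
      exp(\<i>\<pi>lam) + exp(-\<i>\<pi>lam), that is 2 cos \<pi>lam.\<close>
    have cs0: "zplus lam ?c 0 = 1" "zminus lam ?c 0 = 1" "zplus lam ?s 0 = \<i>" "zminus lam ?s 0 = - \<i>"
      by (simp_all add: zplus_def zminus_def is_sol_0[OF is_sol_csol] is_sol_0[OF is_sol_ssol])
    have d: "cmod (zplus lam ?c pi - 1) \<le> D / cmod lam" "cmod (zminus lam ?c pi - 1) \<le> D / cmod lam"
      "cmod (zplus lam ?s pi - \<i>) \<le> D / cmod lam" "cmod (zminus lam ?s pi - - \<i>) \<le> D / cmod lam"
      using D(2)[OF lam is_sol_csol _ pi] D(2)[OF lam is_sol_ssol _ pi] unfolding cs0 by (auto simp: norm_prod_def)
    have m: "cmod (w * v) \<le> exp (b * pi) * (D / cmod lam)" if "cmod w \<le> exp (b * pi)" "cmod v \<le> D / cmod lam" for v w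
      unfolding norm_mult using that by (intro mult_mono) auto
    have cs: "2 * cos (of_real pi * lam) = ?e + ?f" by (simp add: cos_exp_eq mult_ac)
    have "2 * (hillF p q lam - 2 * cos (of_real pi * lam))
       = (?e * (zplus lam ?c pi - 1) + ?f * (zminus lam ?c pi - 1))
         + (- \<i> * (?e * (zplus lam ?s pi - \<i>)) + \<i> * (?f * (zminus lam ?s pi - - \<i>)))"
      unfolding hillF_def recover_from_z(1)[of ?c pi lam] recover_from_z(2)[of ?s pi lam] cs
      by (simp add: field_simps)
    also have "cmod \<dots> \<le> (exp (b * pi) * (D / cmod lam) + exp (b * pi) * (D / cmod lam))
         + (exp (b * pi) * (D / cmod lam) + exp (b * pi) * (D / cmod lam))"
      using m[OF ef(1) d(1)] m[OF ef(2) d(2)] m[OF ef(1) d(3)] m[OF ef(2) d(4)]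
      by (intro order_trans[OF norm_triangle_ineq add_mono] order_trans[OF norm_triangle_ineq])
        (auto simp: norm_mult intro: order_trans[OF norm_triangle_ineq add_mono])
    finally have "2 * cmod (hillF p q lam - 2 * cos (of_real pi * lam)) \<le> 4 * (exp (b * pi) * (D / cmod lam))"
      by (simp only: norm_mult norm_numeral) (simp add: mult_ac)
    then show "cmod (hillF p q lam - 2 * cos (of_real pi * lam)) \<le> 2 * (exp (b * pi) * D) / cmod lam"
      by simp
  qed
qed

end

section \<open>Large eigenvalues\<close>

lemma square_perturbation:
  fixes w w0 e :: complex
  assumes "w = w0 + e" "cmod w0 \<le> M" "cmod e \<le> d" "d \<le> M"
  shows "cmod (w\<^sup>2 - w0\<^sup>2) \<le> 3 * M * d"
proof -
  have "w\<^sup>2 - w0\<^sup>2 = e * (2 * w0 + e)" by (simp add: assms(1) power2_eq_square algebra_simps)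
  moreover have "cmod (2 * w0 + e) \<le> 3 * M"
    using norm_triangle_ineq[of "2 * w0" e] assms(2-4) by (simp add: norm_mult)
  moreover have "0 \<le> d" using order_trans[OF norm_ge_zero assms(3)] .
  ultimately have "cmod (w\<^sup>2 - w0\<^sup>2) \<le> d * (3 * M)"
    using assms(3) by (simp only: norm_mult) (intro mult_mono, auto)
  then show ?thesis by (simp add: mult_ac)
qed

context dirac
begin

lemma deriv_hillF_asymptotics:
  assumes "b \<ge> 0"
  obtains D where "D \<ge> 0" "\<And>lam. \<bar>Im lam\<bar> \<le> b \<Longrightarrow> cmod lam \<ge> 2 \<Longrightarrow>
    cmod (hillF p q lam - 2 * cos (of_real pi * lam)) \<le> D / cmod lam \<and>
    cmod (deriv (hillF p q) lam + 2 * of_real pi * sin (of_real pi * lam)) \<le> D / cmod lam"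
proof -
  \<comment> \<open>The strip is wider by 1 to contain the unit circle for Cauchy's estimate;
    \<open>cmod lam \<ge> 2\<close> keeps that circle at distance at least half of
    \<open>cmod lam\<close> from 0.\<close>
  obtain D where D: "D \<ge> 0" "\<And>lam. \<bar>Im lam\<bar> \<le> b + 1 \<Longrightarrow> lam \<noteq> 0 \<Longrightarrow>
    cmod (hillF p q lam - 2 * cos (of_real pi * lam)) \<le> D / cmod lam"
    using hillF_asymptotics[of "b + 1"] by metis
  show ?thesis
  proof (rule that[of "2 * D"])
    fix lam assume lam: "\<bar>Im lam\<bar> \<le> b" "cmod lam \<ge> 2"
    let ?f = "\<lambda>z. hillF p q z - 2 * cos (of_real pi * z)"
    have hol: "?f holomorphic_on A" for A by (intro holomorphic_intros hillF_holomorphic)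
    have "cmod ((deriv ^^ 1) ?f lam) \<le> fact 1 * (2 * D / cmod lam) / 1 ^ 1"
    proof (rule Cauchy_inequality[OF hol holomorphic_on_imp_continuous_on[OF hol]])
      fix x assume x: "cmod (lam - x) = 1"
      have "\<bar>Im x\<bar> \<le> b + 1" using abs_Im_le_cmod[of "lam - x"] x lam by simp
      moreover have cx: "cmod x \<ge> cmod lam / 2" using norm_triangle_sub[of lam x] x lam by simp
      moreover have "x \<noteq> 0" using cx lam by auto
      ultimately have "cmod (?f x) \<le> D / cmod x" using D(2) by simp
      also have "\<dots> \<le> D / (cmod lam / 2)"
      proof (rule divide_left_mono[OF cx D(1)])
        have "cmod lam > 0" using lam(2) by linarith
        then show "0 < cmod x * (cmod lam / 2)" using cx by (intro mult_pos_pos) linarith+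
      qed
      finally show "cmod (?f x) \<le> 2 * D / cmod lam" by (simp add: mult.commute)
    qed simp
    moreover have "deriv ?f lam = deriv (hillF p q) lam + 2 * of_real pi * sin (of_real pi * lam)"
      unfolding deriv_hillF
      by (rule DERIV_imp_deriv) (auto intro!: derivative_eq_intros hillF_has_field_derivative)
    moreover have "cmod (?f lam) \<le> D / cmod lam" using D(2)[of lam] lam by (cases "lam = 0") auto
    moreover have "D / cmod lam \<le> 2 * D / cmod lam" using D(1) by (intro divide_right_mono) auto
    ultimately show "cmod (?f lam) \<le> 2 * D / cmod lam \<and>
      cmod (deriv (hillF p q) lam + 2 * of_real pi * sin (of_real pi * lam)) \<le> 2 * D / cmod lam"
      by simp
  qed (use D in simp)
qed

text \<open>The asymptotics involve \<open>lam\<close>, the hypothesis \<open>t\<close>. Knowing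
  that cos \<pi>lam is close to cos \<pi>t fixes the sine only up to sign, so squares are
  compared.\<close>

lemma deriv_hillF_lower_bound:
  assumes "b \<ge> 0" "\<sigma> > 0"
  obtains R where "\<And>lam t. cmod lam \<ge> R \<Longrightarrow> \<bar>Im lam\<bar> \<le> b \<Longrightarrow>
    hillF p q lam = 2 * cos (of_real pi * t) \<Longrightarrow> cmod (sin (of_real pi * t)) \<ge> \<sigma> \<Longrightarrow>
    cmod (deriv (hillF p q) lam) \<ge> \<sigma>"
proof -
  obtain D where D: "D \<ge> 0" "\<And>lam. \<bar>Im lam\<bar> \<le> b \<Longrightarrow> cmod lam \<ge> 2 \<Longrightarrow>
    cmod (hillF p q lam - 2 * cos (of_real pi * lam)) \<le> D / cmod lam \<and>
    cmod (deriv (hillF p q) lam + 2 * of_real pi * sin (of_real pi * lam)) \<le> D / cmod lam"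
    using deriv_hillF_asymptotics[OF assms(1)] by metis
  define M where "M = max D (2 * pi * exp (b * pi))"
  have M: "M > 0" "D \<le> M" "2 * pi * exp (b * pi) \<le> M" by (auto simp: M_def less_max_iff_disj)
  \<comment> \<open>Chosen so that the error (\<pi>^2 + 1) 3 M D / \<bar>lam\<bar> in the comparison
    of squares is at most \<sigma>^2.\<close>
  define R where "R = max 2 ((pi\<^sup>2 + 1) * (3 * M * D) / \<sigma>\<^sup>2)"
  show ?thesis
  proof (rule that[of R])
    fix lam t assume lam: "cmod lam \<ge> R" "\<bar>Im lam\<bar> \<le> b"
      and t: "hillF p q lam = 2 * cos (of_real pi * t)" and sg: "cmod (sin (of_real pi * t)) \<ge> \<sigma>"
    have l2: "cmod lam \<ge> 2" using lam(1) by (simp add: R_def)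
    define d where "d = D / cmod lam"
    have "M * 1 \<le> M * cmod lam" using M(1) l2 by (intro mult_left_mono) auto
    then have "D \<le> M * cmod lam" using M(2) by linarith
    moreover have "cmod lam > 0" using l2 by linarith
    ultimately have dM: "d \<le> M" by (simp add: d_def divide_le_eq)
    let ?C = "2 * cos (of_real pi * lam)" and ?S = "- (2 * of_real pi * sin (of_real pi * lam))"
    have "cmod (osc lam pi) \<le> exp (b * pi)"
      "cmod (osc (- lam) pi) \<le> exp (b * pi)"
      using lam(2) by (intro norm_exp_strip; simp)+
    then have e: "cmod (exp (\<i> * (of_real pi * lam))) \<le> exp (b * pi)"
      "cmod (exp (- (\<i> * (of_real pi * lam)))) \<le> exp (b * pi)"
      by (simp_all only: mult_ac mult_minus_left mult_minus_right)
    have "cmod ?C \<le> exp (b * pi) + exp (b * pi)"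
    proof -
      have "?C = exp (\<i> * (of_real pi * lam)) + exp (- (\<i> * (of_real pi * lam)))"
        by (simp add: cos_exp_eq)
      then show ?thesis using order_trans[OF norm_triangle_ineq add_mono[OF e]] by simp
    qed
    also have "\<dots> \<le> 2 * pi * exp (b * pi)"
    proof -
      have "2 * exp (b * pi) \<le> (2 * pi) * exp (b * pi)" using pi_gt3 by (intro mult_right_mono) auto
      then show ?thesis by simp
    qed
    finally have C: "cmod ?C \<le> M" using M(3) by linarith
    have "cmod (sin (of_real pi * lam)) \<le> exp (b * pi)"
      unfolding sin_exp_eq using order_trans[OF norm_triangle_ineq4 add_mono[OF e]] by (simp add: norm_divide norm_mult)
    then have "cmod ?S \<le> 2 * pi * exp (b * pi)" by (simp add: norm_mult)
    then have S: "cmod ?S \<le> M" using M(3) by linarith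
    let ?F = "hillF p q lam" and ?F' = "deriv (hillF p q) lam"
    have 1: "cmod (?F\<^sup>2 - ?C\<^sup>2) \<le> 3 * M * d"
      using D(2)[OF lam(2) l2] C dM by (intro square_perturbation[of _ _ "?F - ?C"]) (auto simp: d_def)
    have 2: "cmod (?F'\<^sup>2 - ?S\<^sup>2) \<le> 3 * M * d"
      using D(2)[OF lam(2) l2] S dM by (intro square_perturbation[of _ _ "?F' - ?S"]) (auto simp: d_def)
    have cs: "(cos (of_real pi * lam))\<^sup>2 + (sin (of_real pi * lam))\<^sup>2 = 1"
      "(cos (of_real pi * t))\<^sup>2 + (sin (of_real pi * t))\<^sup>2 = 1" by simp_all
    \<comment> \<open>Both S^2 + \<pi>^2 C^2 and \<pi>^2 F^2 + 4 \<pi>^2 sin^2 \<pi>t equal 4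
      \<pi>^2, where C and S abbreviate the main terms of F and F'.\<close>
    have "?F'\<^sup>2 - 4 * (complex_of_real pi)\<^sup>2 * (sin (of_real pi * t))\<^sup>2
       = (?F'\<^sup>2 - ?S\<^sup>2) + (complex_of_real pi)\<^sup>2 * (?F\<^sup>2 - ?C\<^sup>2)"
      unfolding t using cs by algebra
    also have "cmod \<dots> \<le> 3 * M * d + pi\<^sup>2 * (3 * M * d)"
      using 1 2 by (intro order_trans[OF norm_triangle_ineq add_mono]) (auto simp: norm_mult norm_power intro!: mult_left_mono)
    also have "\<dots> = (pi\<^sup>2 + 1) * (3 * M * D) / cmod lam"
      by (simp add: d_def add_divide_distrib distrib_left mult_ac)
    also have "\<dots> \<le> \<sigma>\<^sup>2"
    proof -
      have "(pi\<^sup>2 + 1) * (3 * M * D) / \<sigma>\<^sup>2 \<le> cmod lam" using lam(1) by (simp add: R_def)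
      moreover have "cmod lam > 0" using l2 by linarith
      ultimately show ?thesis using assms(2) by (simp add: field_simps)
    qed
    finally have "cmod (?F'\<^sup>2 - 4 * (complex_of_real pi)\<^sup>2 * (sin (of_real pi * t))\<^sup>2) \<le> \<sigma>\<^sup>2" .
    moreover have "4 * \<sigma>\<^sup>2 \<le> cmod (4 * (complex_of_real pi)\<^sup>2 * (sin (of_real pi * t))\<^sup>2)"
    proof -
      have "1 * \<sigma>\<^sup>2 \<le> pi\<^sup>2 * (cmod (sin (of_real pi * t)))\<^sup>2"
        using sg assms(2) pi_gt3 by (intro mult_mono power_mono) (auto simp: one_le_power)
      then show ?thesis by (simp add: norm_mult norm_power)
    qed
    ultimately have "3 * \<sigma>\<^sup>2 \<le> cmod (?F'\<^sup>2)"
      using norm_triangle_ineq2[of "4 * (complex_of_real pi)\<^sup>2 * (sin (of_real pi * t))\<^sup>2" "?F'\<^sup>2"]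
      by (simp only: norm_minus_commute)
    then have "\<sigma>\<^sup>2 \<le> (cmod ?F')\<^sup>2" using zero_le_power2[of \<sigma>] unfolding norm_power by linarith
    then show "\<sigma> \<le> cmod ?F'" by (rule power2_le_imp_le) simp
  qed
qed

text \<open>A numerical range argument. The sesquilinear Wronskian \<theta> of y with its conjugate
  has derivative 2\<i> (Im lam) \<bar>y\<bar>^2 plus a term of size at most 4 C \<bar>y\<bar>^2.
  After weighting against the multiplier, its integral over the period is 0, which is impossible if
  the first term dominates.\<close>

lemma eigenvalue_strip:
  assumes C: "C > 0" "\<And>s. s \<in> {0..pi} \<Longrightarrow> cmod (p s) \<le> C" "\<And>s. s \<in> {0..pi} \<Longrightarrow> cmod (q s) \<le> C"
    and v: "eigvec lam (exp (\<i> * of_real pi * t)) v"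
  shows "\<bar>Im lam\<bar> \<le> \<bar>Im t\<bar> + 2 * C"
proof (rule ccontr)
  assume neg: "\<not> \<bar>Im lam\<bar> \<le> \<bar>Im t\<bar> + 2 * C"
  define y where "y = comb lam v"
  have y: "is_sol p q lam v y" unfolding y_def by (rule is_sol_comb)
  obtain K where K: "\<And>s. s \<in> {0..pi} \<Longrightarrow> cmod (q s * fst (y s) - (lam + p s) * snd (y s)) \<le> K"
    "\<And>s. s \<in> {0..pi} \<Longrightarrow> cmod ((lam - p s) * fst (y s) - q s * snd (y s)) \<le> K"
    using is_sol_components_bounded[OF y] by metis
  define y1 y2 where "y1 s = fst (y s)" and "y2 s = snd (y s)" for s
  define d1 where "d1 s = q s * y1 s - (lam + p s) * y2 s" for s
  define d2 where "d2 s = (lam - p s) * y1 s - q s * y2 s" for s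
  have I1: "(d1 has_integral (y1 x - y1 0)) {0..x}" and I2: "(d2 has_integral (y2 x - y2 0)) {0..x}"
    if "x \<in> {0..pi}" for x
    using is_sol_components[OF y that] by (simp_all add: d1_def[abs_def] d2_def[abs_def] y1_def y2_def)
  have J1: "((\<lambda>s. cnj (d1 s)) has_integral (cnj (y1 x) - cnj (y1 0))) {0..x}"
    and J2: "((\<lambda>s. cnj (d2 s)) has_integral (cnj (y2 x) - cnj (y2 0))) {0..x}" if "x \<in> {0..pi}" for x
    using I1[OF that] I2[OF that] has_integral_cnj[of d1 "y1 x - y1 0" "{0..x}"] has_integral_cnj[of d2 "y2 x - y2 0" "{0..x}"]
    by (simp_all add: o_def)
  have K': "cmod (d1 s) \<le> K" "cmod (d2 s) \<le> K" "cmod (cnj (d1 s)) \<le> K" "cmod (cnj (d2 s)) \<le> K" if "s \<in> {0..pi}" for s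
    using K[OF that] unfolding complex_mod_cnj by (simp_all add: d1_def d2_def y1_def y2_def)
  define \<theta> where "\<theta> s = cnj (y1 s) * y2 s - cnj (y2 s) * y1 s" for s
  define \<theta>' where "\<theta>' s = (cnj (d1 s) * y2 s + cnj (y1 s) * d2 s) - (cnj (d2 s) * y1 s + cnj (y2 s) * d1 s)" for s
  have T: "(\<theta>' has_integral (\<theta> x - \<theta> 0)) {0..x}" if x: "x \<in> {0..pi}" for x
    using has_integral_diff[OF product_rule_integral[OF J1 I2 K'(3) K'(2) x] product_rule_integral[OF J2 I1 K'(4) K'(1) x]]
    by (simp add: \<theta>_def \<theta>'_def[abs_def] algebra_simps)
  define N where "N s = (norm (y s))\<^sup>2" for s
  have N: "N s = (cmod (y1 s))\<^sup>2 + (cmod (y2 s))\<^sup>2" for s by (simp add: N_def norm_prod_power2 y1_def y2_def)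
  have y12: "2 * (cmod (y1 s) * cmod (y2 s)) \<le> N s" for s
    using sum_squares_bound[of "cmod (y1 s)" "cmod (y2 s)"] by (simp add: N mult.assoc)
  have \<theta>le: "cmod (\<theta> s) \<le> N s" for s
    unfolding \<theta>_def using norm_triangle_ineq4[of "cnj (y1 s) * y2 s" "cnj (y2 s) * y1 s"] y12[of s]
    by (simp add: norm_mult mult.commute)
  define R where "R s = y2 s * cnj (y2 s) * (p s - cnj (p s)) + y1 s * cnj (y1 s) * (cnj (p s) - p s)
      + (cnj (q s) - q s) * (cnj (y1 s) * y2 s + cnj (y2 s) * y1 s)" for s
  have \<theta>'eq: "\<theta>' s = (lam - cnj lam) * (y1 s * cnj (y1 s) + y2 s * cnj (y2 s)) + R s" for s
    by (simp add: \<theta>'_def R_def d1_def d2_def algebra_simps)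
  have Rle: "cmod (R s) \<le> 4 * C * N s" if s: "s \<in> {0..pi}" for s
  proof -
    have pq: "cmod (p s - cnj (p s)) \<le> 2 * C" "cmod (cnj (p s) - p s) \<le> 2 * C" "cmod (cnj (q s) - q s) \<le> 2 * C"
      using C(2)[OF s] C(3)[OF s] norm_triangle_ineq4[of "p s" "cnj (p s)"] norm_triangle_ineq4[of "cnj (p s)" "p s"]
        norm_triangle_ineq4[of "cnj (q s)" "q s"] by simp_all
    have "cmod (y2 s * cnj (y2 s) * (p s - cnj (p s))) \<le> (cmod (y2 s))\<^sup>2 * (2 * C)"
      "cmod (y1 s * cnj (y1 s) * (cnj (p s) - p s)) \<le> (cmod (y1 s))\<^sup>2 * (2 * C)"
      unfolding norm_mult[of "_ * cnj _"] using pq C(1)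
      by (auto simp: norm_mult power2_eq_square intro!: mult_left_mono)
    moreover have "cmod ((cnj (q s) - q s) * (cnj (y1 s) * y2 s + cnj (y2 s) * y1 s)) \<le> (2 * C) * N s"
    proof -
      have "cmod (cnj (y1 s) * y2 s + cnj (y2 s) * y1 s) \<le> N s"
        using norm_triangle_ineq[of "cnj (y1 s) * y2 s" "cnj (y2 s) * y1 s"] y12[of s]
        by (simp add: norm_mult mult.commute)
      then show ?thesis unfolding norm_mult[of "_ - _"] using pq(3) C(1) by (intro mult_mono) auto
    qed
    moreover have "cmod (R s) \<le> cmod (y2 s * cnj (y2 s) * (p s - cnj (p s))) + cmod (y1 s * cnj (y1 s) * (cnj (p s) - p s))
        + cmod ((cnj (q s) - q s) * (cnj (y1 s) * y2 s + cnj (y2 s) * y1 s))"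
      unfolding R_def by (intro order_trans[OF norm_triangle_ineq] add_right_mono norm_triangle_ineq)
    ultimately show ?thesis by (simp add: N algebra_simps)
  qed
  define \<tau> where "\<tau> = Im t"
  \<comment> \<open>Since \<theta>(\<pi>) = \<bar>\<rho>\<bar>^2 \<theta>(0) with
    \<bar>\<rho>\<bar>^2 = exp(-2\<pi>\<tau>), this weight makes the product
    \<open>e s * \<theta> s\<close> take equal values at both ends, also for t off the real
    line.\<close>
  define e where "e s = exp (complex_of_real (2 * \<tau> * s))" for s
  have E: "((\<lambda>s. complex_of_real (2 * \<tau>) * e s) has_integral (e x - e 0)) {0..x}" if "x \<in> {0..pi}" for x
    unfolding e_def using that
    by (intro fundamental_theorem_of_calculus)
      (auto intro!: derivative_eq_intros has_vector_derivative_real_field)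
  have ce: "continuous_on {0..pi} (\<lambda>s. complex_of_real (2 * \<tau>) * e s)" unfolding e_def by (intro continuous_intros)
  obtain KE where KE: "\<And>s. s \<in> {0..pi} \<Longrightarrow> cmod (complex_of_real (2 * \<tau>) * e s) \<le> KE"
    using compact_imp_bounded[OF compact_continuous_image[OF ce compact_Icc]] unfolding bounded_iff by blast
  have c\<theta>: "continuous_on {0..pi} y" by (rule is_sol_continuous[OF y])
  then have "continuous_on {0..pi} N" unfolding N_def by (intro continuous_intros)
  then obtain KN where KN: "\<And>s. s \<in> {0..pi} \<Longrightarrow> norm (N s) \<le> KN"
    using compact_imp_bounded[OF compact_continuous_image[OF _ compact_Icc], of 0 pi N] unfolding bounded_iff by blast
  have \<theta>'le: "cmod (\<theta>' s) \<le> (2 * cmod lam + 4 * C) * KN" if s: "s \<in> {0..pi}" for s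
  proof -
    have "cmod (lam - cnj lam) \<le> 2 * cmod lam" using norm_triangle_ineq4[of lam "cnj lam"] by simp
    moreover have "cmod (y1 s * cnj (y1 s) + y2 s * cnj (y2 s)) \<le> N s"
      using norm_triangle_ineq[of "y1 s * cnj (y1 s)" "y2 s * cnj (y2 s)"] by (simp add: N norm_mult power2_eq_square)
    ultimately have "cmod ((lam - cnj lam) * (y1 s * cnj (y1 s) + y2 s * cnj (y2 s))) \<le> (2 * cmod lam) * N s"
      unfolding norm_mult[of "lam - _"] by (intro mult_mono) auto
    then have "cmod (\<theta>' s) \<le> (2 * cmod lam + 4 * C) * N s"
      unfolding \<theta>'eq using Rle[OF s] by (intro order_trans[OF norm_triangle_ineq]) (simp add: algebra_simps)
    also have "\<dots> \<le> (2 * cmod lam + 4 * C) * KN" using KN[OF s] C(1) by (intro mult_left_mono) auto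
    finally show ?thesis .
  qed
  have bc: "y pi = (exp (\<i> * of_real pi * t) * fst v, exp (\<i> * of_real pi * t) * snd v)" "y 0 = v"
    using v unfolding y_def by (simp_all add: eigvec_boundary comb_0)
  have "e pi * (cnj (exp (\<i> * of_real pi * t)) * exp (\<i> * of_real pi * t)) = 1"
  proof -
    have "complex_of_real (2 * \<tau> * pi) + (cnj (\<i> * of_real pi * t) + \<i> * of_real pi * t) = 0"
      by (simp add: complex_eq_iff \<tau>_def)
    then show ?thesis unfolding e_def exp_cnj exp_add[symmetric] by (simp only: exp_zero)
  qed
  then have "e pi * \<theta> pi - e 0 * \<theta> 0 = 0"
    unfolding \<theta>_def y1_def y2_def bc by (simp add: e_def) algebra
  moreover have "((\<lambda>s. complex_of_real (2 * \<tau>) * e s * \<theta> s + e s * \<theta>' s) has_integral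
      (e pi * \<theta> pi - e 0 * \<theta> 0)) {0..pi}"
    by (rule product_rule_integral[OF E T KE \<theta>'le]) (auto intro: order_refl)
  ultimately have I: "((\<lambda>s. complex_of_real (2 * \<tau>) * e s * \<theta> s + e s * \<theta>' s) has_integral 0) {0..pi}" by simp
  \<comment> \<open>The sign lets positive and negative Im lam be treated at once.\<close>
  define \<epsilon> where "\<epsilon> = sgn (Im lam)"
  have \<epsilon>: "\<epsilon> * Im lam = \<bar>Im lam\<bar>" "\<bar>\<epsilon>\<bar> \<le> 1" by (auto simp: \<epsilon>_def sgn_real_def)
  from has_integral_mult_right[OF has_integral_linear[OF I bounded_linear_Im], of \<epsilon>]
  have I': "((\<lambda>s. \<epsilon> * Im (complex_of_real (2 * \<tau>) * e s * \<theta> s + e s * \<theta>' s)) has_integral 0) {0..pi}"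
    by (simp only: o_def) simp
  obtain E0 where E0: "E0 \<ge> 0"
     "\<And>x. x \<in> {0..pi} \<Longrightarrow> norm (csol p q lam x) \<le> E0" "\<And>x. x \<in> {0..pi} \<Longrightarrow> norm (ssol p q lam x) \<le> E0"
    using sol_bounded_strip[of "\<bar>Im lam\<bar>"] by (metis order_refl)
  have v0: "norm v > 0" using v by (simp add: eigvec_def)
  have "4 * E0 * norm (y 0) \<ge> norm v" unfolding y_def by (rule norm_le_comb) (use E0 in auto)
  then have E0p: "E0 > 0" using v0 E0(1) by (cases "E0 = 0") auto
  \<comment> \<open>A positive lower bound for \<bar>y\<bar>^2, from the invertibility of the
    fundamental matrix, keeps the integrand away from 0.\<close>
  define m where "m = (norm v / (4 * E0))\<^sup>2"
  have m: "m > 0" using v0 E0p by (simp add: m_def)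
  have mN: "m \<le> N s" if "s \<in> {0..pi}" for s
  proof -
    have "norm v \<le> 4 * E0 * norm (y s)" unfolding y_def by (rule norm_le_comb) (use E0 that in auto)
    then have "norm v / (4 * E0) \<le> norm (y s)" using E0p by (simp add: field_simps)
    then show ?thesis unfolding m_def N_def using E0p by (intro power_mono) auto
  qed
  \<comment> \<open>The main term contributes 2 \<bar>Im lam\<bar>; the derivative of the weight
    costs 2 \<bar>\<tau>\<bar> and the coefficients cost 4 C.\<close>
  define \<kappa> where "\<kappa> = 2 * (\<bar>Im lam\<bar> - \<bar>\<tau>\<bar> - 2 * C)"
  have \<kappa>: "\<kappa> > 0" using neg by (simp add: \<kappa>_def \<tau>_def)
  have "exp (- (2 * \<bar>\<tau>\<bar> * pi)) * (\<kappa> * m) \<le> \<epsilon> * Im (complex_of_real (2 * \<tau>) * e s * \<theta> s + e s * \<theta>' s)" if s: "s \<in> {0..pi}" for s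
  proof -
    have "y1 s * cnj (y1 s) + y2 s * cnj (y2 s) = of_real (N s)"
      by (simp only: N of_real_add complex_norm_square)
    moreover have "lam - cnj lam = 2 * Im lam * \<i>" by (simp add: complex_eq_iff)
    ultimately have "\<theta>' s = (2 * Im lam * N s) * \<i> + R s"
      unfolding \<theta>'eq by (simp add: mult_ac)
    then have "complex_of_real (2 * \<tau>) * e s * \<theta> s + e s * \<theta>' s
        = of_real (exp (2 * \<tau> * s)) * (complex_of_real (2 * \<tau>) * \<theta> s + ((2 * Im lam * N s) * \<i> + R s))"
      by (simp add: e_def algebra_simps flip: exp_of_real)
    then have Im: "\<epsilon> * Im (complex_of_real (2 * \<tau>) * e s * \<theta> s + e s * \<theta>' s)
        = exp (2 * \<tau> * s) * (\<epsilon> * (2 * \<tau> * Im (\<theta> s)) + (2 * \<bar>Im lam\<bar> * N s + \<epsilon> * Im (R s)))"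
      using \<epsilon>(1) by (simp add: algebra_simps)
    have "\<bar>\<epsilon> * (2 * \<tau> * Im (\<theta> s))\<bar> \<le> 1 * (2 * \<bar>\<tau>\<bar> * N s)"
      unfolding abs_mult using \<epsilon>(2) order_trans[OF abs_Im_le_cmod \<theta>le, of s] by (intro mult_mono) auto
    moreover have "\<bar>\<epsilon> * Im (R s)\<bar> \<le> 1 * (4 * C * N s)"
      unfolding abs_mult using \<epsilon>(2) order_trans[OF abs_Im_le_cmod Rle[OF s]] by (intro mult_mono) auto
    ultimately have "\<kappa> * N s \<le> \<epsilon> * (2 * \<tau> * Im (\<theta> s)) + (2 * \<bar>Im lam\<bar> * N s + \<epsilon> * Im (R s))"
      by (simp add: \<kappa>_def algebra_simps)
    moreover have "\<kappa> * m \<le> \<kappa> * N s" using mN[OF s] \<kappa> by (intro mult_left_mono) auto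
    ultimately have lo: "\<kappa> * m \<le> \<epsilon> * (2 * \<tau> * Im (\<theta> s)) + (2 * \<bar>Im lam\<bar> * N s + \<epsilon> * Im (R s))"
      by linarith
    have "exp (- (2 * \<bar>\<tau>\<bar> * pi)) \<le> exp (2 * \<tau> * s)"
    proof -
      have "- (2 * \<tau> * s) \<le> \<bar>2 * \<tau> * s\<bar>" by simp
      also have "\<dots> = 2 * \<bar>\<tau>\<bar> * s" using s by (simp add: abs_mult)
      also have "\<dots> \<le> 2 * \<bar>\<tau>\<bar> * pi" using s by (intro mult_left_mono) auto
      finally show ?thesis by simp
    qed
    then show ?thesis unfolding Im using \<kappa> m lo by (intro mult_mono lo) simp_all
  qed
  then have "(\<lambda>s. exp (- (2 * \<bar>\<tau>\<bar> * pi)) * (\<kappa> * m)) s \<le> \<epsilon> * Im (complex_of_real (2 * \<tau>) * e s * \<theta> s + e s * \<theta>' s)"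
    if "s \<in> {0..pi}" for s using that by simp
  moreover have "((\<lambda>s::real. exp (- (2 * \<bar>\<tau>\<bar> * pi)) * (\<kappa> * m)) has_integral (pi * (exp (- (2 * \<bar>\<tau>\<bar> * pi)) * (\<kappa> * m)))) {0..pi}"
    using has_integral_const_real[of "exp (- (2 * \<bar>\<tau>\<bar> * pi)) * (\<kappa> * m)" 0 pi] by simp
  ultimately have "pi * (exp (- (2 * \<bar>\<tau>\<bar> * pi)) * (\<kappa> * m)) \<le> 0"
    using has_integral_le[OF _ I'] by blast
  moreover have "pi * (exp (- (2 * \<bar>\<tau>\<bar> * pi)) * (\<kappa> * m)) > 0" using \<kappa> m by simp
  ultimately show False by linarith
qed

end

section \<open>Integrability over real intervals\<close>

text \<open>In \<open>ft\<close> the index set varies with x. A range common to all x in [0, \<pi>]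
  makes continuity in (t, x) evident and lets t be pulled out of the integrals in
  \<open>bip_ft\<close>.\<close>

definition ft_sum :: "(real \<Rightarrow> complex \<times> complex) \<Rightarrow> int \<Rightarrow> complex \<Rightarrow> real \<Rightarrow> complex \<times> complex" where
  "ft_sum f M t x = (\<Sum>k\<in>{-M..M}.
      (exp (- \<i> * of_real pi * of_int k * t) * fst (f (x + of_int k * pi)),
       exp (- \<i> * of_real pi * of_int k * t) * snd (f (x + of_int k * pi))))"

lemma ft_finite_sum:
  assumes "compact (closure {y. f y \<noteq> 0})"
  obtains M :: int where "\<And>t x. x \<in> {0..pi} \<Longrightarrow> ft f t x = ft_sum f M t x"
proof -
  have "bounded {y. f y \<noteq> 0}"
    using assms by (meson bounded_closure_image bounded_subset closure_subset compact_imp_bounded)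
  then obtain B where B: "\<And>y. f y \<noteq> 0 \<Longrightarrow> \<bar>y\<bar> \<le> B" by (auto simp: bounded_iff)
  show ?thesis
  proof (rule that[of "\<lceil>B / pi + 1\<rceil>"])
    fix t :: complex and x :: real assume x: "x \<in> {0..pi}"
    have "{k::int. f (x + of_int k * pi) \<noteq> 0} \<subseteq> {- \<lceil>B / pi + 1\<rceil>..\<lceil>B / pi + 1\<rceil>}"
    proof
      fix k :: int assume "k \<in> {k. f (x + of_int k * pi) \<noteq> 0}"
      then have "\<bar>x + of_int k * pi\<bar> \<le> B" using B by simp
      then have "\<bar>of_int k\<bar> * pi \<le> B + pi" using x by (simp add: abs_if split: if_splits)
      then have "\<bar>real_of_int k\<bar> \<le> B / pi + 1" by (simp add: field_simps)
      then have "\<bar>k\<bar> \<le> \<lceil>B / pi + 1\<rceil>" by linarith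
      then show "k \<in> {- \<lceil>B / pi + 1\<rceil>..\<lceil>B / pi + 1\<rceil>}" by auto
    qed
    then show "ft f t x = ft_sum f \<lceil>B / pi + 1\<rceil> t x"
      unfolding ft_def ft_sum_def by (intro sum.mono_neutral_left) (auto simp: zero_prod_def)
  qed
qed

lemma continuous_on_translate:
  assumes "continuous_on UNIV (f :: real \<Rightarrow> 'a::topological_space)"
  shows "continuous_on A (\<lambda>s. f (s + c))"
  by (rule continuous_on_compose2[OF assms]) (auto intro!: continuous_intros)

lemma continuous_on_ft:
  assumes "continuous_on UNIV f" "compact (closure {y. f y \<noteq> 0})"
  shows "continuous_on (UNIV \<times> {0..pi}) (\<lambda>z. ft f (fst z) (snd z))"
proof -
  obtain M :: int where M: "\<And>t x. x \<in> {0..pi} \<Longrightarrow> ft f t x = ft_sum f M t x"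
    using ft_finite_sum[OF assms(2)] by metis
  have c: "continuous_on A (\<lambda>z::complex \<times> real. f (snd z + c))" for c A
    by (rule continuous_on_compose2[OF assms(1)]) (auto intro!: continuous_intros)
  have "continuous_on (UNIV \<times> {0..pi}) (\<lambda>z. \<Sum>k\<in>{-M..M}.
      (exp (- \<i> * of_real pi * of_int k * fst z) * fst (f (snd z + of_int k * pi)),
       exp (- \<i> * of_real pi * of_int k * fst z) * snd (f (snd z + of_int k * pi))))"
    by (intro continuous_intros c)
  then show ?thesis by (rule continuous_on_eq) (auto simp: M ft_sum_def)
qed

lemma continuous_on_ft_slice:
  assumes "continuous_on UNIV f" "compact (closure {y. f y \<noteq> 0})"
  shows "continuous_on {0..pi} (ft f t)"
proof -
  have "continuous_on {0..pi} (\<lambda>s. (\<lambda>z. ft f (fst z) (snd z)) (t, s))"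
    by (rule continuous_on_compose2[OF continuous_on_ft[OF assms]]) (auto intro!: continuous_intros)
  then show ?thesis by simp
qed

lemma ft_bounded:
  assumes "continuous_on UNIV f" "compact (closure {y. f y \<noteq> 0})" "compact K"
  obtains G where "\<And>t s. t \<in> K \<Longrightarrow> s \<in> {0..pi} \<Longrightarrow> norm (ft f t s) \<le> G"
proof -
  have "compact ((\<lambda>z. ft f (fst z) (snd z)) ` (K \<times> {0..pi}))"
    by (intro compact_continuous_image compact_Times assms(3) compact_Icc
        continuous_on_subset[OF continuous_on_ft[OF assms(1,2)]]) auto
  from compact_imp_bounded[OF this] obtain G where G: "\<forall>w\<in>(\<lambda>z. ft f (fst z) (snd z)) ` (K \<times> {0..pi}). norm w \<le> G"
    unfolding bounded_iff by blast
  show ?thesis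
  proof (rule that[of G])
    show "norm (ft f t s) \<le> G" if "t \<in> K" "s \<in> {0..pi}" for t s
      using bspec[OF G, OF imageI[of "(t, s)"]] that by simp
  qed
qed

lemma bip_ft:
  assumes "continuous_on UNIV f" "continuous_on {0..pi} u"
    and M: "\<And>x. x \<in> {0..pi} \<Longrightarrow> ft f t x = ft_sum f M t x"
  shows "bip (ft f t) u = (\<Sum>k\<in>{-M..M}. exp (- \<i> * of_real pi * of_int k * t)
      * bip (\<lambda>s. f (s + of_int k * pi)) u)"
proof -
  have c: "continuous_on {0..pi} (\<lambda>s. f (s + c))" for c by (rule continuous_on_translate[OF assms(1)])
  have "bip (ft f t) u = integral {0..pi} (\<lambda>s. \<Sum>k\<in>{-M..M}. exp (- \<i> * of_real pi * of_int k * t) *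
      (fst (f (s + of_int k * pi)) * fst (u s) + snd (f (s + of_int k * pi)) * snd (u s)))"
    unfolding bip_def
    by (rule integral_cong) (simp add: M ft_sum_def fst_sum snd_sum sum_distrib_left sum.distrib algebra_simps)
  also have "\<dots> = (\<Sum>k\<in>{-M..M}. integral {0..pi} (\<lambda>s. exp (- \<i> * of_real pi * of_int k * t) *
      (fst (f (s + of_int k * pi)) * fst (u s) + snd (f (s + of_int k * pi)) * snd (u s))))"
    by (intro integral_sum integrable_continuous_real continuous_intros c assms(2)) auto
  finally show ?thesis by (simp add: bip_def)
qed

lemma sin_pi_nonzero:
  assumes "of_int m < t" "t < of_int m + 1"
  shows "sin (pi * t) \<noteq> 0"
proof
  assume "sin (pi * t) = 0"
  then obtain i :: int where "pi * t = of_int i * pi" unfolding sin_zero_iff_int2 by blast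
  then have "t = of_int i" by (simp add: mult.commute)
  then have "of_int m < (of_int i :: real)" "of_int i < (of_int (m + 1) :: real)" using assms by simp_all
  then show False unfolding of_int_less_iff by linarith
qed

lemma absolutely_integrable_Icc_cover:
  fixes P :: "real \<Rightarrow> 'a::euclidean_space"
  assumes "P absolutely_integrable_on {a..b}" "P absolutely_integrable_on {b..c}" "P absolutely_integrable_on {c..d}"
    and "S \<subseteq> {a..d}" "S \<in> sets lebesgue"
  shows "P absolutely_integrable_on S"
proof -
  have "P absolutely_integrable_on {a..b} \<union> {b..c} \<union> {c..d}"
    by (intro absolutely_integrable_Un assms)
  then show ?thesis
    by (rule set_integrable_subset[OF _ assms(5)]) (use assms(4) in auto)
qed

context dirac
begin

text \<open>Continuity in two independent variables t and lam allows the substitution of a label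
  along the real line as well as along a semicircle. In the integrals, t occurs only in finitely
  many exponential factors and lam only in the solutions.\<close>

lemma continuous_on_numer:
  assumes f: "continuous_on UNIV f" "compact (closure {y. f y \<noteq> 0})" and x: "x \<in> {0..pi}"
  shows "continuous_on UNIV (\<lambda>z. comb (snd z) (numer (fst z) (snd z) (ft f (fst z))) x)"
proof -
  obtain M :: int where M: "\<And>t x. x \<in> {0..pi} \<Longrightarrow> ft f t x = ft_sum f M t x"
    using ft_finite_sum[OF f(2)] by metis
  have c1: "continuous_on UNIV (\<lambda>z::complex \<times> complex. bip (\<lambda>s. f (s + c)) (sol p q (snd z) v))" for c v
    by (rule continuous_on_compose2[OF continuous_on_bip_sol[OF continuous_on_translate[OF f(1)]]])
      (auto intro!: continuous_intros)
  have eq: "bip (ft f t) (sol p q lam v) = (\<Sum>k\<in>{-M..M}. exp (- \<i> * of_real pi * of_int k * t)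
      * bip (\<lambda>s. f (s + of_int k * pi)) (sol p q lam v))" for t lam v
    by (rule bip_ft[OF f(1) is_sol_continuous[OF is_sol_sol]]) (rule M)
  have b: "continuous_on UNIV (\<lambda>z. bip (ft f (fst z)) (sol p q (snd z) v))" for v
    unfolding eq by (intro continuous_intros c1)
  have c2: "continuous_on UNIV (\<lambda>z::complex \<times> complex. sol p q (snd z) v y)" if "y \<in> {0..pi}" for v y
    by (rule continuous_on_compose2[OF continuous_on_sol_param[OF that]]) (auto intro!: continuous_intros)
  have "pi \<in> {0..pi}" by simp
  then show ?thesis
    unfolding comb_def numer_def K11_def K12_def K21_def K22_def csol_def ssol_def fst_conv snd_conv
    by (intro continuous_intros b c2 x)
qed

lemma riesz_proj_norm_le:
  assumes s: "simple_eig p q t lam" and g: "continuous_on {0..pi} g"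
  shows "norm (riesz_proj p q t lam g x) \<le> 2 * norm (comb lam (numer t lam g) x) * (1 / cmod (deriv (hillF p q) lam))"
proof -
  let ?n = "comb lam (numer t lam g) x" and ?d = "deriv (hillF p q) lam"
  have "norm (riesz_proj p q t lam g x) \<le> cmod (fst ?n / ?d) + cmod (snd ?n / ?d)"
    unfolding riesz_proj_formula[OF s g] by (rule norm_Pair_le)
  also have "\<dots> \<le> norm ?n / cmod ?d + norm ?n / cmod ?d"
    unfolding norm_divide using norm_fst_le[of "fst ?n" "snd ?n"] norm_snd_le[of "snd ?n" "fst ?n"]
    by (intro add_mono divide_right_mono) auto
  finally show ?thesis by simp
qed

lemma norm_numer_le:
  assumes E: "\<And>s. s \<in> {0..pi} \<Longrightarrow> norm (csol p q lam s) \<le> E" "\<And>s. s \<in> {0..pi} \<Longrightarrow> norm (ssol p q lam s) \<le> E"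
    and G: "\<And>s. s \<in> {0..pi} \<Longrightarrow> norm (g s) \<le> G" and t: "Im t \<le> 1"
  shows "norm (numer t lam g) \<le> 4 * ((E + exp pi) * (2 * pi * G * E))"
proof -
  have E0: "E \<ge> 0" using order_trans[OF norm_ge_zero E(1)[of 0]] by simp
  have G0: "G \<ge> 0" using order_trans[OF norm_ge_zero G[of 0]] by simp
  have le: "cmod (fst u) \<le> norm u" "cmod (snd u) \<le> norm u" for u :: "complex \<times> complex"
    using norm_fst_le[of "fst u" "snd u"] norm_snd_le[of "snd u" "fst u"] by simp_all
  \<comment> \<open>The modulus is exp(\<pi> Im t).\<close>
  have r: "cmod (exp (- (\<i> * of_real pi * t))) \<le> exp pi" using t by simp
  have cs: "cmod (fst (csol p q lam pi)) \<le> E" "cmod (snd (csol p q lam pi)) \<le> E"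
    "cmod (fst (ssol p q lam pi)) \<le> E" "cmod (snd (ssol p q lam pi)) \<le> E"
    using order_trans[OF le(1) E(1)[of pi]] order_trans[OF le(2) E(1)[of pi]]
      order_trans[OF le(1) E(2)[of pi]] order_trans[OF le(2) E(2)[of pi]] by auto
  have k: "cmod (K11 t lam) \<le> E + exp pi" "cmod (K12 t lam) \<le> E + exp pi"
    "cmod (K21 t lam) \<le> E + exp pi" "cmod (K22 t lam) \<le> E + exp pi"
    unfolding K11_def K12_def K21_def K22_def
    using cs r norm_triangle_ineq4[of "fst (csol p q lam pi)" "exp (- (\<i> * of_real pi * t))"]
      norm_triangle_ineq4[of "exp (- (\<i> * of_real pi * t))" "snd (ssol p q lam pi)"] exp_ge_zero[of pi]
    by (simp_all only: norm_minus_cancel)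
  have b: "cmod (bip g (csol p q lam)) \<le> 2 * pi * G * E" "cmod (bip g (ssol p q lam)) \<le> 2 * pi * G * E"
    by (rule bip_bound[OF G]; use E in simp)+
  have m: "cmod (a * c) \<le> (E + exp pi) * (2 * pi * G * E)" if "cmod a \<le> E + exp pi" "cmod c \<le> 2 * pi * G * E" for a c
    unfolding norm_mult using that E0 by (intro mult_mono) (auto intro: add_nonneg_nonneg)
  have "norm (numer t lam g) \<le> cmod (K11 t lam * bip g (csol p q lam) + K12 t lam * bip g (ssol p q lam))
     + cmod (K21 t lam * bip g (csol p q lam) + K22 t lam * bip g (ssol p q lam))"
    unfolding numer_def by (rule order_trans[OF norm_Pair_le]) (simp only: norm_minus_cancel)
  also have "\<dots> \<le> 4 * ((E + exp pi) * (2 * pi * G * E))"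
    using m[OF k(1) b(1)] m[OF k(2) b(2)] m[OF k(3) b(1)] m[OF k(4) b(2)]
      norm_triangle_ineq[of "K11 t lam * bip g (csol p q lam)" "K12 t lam * bip g (ssol p q lam)"]
      norm_triangle_ineq[of "K21 t lam * bip g (csol p q lam)" "K22 t lam * bip g (ssol p q lam)"] by linarith
  finally show ?thesis .
qed

lemma branch_hillF: "continuous_on UNIV L \<Longrightarrow> branch (hillF p q) L"
  by (simp add: branch_def hillF_holomorphic)

abbreviation proj :: "(real \<Rightarrow> complex) \<Rightarrow> (real \<Rightarrow> complex \<times> complex) \<Rightarrow> real \<Rightarrow> real \<Rightarrow> complex \<times> complex" where
  "proj L f x t \<equiv> riesz_proj p q (of_real t) (L t) (ft f (of_real t)) x"

lemma riesz_proj_real_measurable: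
  assumes L: "continuous_on UNIV L" and f: "continuous_on UNIV f" "compact (closure {y. f y \<noteq> 0})" and x: "x \<in> {0..pi}"
  shows "(\<lambda>t. proj L f x t) \<in> borel_measurable borel"
proof -
  interpret branch "hillF p q" L by (rule branch_hillF[OF L])
  let ?n = "\<lambda>t. comb (L t) (numer (of_real t) (L t) (ft f (of_real t))) x"
  have "continuous_on UNIV (\<lambda>t. (\<lambda>z. comb (snd z) (numer (fst z) (snd z) (ft f (fst z))) x) (complex_of_real t, L t))"
    by (rule continuous_on_compose2[OF continuous_on_numer[OF f x]]) (auto intro!: continuous_intros L)
  then have cn: "continuous_on UNIV ?n" by simp
  have [measurable]: "(\<lambda>t. fst (?n t)) \<in> borel_measurable borel" "(\<lambda>t. snd (?n t)) \<in> borel_measurable borel"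
    "(\<lambda>t. deriv (hillF p q) (L t)) \<in> borel_measurable borel"
    by (intro borel_measurable_continuous_onI continuous_intros cn continuous_deriv_F)+
  have "(\<lambda>t. proj L f x t) = (\<lambda>t. if t \<in> simple_set then
      (fst (?n t) / deriv (hillF p q) (L t), snd (?n t) / deriv (hillF p q) (L t)) else 0)"
  proof
    fix t
    show "proj L f x t = (if t \<in> simple_set then
      (fst (?n t) / deriv (hillF p q) (L t), snd (?n t) / deriv (hillF p q) (L t)) else 0)"
    proof (cases "t \<in> simple_set")
      case True
      then have "simple_eig p q (of_real t) (L t)" by (simp add: simple_eig_def simple_set_def)
      from riesz_proj_formula[OF this continuous_on_ft_slice[OF f]] True show ?thesis by simp
    next
      case False
      then have "\<not> simple_eig p q (of_real t) (L t)" by (simp add: simple_eig_def simple_set_def)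
      with False show ?thesis by (simp add: riesz_proj_def)
    qed
  qed
  then show ?thesis by (simp only:) measurable
qed

text \<open>The interval may contain points of \<open>Aset\<close>: the projection is dominated by a
  constant multiple of \<open>weight\<close>, whose singularities away from integers are
  integrable.\<close>

lemma riesz_proj_integrable_off_integers:
  assumes L: "continuous_on UNIV L" and f: "continuous_on UNIV f" "compact (closure {y. f y \<noteq> 0})" and x: "x \<in> {0..pi}"
    and "of_int m < a" "b < of_int m + 1"
  shows "(\<lambda>t. proj L f x t) absolutely_integrable_on {a..b}"
proof -
  interpret branch "hillF p q" L by (rule branch_hillF[OF L])
  let ?n = "\<lambda>t. comb (L t) (numer (of_real t) (L t) (ft f (of_real t))) x"
  have "continuous_on UNIV (\<lambda>t. (\<lambda>z. comb (snd z) (numer (fst z) (snd z) (ft f (fst z))) x) (complex_of_real t, L t))"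
    by (rule continuous_on_compose2[OF continuous_on_numer[OF f x]]) (auto intro!: continuous_intros L)
  then have "continuous_on UNIV ?n" by simp
  then have "continuous_on {a..b} ?n" by (rule continuous_on_subset) simp
  then obtain N where N: "\<And>t. t \<in> {a..b} \<Longrightarrow> norm (?n t) \<le> N"
    using compact_imp_bounded[OF compact_continuous_image[OF _ compact_Icc], of a b ?n] unfolding bounded_iff by blast
  have W: "weight absolutely_integrable_on {a..b}"
    by (rule weight_integrable, rule sin_pi_nonzero[of m]) (use assms(5,6) in auto)
  show ?thesis
  proof (rule measurable_bounded_by_integrable_imp_absolutely_integrable)
    show "(\<lambda>t. 2 * N * weight t) integrable_on {a..b}"
      by (intro integrable_on_mult_right set_lebesgue_integral_eq_integral(1) W)
    fix t assume t: "t \<in> {a..b}"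
    show "norm (proj L f x t) \<le> 2 * N * weight t"
    proof (cases "t \<in> simple_set")
      case True
      then have "simple_eig p q (of_real t) (L t)" by (simp add: simple_eig_def simple_set_def)
      from riesz_proj_norm_le[OF this continuous_on_ft_slice[OF f, of "of_real t"], of x]
      have "norm (proj L f x t) \<le> 2 * norm (?n t) * weight t"
        using True by (simp add: weight_def)
      also have "\<dots> \<le> 2 * N * weight t"
        using N[OF t] by (intro mult_right_mono) (auto simp: weight_def)
      finally show ?thesis .
    next
      case False
      then have "\<not> simple_eig p q (of_real t) (L t)" by (simp add: simple_eig_def simple_set_def)
      with False show ?thesis by (simp add: riesz_proj_def weight_def)
    qed
  qed (auto intro: borel_measurable_lebesgue_on riesz_proj_real_measurable[OF L f x])
qed

lemma riesz_proj_integrable_at_integer: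
  fixes t0 :: real
  assumes L: "continuous_on UNIV L" and f: "continuous_on UNIV f" "compact (closure {y. f y \<noteq> 0})" and x: "x \<in> {0..pi}"
    and t0: "t0 = of_int m" and h: "0 < h" "h < 1"
    and e: "e > 0" "(\<lambda>t. 1 / alpha_abs p q (of_real t) (L t)) absolutely_integrable_on {t0 - e<..<t0 + e}"
  shows "(\<lambda>t. proj L f x t) absolutely_integrable_on {t0 - h<..<t0 + h}"
proof (rule absolutely_integrable_Icc_cover)
  \<comment> \<open>The radius \<open>e\<close> supplied by the ESS condition may be smaller than
    \<open>h\<close>. The majorant 1/\<alpha> is used only within distance \<open>d\<close>; the two
    outer pieces contain no integer.\<close>
  define d where "d = min e h / 2"
  have d: "0 < d" "d < e" "d < h" using e(1) h(1) by (auto simp: d_def min_def)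
  let ?P = "\<lambda>t. proj L f x t"
  let ?I = "{t0 - d..t0 + d}"
  show "?P absolutely_integrable_on {t0 - h..t0 - d}"
    by (rule riesz_proj_integrable_off_integers[OF L f x, of "m - 1"]) (use t0 h d in auto)
  show "?P absolutely_integrable_on {t0 + d..t0 + h}"
    by (rule riesz_proj_integrable_off_integers[OF L f x, of m]) (use t0 h d in auto)
  show "?P absolutely_integrable_on ?I"
  proof -
    have "bounded (L ` ?I)"
      by (intro compact_imp_bounded compact_continuous_image continuous_on_subset[OF L]) auto
    then obtain R where R: "\<And>t. t \<in> ?I \<Longrightarrow> cmod (L t) \<le> R" unfolding bounded_iff by blast
    obtain E where E: "\<And>lam x. \<bar>Im lam\<bar> \<le> R \<Longrightarrow> x \<in> {0..pi} \<Longrightarrow> norm (csol p q lam x) \<le> E"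
      "\<And>lam x. \<bar>Im lam\<bar> \<le> R \<Longrightarrow> x \<in> {0..pi} \<Longrightarrow> norm (ssol p q lam x) \<le> E"
      using sol_bounded_strip[of R] by metis
    have "compact (complex_of_real ` ?I)" by (intro compact_continuous_image continuous_intros) auto
    from ft_bounded[OF f this] obtain G where
      G: "\<And>t s. t \<in> complex_of_real ` ?I \<Longrightarrow> s \<in> {0..pi} \<Longrightarrow> norm (ft f t s) \<le> G" by metis
    define C where "C = 2 * (2 * pi * G * (4 * E) * (4 * E)) * (4 * E)\<^sup>2"
    have A: "(\<lambda>t. 1 / alpha_abs p q (of_real t) (L t)) absolutely_integrable_on ?I"
      by (rule set_integrable_subset[OF e(2)]) (use d in auto)
    show ?thesis
    proof (rule measurable_bounded_by_integrable_imp_absolutely_integrable)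
      show "(\<lambda>t. C * (1 / alpha_abs p q (of_real t) (L t))) integrable_on ?I"
        by (intro integrable_on_mult_right set_lebesgue_integral_eq_integral(1) A)
      fix t assume t: "t \<in> ?I"
      show "norm (?P t) \<le> C * (1 / alpha_abs p q (of_real t) (L t))"
      proof (cases "simple_eig p q (of_real t) (L t)")
        case True
        have im: "\<bar>Im (L t)\<bar> \<le> R" using order_trans[OF abs_Im_le_cmod R[OF t]] .
        show ?thesis
          unfolding C_def
          by (rule riesz_proj_le_alpha[OF True x]) (use E im G t in auto)
      qed (simp add: riesz_proj_def alpha_abs_def)
    qed (auto intro: borel_measurable_lebesgue_on riesz_proj_real_measurable[OF L f x])
  qed
qed auto

text \<open>The real points of \<open>Aset\<close> form the t-projection of a closed set of pairs
  (lam, t). A projection of a closed set need not be closed, but cutting lam to discs exhibits it as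
  a countable union of compact sets.\<close>

lemma Eset_measurable: "Eset p q h \<in> sets lebesgue"
proof -
  define S where "S = {z. deriv (hillF p q) z = 0} \<union> {z. fst (ssol p q z pi) = 0}"
  have "closed S"
    unfolding S_def ssol_def
    by (intro closed_Un closed_Collect_eq continuous_intros continuous_on_deriv_hillF continuous_on_sol_param) auto
  define T where "T n = snd ` (((S \<inter> cball 0 (real n)) \<times> {-h..2 - h}) \<inter>
      {z. hillF p q (fst z) = 2 * cos (of_real pi * complex_of_real (snd z))})" for n
  have "compact (T n)" for n
  proof -
    have "closed {z :: complex \<times> real. hillF p q (fst z) = 2 * cos (of_real pi * complex_of_real (snd z))}"
      by (intro closed_Collect_eq continuous_intros continuous_on_compose2[OF continuous_on_hillF[of UNIV]]) auto
    then show ?thesis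
      unfolding T_def
      by (intro compact_continuous_image continuous_intros compact_Int_closed compact_Times closed_Int_compact \<open>closed S\<close>) auto
  qed
  then have T: "(\<Union>n. T n) \<in> sets borel" by (intro sets.countable_UN) (auto intro: borel_closed compact_imp_closed)
  \<comment> \<open>For negative h the condition on the imaginary part makes \<open>Dh h\<close>
    empty, a condition that \<open>T\<close> does not see.\<close>
  have "{t. complex_of_real t \<in> Aset p q h} = (if 0 \<le> h then (\<Union>n. T n) else {})"
  proof (cases "0 \<le> h")
    case True
    have "t \<in> (\<Union>n. T n)" if tA: "complex_of_real t \<in> Aset p q h" for t
    proof -
      obtain z where z: "z \<in> S" "hillF p q z = 2 * cos (of_real pi * of_real t)" and t: "t \<in> {-h..2 - h}"
        using tA by (auto simp: Aset_def Dh_def S_def)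
      obtain n where "cmod z \<le> real n" using real_arch_simple by blast
      then have "(z, t) \<in> ((S \<inter> cball 0 (real n)) \<times> {-h..2 - h}) \<inter>
          {z. hillF p q (fst z) = 2 * cos (of_real pi * complex_of_real (snd z))}" using z t by simp
      from imageI[OF this, of snd] show ?thesis unfolding T_def by auto
    qed
    moreover have "complex_of_real t \<in> Aset p q h" if "t \<in> T n" for t n
      using that True by (auto simp: T_def Aset_def Dh_def S_def)
    ultimately show ?thesis using True by auto
  qed (auto simp: Aset_def Dh_def)
  then have "{t. complex_of_real t \<in> Aset p q h} \<in> sets borel" using T by simp
  then have "Eset p q h \<in> sets borel" unfolding Eset_def Bset_def by (intro sets.Diff sets.Un) auto
  then show ?thesis by (simp add: sets_completionI_sets)
qed

end

section \<open>Integrability over the semicircles\<close>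

lemma compact_semicirc: "compact (semicirc c h)"
proof -
  have eq: "semicirc c h = sphere c h \<inter> {t. Im t \<ge> 0}"
    by (auto simp: semicirc_def dist_norm norm_minus_commute)
  show ?thesis unfolding eq by (intro compact_Int_closed closed_halfspace_Im_ge) auto
qed

lemma sin_nonzero_semicirc:
  assumes "0 < h" "h < 1" "t \<in> semicirc (of_int m) h"
  shows "sin (of_real pi * t) \<noteq> 0"
proof
  assume "sin (of_real pi * t) = 0"
  then obtain n :: int where "of_real pi * t = of_real (n * pi)" unfolding sin_eq_0 by blast
  then have "t = of_int n" by (simp add: mult.commute)
  then have "cmod (of_int n - of_int m) = h" using assms(3) by (simp add: semicirc_def)
  then have "cmod (of_int (n - m)) = h" by simp
  then have "of_int \<bar>n - m\<bar> = h" by (simp only: norm_of_int of_int_abs)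
  then have "0 < \<bar>n - m\<bar>" "\<bar>n - m\<bar> < 1" using assms(1,2) by linarith+
  then show False by linarith
qed

text \<open>Labels are continuous on the arc without its end points, which correspond to the
  parameters 0 and 1 of the path.\<close>

lemma semicirc_path_interior:
  assumes "Im c = 0" "h > 0" "s \<in> {0<..<1}"
  shows "semicirc_path c h s \<in> semicirc c h - {c + of_real h, c - of_real h}"
proof -
  have s: "sin (pi * s) > 0" using assms(3) by (intro sin_gt_zero) auto
  have e: "exp (\<i> * of_real pi * of_real s) = Complex (cos (pi * s)) (sin (pi * s))"
    by (simp add: complex_eq_iff Re_exp Im_exp)
  have im: "Im (semicirc_path c h s) = h * sin (pi * s)"
    by (simp add: semicirc_path_def e assms(1))
  have "cmod (exp (\<i> * of_real pi * of_real s)) = 1" by simp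
  then have "cmod (semicirc_path c h s - c) = h"
    using assms(2) by (simp add: semicirc_path_def norm_mult)
  moreover have "h * sin (pi * s) > 0" using assms(2) s by simp
  moreover have "semicirc_path c h s \<noteq> c + of_real h" "semicirc_path c h s \<noteq> c - of_real h"
    using \<open>h * sin (pi * s) > 0\<close> im assms(1) by (auto dest!: arg_cong[of _ _ Im])
  ultimately show ?thesis by (simp add: semicirc_def im)
qed

context dirac
begin

text \<open>\<open>lam\<close> is arbitrary and not the value of a label, so the bound survives even
  if a label were to run to infinity towards the ends of the arc.\<close>

lemma riesz_proj_bounded_semicirc:
  assumes h: "0 < h" "h < 1" and K: "semicirc (of_int m) h \<subseteq> Dh h" "semicirc (of_int m) h \<inter> Aset p q h = {}"
    and f: "continuous_on UNIV f" "compact (closure {y. f y \<noteq> 0})" and x: "x \<in> {0..pi}"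
  obtains B where "\<And>t lam. t \<in> semicirc (of_int m) h \<Longrightarrow> norm (riesz_proj p q t lam (ft f t) x) \<le> B"
proof -
  let ?K = "semicirc (of_int m) h"
  have ck: "compact ?K" by (rule compact_semicirc)
  have im: "\<bar>Im t\<bar> \<le> 1" if "t \<in> ?K" for t
    using abs_Im_le_cmod[of "t - of_int m"] that h by (simp add: semicirc_def)
  obtain C where C: "C > 0" "\<And>s. s \<in> {0..pi} \<Longrightarrow> cmod (p s) \<le> C" "\<And>s. s \<in> {0..pi} \<Longrightarrow> cmod (q s) \<le> C"
    using coefficients_bounded by metis
  define b where "b = 1 + 2 * C"
  have strip: "\<bar>Im lam\<bar> \<le> b" if t: "t \<in> ?K" and s: "simple_eig p q t lam" for t lam
  proof -
    obtain v where "eigvec lam (exp (\<i> * of_real pi * t)) v" by (rule psi_eq[OF s])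
    from eigenvalue_strip[OF C this] im[OF t] show ?thesis by (simp add: b_def)
  qed
  have ne: "?K \<noteq> {}"
  proof -
    have "of_int m + complex_of_real h \<in> ?K" using h by (simp add: semicirc_def)
    then show ?thesis by blast
  qed
  have "continuous_on ?K (\<lambda>t. cmod (sin (of_real pi * t)))" by (intro continuous_intros)
  then obtain t1 where t1: "t1 \<in> ?K" "\<And>t. t \<in> ?K \<Longrightarrow> cmod (sin (of_real pi * t1)) \<le> cmod (sin (of_real pi * t))"
    using continuous_attains_inf[OF ck ne] by metis
  define \<sigma> where "\<sigma> = cmod (sin (of_real pi * t1))"
  have \<sigma>: "\<sigma> > 0" using sin_nonzero_semicirc[OF h t1(1)] by (simp add: \<sigma>_def)
  have b0: "b \<ge> 0" using C(1) by (simp add: b_def)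
  obtain R where R: "\<And>lam t. cmod lam \<ge> R \<Longrightarrow> \<bar>Im lam\<bar> \<le> b \<Longrightarrow>
    hillF p q lam = 2 * cos (of_real pi * t) \<Longrightarrow> cmod (sin (of_real pi * t)) \<ge> \<sigma> \<Longrightarrow>
    cmod (deriv (hillF p q) lam) \<ge> \<sigma>"
    using deriv_hillF_lower_bound[OF b0 \<sigma>] by metis
  \<comment> \<open>All pairs of a point of the arc and an eigenvalue of modulus at most R. On this
    compact set F' has no zero because the arc avoids \<open>Aset\<close>; larger eigenvalues are
    covered by \<open>R\<close>.\<close>
  define Q where "Q = (?K \<times> cball 0 R) \<inter> {z. hillF p q (snd z) = 2 * cos (of_real pi * fst z)}"
  have "closed {z::complex \<times> complex. hillF p q (snd z) = 2 * cos (of_real pi * fst z)}"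
    by (intro closed_Collect_eq continuous_intros continuous_on_compose2[OF continuous_on_hillF[of UNIV]]) auto
  then have Q: "compact Q" unfolding Q_def by (intro compact_Int_closed compact_Times ck) auto
  have dQ: "continuous_on Q (\<lambda>z. cmod (deriv (hillF p q) (snd z)))"
    by (intro continuous_intros continuous_on_compose2[OF continuous_on_deriv_hillF[of UNIV]]) auto
  have nz: "deriv (hillF p q) (snd z) \<noteq> 0" if "z \<in> Q" for z
  proof -
    have z: "fst z \<in> ?K" "hillF p q (snd z) = 2 * cos (of_real pi * fst z)"
      using that by (auto simp: Q_def)
    then have "fst z \<in> Dh h" "fst z \<notin> Aset p q h" using K by auto
    then show ?thesis using z(2) by (auto simp: Aset_def)
  qed
  obtain \<delta>0 where d0: "\<delta>0 > 0" "\<And>z. z \<in> Q \<Longrightarrow> cmod (deriv (hillF p q) (snd z)) \<ge> \<delta>0"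
  proof (cases "Q = {}")
    case False
    obtain z1 where "z1 \<in> Q" "\<And>z. z \<in> Q \<Longrightarrow> cmod (deriv (hillF p q) (snd z1)) \<le> cmod (deriv (hillF p q) (snd z))"
      using continuous_attains_inf[OF Q False dQ] by metis
    then show ?thesis using nz by (intro that[of "cmod (deriv (hillF p q) (snd z1))"]) auto
  qed (auto intro: that[of 1])
  define \<delta> where "\<delta> = min \<sigma> \<delta>0"
  have \<delta>: "\<delta> > 0" using \<sigma> d0 by (simp add: \<delta>_def)
  have low: "\<delta> \<le> cmod (deriv (hillF p q) lam)" if t: "t \<in> ?K" and s: "simple_eig p q t lam" for t lam
  proof -
    have F: "hillF p q lam = 2 * cos (of_real pi * t)" using s by (simp add: simple_eig_def)
    show ?thesis
    proof (cases "cmod lam \<ge> R")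
      case True
      from R[OF True strip[OF t s] F] t1(2)[OF t] show ?thesis by (simp add: \<sigma>_def \<delta>_def)
    next
      case False
      then have "(t, lam) \<in> Q" using t F by (simp add: Q_def)
      from d0(2)[OF this] show ?thesis by (simp add: \<delta>_def)
    qed
  qed
  obtain E where E: "E \<ge> 0" "\<And>lam x. \<bar>Im lam\<bar> \<le> b \<Longrightarrow> x \<in> {0..pi} \<Longrightarrow> norm (csol p q lam x) \<le> E"
    "\<And>lam x. \<bar>Im lam\<bar> \<le> b \<Longrightarrow> x \<in> {0..pi} \<Longrightarrow> norm (ssol p q lam x) \<le> E"
    using sol_bounded_strip[of b] by metis
  obtain G where G: "\<And>t s. t \<in> ?K \<Longrightarrow> s \<in> {0..pi} \<Longrightarrow> norm (ft f t s) \<le> G"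
    using ft_bounded[OF f ck] by metis
  define N where "N = 4 * E * (4 * ((E + exp pi) * (2 * pi * G * E)))"
  have G0: "G \<ge> 0" using order_trans[OF norm_ge_zero G[OF t1(1), of 0]] by simp
  have N0: "N \<ge> 0" using E(1) G0 by (simp add: N_def)
  show ?thesis
  proof (rule that[of "2 * N * (1 / \<delta>)"])
    fix t lam assume t: "t \<in> ?K"
    show "norm (riesz_proj p q t lam (ft f t) x) \<le> 2 * N * (1 / \<delta>)"
    proof (cases "simple_eig p q t lam")
      case True
      have E': "norm (csol p q lam s) \<le> E" "norm (ssol p q lam s) \<le> E" if "s \<in> {0..pi}" for s
        using E(2,3)[OF strip[OF t True] that] by auto
      have "norm (comb lam (numer t lam (ft f t)) x) \<le> 4 * E * norm (numer t lam (ft f t))"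
        by (rule norm_comb_le[OF E'[OF x]])
      also have "\<dots> \<le> N"
        unfolding N_def using im[OF t] E(1)
        by (intro mult_left_mono norm_numer_le[OF E' G[OF t]]) auto
      finally have n: "norm (comb lam (numer t lam (ft f t)) x) \<le> N" .
      have "norm (riesz_proj p q t lam (ft f t) x)
          \<le> 2 * norm (comb lam (numer t lam (ft f t)) x) * (1 / cmod (deriv (hillF p q) lam))"
        by (rule riesz_proj_norm_le[OF True continuous_on_ft_slice[OF f]])
      also have "\<dots> \<le> 2 * N * (1 / \<delta>)"
        using n low[OF t True] \<delta> N0 by (intro mult_mono divide_left_mono mult_pos_pos) auto
      finally show ?thesis .
    qed (use N0 \<delta> in \<open>simp add: riesz_proj_def\<close>)
  qed
qed

text \<open>Contour integrals are scalar, hence the two components. The functional \<open>T\<close>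
  stands for either of them; that it commutes with complex division lets it act on the numerator of
  the formula.\<close>

lemma riesz_proj_contour_integrable:
  assumes h: "0 < h" "h < 1" and K: "semicirc (of_int m) h \<subseteq> Dh h" "semicirc (of_int m) h \<inter> Aset p q h = {}"
    and f: "continuous_on UNIV f" "compact (closure {y. f y \<noteq> 0})" and x: "x \<in> {0..pi}"
    and L: "continuous_on (semicirc (of_int m) h - {of_int m + of_real h, of_int m - of_real h}) L"
  shows "(\<lambda>t. fst (riesz_proj p q t (L t) (ft f t) x)) contour_integrable_on semicirc_path (of_int m) h"
    and "(\<lambda>t. snd (riesz_proj p q t (L t) (ft f t) x)) contour_integrable_on semicirc_path (of_int m) h"
proof -
  obtain B where B: "\<And>t lam. t \<in> semicirc (of_int m) h \<Longrightarrow> norm (riesz_proj p q t lam (ft f t) x) \<le> B"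
    using riesz_proj_bounded_semicirc[OF h K f x] by metis
  let ?g = "semicirc_path (of_int m) h" and ?I = "{0<..<1::real}"
  let ?n = "\<lambda>s. comb (L (?g s)) (numer (?g s) (L (?g s)) (ft f (?g s))) x"
  let ?F = "\<lambda>s. hillF p q (L (?g s)) - 2 * cos (of_real pi * ?g s)"
  let ?F' = "\<lambda>s. deriv (hillF p q) (L (?g s))"
  have cg: "continuous_on A ?g" for A unfolding semicirc_path_def by (intro continuous_intros)
  have cL: "continuous_on ?I (\<lambda>s. L (?g s))"
    by (rule continuous_on_compose2[OF L cg]) (use semicirc_path_interior[OF _ h(1)] in auto)
  have cn: "continuous_on ?I ?n"
    using continuous_on_compose2[OF continuous_on_numer[OF f x] continuous_on_Pair[OF cg cL]] by simp
  have cF: "continuous_on ?I ?F"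
    by (intro continuous_intros cg continuous_on_compose2[OF continuous_on_hillF[of UNIV] cL]) auto
  have cF': "continuous_on ?I ?F'"
    by (intro continuous_on_compose2[OF continuous_on_deriv_hillF[of UNIV] cL]) auto
  have vd: "vector_derivative ?g (at s) = of_real h * (\<i> * of_real pi * exp (\<i> * of_real pi * of_real s))" for s
    unfolding semicirc_path_def
    by (rule vector_derivative_at) (auto intro!: derivative_eq_intros has_vector_derivative_real_field)
  have cv: "continuous_on A (\<lambda>s. vector_derivative ?g (at s))" for A
    unfolding vd by (intro continuous_intros)
  have main: "(\<lambda>t. T (riesz_proj p q t (L t) (ft f t) x)) contour_integrable_on ?g"
    if T: "bounded_linear T" "\<And>w. cmod (T w) \<le> norm w" "\<And>a b d. T (a / d, b / d) = T (a, b) / d" "T 0 = 0"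
    for T :: "complex \<times> complex \<Rightarrow> complex"
    \<comment> \<open>Passing to the open parameter interval removes the end points of the arc,
      where the label need not be continuous.\<close>
    unfolding contour_integrable_on integrable_on_Icc_iff_Ioo
  proof (rule measurable_bounded_by_integrable_imp_integrable)
    have [measurable]: "(\<lambda>s. T (?n s)) \<in> borel_measurable (lebesgue_on ?I)" "?F \<in> borel_measurable (lebesgue_on ?I)"
      "?F' \<in> borel_measurable (lebesgue_on ?I)" "(\<lambda>s. vector_derivative ?g (at s)) \<in> borel_measurable (lebesgue_on ?I)"
      by (intro continuous_imp_measurable_on_sets_lebesgue bounded_linear.continuous_on[OF T(1)] cn cF cF' cv; simp)+
    have "(\<lambda>s. T (riesz_proj p q (?g s) (L (?g s)) (ft f (?g s)) x) * vector_derivative ?g (at s))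
       = (\<lambda>s. (if ?F s = 0 \<and> ?F' s \<noteq> 0 then T (?n s) / ?F' s else 0) * vector_derivative ?g (at s))"
    proof
      fix s
      have "T (riesz_proj p q (?g s) (L (?g s)) (ft f (?g s)) x) = (if ?F s = 0 \<and> ?F' s \<noteq> 0 then T (?n s) / ?F' s else 0)"
      proof (cases "simple_eig p q (?g s) (L (?g s))")
        case True
        show ?thesis
          unfolding riesz_proj_formula[OF True continuous_on_ft_slice[OF f]] T(3)
          using True by (simp add: simple_eig_def)
      next
        case False
        then have "\<not> (?F s = 0 \<and> ?F' s \<noteq> 0)" by (simp add: simple_eig_def)
        with False show ?thesis by (simp add: riesz_proj_def T(4) del: eq_iff_diff_eq_0)
      qed
      then show "T (riesz_proj p q (?g s) (L (?g s)) (ft f (?g s)) x) * vector_derivative ?g (at s)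
        = (if ?F s = 0 \<and> ?F' s \<noteq> 0 then T (?n s) / ?F' s else 0) * vector_derivative ?g (at s)" by simp
    qed
    then show "(\<lambda>s. T (riesz_proj p q (?g s) (L (?g s)) (ft f (?g s)) x) * vector_derivative ?g (at s))
       \<in> borel_measurable (lebesgue_on ?I)" by (simp only:) measurable
    show "(\<lambda>s::real. B * (h * pi)) integrable_on ?I"
      unfolding integrable_on_Icc_iff_Ioo[symmetric] by (rule integrable_const_ivl)
    fix s assume s: "s \<in> ?I"
    have gs: "?g s \<in> semicirc (of_int m) h" using semicirc_path_interior[OF _ h(1) s] by auto
    have "cmod (vector_derivative ?g (at s)) = h * pi" using h unfolding vd by (simp add: norm_mult)
    then show "cmod (T (riesz_proj p q (?g s) (L (?g s)) (ft f (?g s)) x) * vector_derivative ?g (at s)) \<le> B * (h * pi)"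
      unfolding norm_mult using order_trans[OF T(2) B[OF gs]] h by (simp add: mult_right_mono)
  qed simp
  show "(\<lambda>t. fst (riesz_proj p q t (L t) (ft f t) x)) contour_integrable_on ?g"
    by (rule main[OF bounded_linear_fst]) (auto intro: order_trans[OF norm_fst_le])
  show "(\<lambda>t. snd (riesz_proj p q t (L t) (ft f t) x)) contour_integrable_on ?g"
    by (rule main[OF bounded_linear_snd]) (auto intro: order_trans[OF norm_snd_le])
qed

end

theorem theorem4:
  fixes p q :: "real \<Rightarrow> complex"
    and lamf :: "int \<Rightarrow> nat \<Rightarrow> complex \<Rightarrow> complex"
    and f :: "real \<Rightarrow> complex \<times> complex"
    and h :: real and n :: int and j :: nat and x :: real
  assumes per_p: "\<And>y. p (y + pi) = p y" and per_q: "\<And>y. q (y + pi) = q y"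
    and bv_p: "bv_on p 0 pi" and bv_q: "bv_on q 0 pi"
    and label_mult: "\<And>t mu. card {(m, i). i \<in> {1::nat, 2} \<and> lamf m i t = mu} =
          (if hillF p q mu = 2 * cos (complex_of_real pi * t)
           then nat (zorder (\<lambda>z. hillF p q z - 2 * cos (complex_of_real pi * t)) mu) else 0)"
    and label_cont_real: "\<And>m i. i \<in> {1, 2} \<Longrightarrow> continuous_on UNIV (\<lambda>r::real. lamf m i (of_real r))"
    and label_cont_arc0: "\<And>m i. i \<in> {1, 2} \<Longrightarrow>
          continuous_on (semicirc 0 h - {of_real h, - of_real h}) (lamf m i)"
    and label_cont_arc1: "\<And>m i. i \<in> {1, 2} \<Longrightarrow>
          continuous_on (semicirc 1 h - {1 + of_real h, 1 - of_real h}) (lamf m i)"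
    and f_cont: "continuous_on UNIV f"
    and f_supp: "compact (closure {y. f y \<noteq> 0})"
    and h_pos: "0 < h" and h_small: "h < 1 / 10"
    and h_notA: "complex_of_real h \<notin> closure (Aset p q h)"
    and arc0_A: "semicirc 0 h \<inter> Aset p q h = {}"
    and arc1_A: "semicirc 1 h \<inter> Aset p q h = {}"
    and j12: "j \<in> {1, 2}"
    and x_in: "x \<in> {0..pi}"
  shows
    "(\<lambda>t. riesz_proj p q (of_real t) (lamf n j (of_real t)) (ft f (of_real t)) x)
        absolutely_integrable_on Eset p q h
     \<and> (\<lambda>t. fst (riesz_proj p q t (lamf n j t) (ft f t) x)) contour_integrable_on semicirc_path 0 h
     \<and> (\<lambda>t. snd (riesz_proj p q t (lamf n j t) (ft f t) x)) contour_integrable_on semicirc_path 0 h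
     \<and> (\<lambda>t. fst (riesz_proj p q t (lamf n j t) (ft f t) x)) contour_integrable_on semicirc_path 1 h
     \<and> (\<lambda>t. snd (riesz_proj p q t (lamf n j t) (ft f t) x)) contour_integrable_on semicirc_path 1 h
     \<and> (\<not> is_ESS p q lamf (lamf n j 0) \<longrightarrow>
          (\<lambda>t. riesz_proj p q (of_real t) (lamf n j (of_real t)) (ft f (of_real t)) x)
            absolutely_integrable_on {-h<..<h})
     \<and> (\<not> is_ESS p q lamf (lamf n j 1) \<longrightarrow>
          (\<lambda>t. riesz_proj p q (of_real t) (lamf n j (of_real t)) (ft f (of_real t)) x)
            absolutely_integrable_on {1-h<..<1+h})"
proof -
  interpret dirac p q by unfold_locales (fact bv_p bv_q)+
  let ?P = "\<lambda>t. riesz_proj p q (of_real t) (lamf n j (of_real t)) (ft f (of_real t)) x"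
  note L = label_cont_real[OF j12, of n]
  \<comment> \<open>Integrability holds on all of \<open>Bset\<close>; \<open>Eset\<close> is then a
    measurable subset.\<close>
  have "?P absolutely_integrable_on ({h..1 - h} \<union> {1 + h..2 - h})"
    using riesz_proj_integrable_off_integers[OF L f_cont f_supp x_in, of 0 h "1 - h"]
      riesz_proj_integrable_off_integers[OF L f_cont f_supp x_in, of 1 "1 + h" "2 - h"] h_pos
    by (intro absolutely_integrable_Un) auto
  then have E: "?P absolutely_integrable_on Eset p q h"
    by (rule set_integrable_subset[OF _ Eset_measurable]) (auto simp: Eset_def Bset_def)
  have D: "semicirc 0 h \<subseteq> Dh h" "semicirc 1 h \<subseteq> Dh h"
  proof -
    \<comment> \<open>Both circles of radius h fit into the rectangle: real parts lie between -h and
      1 + h, and h < 1/10 gives 1 + h \<le> 2 - h.\<close>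
    have "t \<in> Dh h" if "cmod (t - of_int m) = h" "m = 0 \<or> m = 1" for t m
      using abs_Re_le_cmod[of "t - of_int m"] abs_Im_le_cmod[of "t - of_int m"] that h_small h_pos
      by (auto simp: Dh_def abs_le_iff)
    from this[of _ 0] this[of _ 1] show "semicirc 0 h \<subseteq> Dh h" "semicirc 1 h \<subseteq> Dh h"
      by (auto simp: semicirc_def)
  qed
  have h1: "h < 1" using h_small by simp
  have arcs0: "(\<lambda>t. fst (riesz_proj p q t (lamf n j t) (ft f t) x)) contour_integrable_on semicirc_path 0 h"
     "(\<lambda>t. snd (riesz_proj p q t (lamf n j t) (ft f t) x)) contour_integrable_on semicirc_path 0 h"
    using riesz_proj_contour_integrable[OF h_pos h1 _ _ f_cont f_supp x_in, of 0 "lamf n j"]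
      D(1) arc0_A label_cont_arc0[OF j12, of n] by simp_all
  have arcs1: "(\<lambda>t. fst (riesz_proj p q t (lamf n j t) (ft f t) x)) contour_integrable_on semicirc_path 1 h"
     "(\<lambda>t. snd (riesz_proj p q t (lamf n j t) (ft f t) x)) contour_integrable_on semicirc_path 1 h"
    using riesz_proj_contour_integrable[OF h_pos h1 _ _ f_cont f_supp x_in, of 1 "lamf n j"]
      D(2) arc1_A label_cont_arc1[OF j12, of n] by simp_all
  have ess: "?P absolutely_integrable_on {t0 - h<..<t0 + h}"
    if ne: "\<not> is_ESS p q lamf (lamf n j (of_real t0))" and t0: "t0 = of_int m" "t0 \<in> {-1<..1}" for t0 :: real and m
  proof -
    \<comment> \<open>The negated ESS condition, read at the given label and at \<open>t0\<close>
      itself, yields one radius on which 1/\<alpha> is integrable.\<close>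
    obtain e where "e > 0" "(\<lambda>t. 1 / alpha_abs p q (of_real t) (lamf n j (of_real t)))
        absolutely_integrable_on {t0 - e<..<t0 + e}"
      using ne t0(2) j12 unfolding is_ESS_def by blast
    then show ?thesis
      by (rule riesz_proj_integrable_at_integer[OF L f_cont f_supp x_in t0(1) h_pos h1])
  qed
  show ?thesis
    using E arcs0 arcs1 ess[of 0 0] ess[of 1 1] by auto
qed

end
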